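(* Let $c>0$, $c\neq1$, $0<\delta<1$, and $\lambda=i\log(c)/\pi$. Locally uniformly for $x$ and $y$ on $(-\delta,\delta)$, $$\lim_{n\to\infty}\frac\pi n\,K_n\left(\frac{\pi x}{n},\frac{\pi y}{n}\right)=K_\infty(x,y),$$ where, for $x\ne y$, $$K_\infty(x,y)=\frac{1}{h(0)\,\pi i}\,\frac{\log c}{c^2-1}\,\frac{G(1+\lambda;2\pi ix)\,G(\lambda;2\pi iy)-G(1+\lambda;2\pi iy)\,G(\lambda;2\pi ix)}{x-y},$$ and, for $x=y$, $$K_\infty(x,x)=\frac{2}{h(0)}\,\frac{\log c}{c^2-1}\Big(G'(1+\lambda;2\pi ix)\,G(\lambda;2\pi ix)-G(1+\lambda;2\pi ix)\,G'(\lambda;2\pi ix)\Big).$$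
   Context: Let $\alpha,\beta>-1$ and let $h$ be real analytic and strictly positive on $[-1,1]$. Let $w_c(x) = (1-x)^\alpha(1+x)^\beta h(x)\,\Xi_c(x)$, $x\in[-1,1]$, where $\Xi_c(x)=1$ for $x\in[-1,0)$ and $\Xi_c(x)=c^2$ for $x\in[0,1]$. Let $p_n$ be the orthonormal polynomials with respect to $w_c$ on $[-1,1]$, and let $K_n(x,y)=\sum_{k=0}^{n-1}p_k(x)p_k(y)$ be the Christoffel–Darboux kernel. $G(a;\zeta)={}_1F_1(a;1;\zeta)e^{-\zeta/2}=e^{-\zeta/2}\sum_{k=0}^\infty\frac{(a)_k}{(k!)^2}\zeta^k$, where ${}_1F_1$ is the confluent hypergeometric function and $(a)_k$ the Pochhammer symbol; $G'$ denotes the derivative with respect to $\zeta$. *)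

theory Defs
  imports "HOL-Analysis.Analysis" "HOL-Computational_Algebra.Polynomial"
begin

(* At points of S that are not interior to S (such as the endpoints of a closed
   interval) the expansion is only required on the part of the ball inside S;
   the sum of the power series then extends f analytically across the point. *)
definition real_analytic_on :: "(real \<Rightarrow> real) \<Rightarrow> real set \<Rightarrow> bool"
    (infixl "real'_analytic'_on" 50) where
  "f real_analytic_on S \<longleftrightarrow>
     (\<forall>x\<in>S. \<exists>r>0. \<exists>a. \<forall>y\<in>ball x r \<inter> S. (\<lambda>k. a k * (y - x) ^ k) sums f y)"

definition jump :: "real \<Rightarrow> real \<Rightarrow> real" where
  "jump c x = (if x < 0 then 1 else c\<^sup>2)"

(* Since 0 powr a = 0, the value at an endpoint with a nonpositive exponent differs
   from the customary one; this affects only a null set. *)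
definition jump_jacobi_weight ::
    "real \<Rightarrow> real \<Rightarrow> (real \<Rightarrow> real) \<Rightarrow> real \<Rightarrow> real \<Rightarrow> real" where
  "jump_jacobi_weight \<alpha> \<beta> h c x = (1 - x) powr \<alpha> * (1 + x) powr \<beta> * h x * jump c x"

definition orthonormal_polys :: "(real \<Rightarrow> real) \<Rightarrow> (nat \<Rightarrow> real poly) \<Rightarrow> bool" where
  "orthonormal_polys w p \<longleftrightarrow>
     (\<forall>n. degree (p n) = n \<and> lead_coeff (p n) > 0) \<and>
     (\<forall>m n. (LINT x:{-1..1}|lborel. poly (p m) x * poly (p n) x * w x) = (if m = n then 1 else 0))"

definition christoffel_darboux :: "(nat \<Rightarrow> real poly) \<Rightarrow> nat \<Rightarrow> real \<Rightarrow> real \<Rightarrow> real" where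
  "christoffel_darboux p n x y = (\<Sum>k<n. poly (p k) x * poly (p k) y)"

definition hyp_1F1 :: "complex \<Rightarrow> complex \<Rightarrow> complex \<Rightarrow> complex" where
  "hyp_1F1 a b z = eval_fps (fps_hypergeo [a] [b] 1) z"

definition G :: "complex \<Rightarrow> complex \<Rightarrow> complex" where
  "G a \<zeta> = hyp_1F1 a 1 \<zeta> * exp (- \<zeta> / 2)"

lemma G_series: "G a \<zeta> = exp (- \<zeta> / 2) * (\<Sum>k. pochhammer a k / (fact k)\<^sup>2 * \<zeta> ^ k)"
  by (simp add: G_def hyp_1F1_def eval_fps_def pochhammer_fact [symmetric] power2_eq_square)

definition jump_exponent :: "real \<Rightarrow> complex" where
  "jump_exponent c = \<i> * of_real (ln c) / of_real pi"

definition K_inf :: "(real \<Rightarrow> real) \<Rightarrow> real \<Rightarrow> real \<Rightarrow> real \<Rightarrow> complex" where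
  "K_inf h c x y =
     (let l = jump_exponent c;
          u = 2 * of_real pi * \<i> * of_real x;
          v = 2 * of_real pi * \<i> * of_real y
      in if x \<noteq> y
         then 1 / (of_real (h 0) * of_real pi * \<i>) * of_real (ln c / (c\<^sup>2 - 1)) *
              ((G (1 + l) u * G l v - G (1 + l) v * G l u) / of_real (x - y))
         else 2 / of_real (h 0) * of_real (ln c / (c\<^sup>2 - 1)) *
              (deriv (G (1 + l)) u * G l u - G (1 + l) u * deriv (G l) u))"

end

theory Submission
  imports Defs
begin

text \<open>
  For real numbers \<open>s\<close>, \<open>t\<close> the quadratic form \<open>s\<^sup>2 K\<^sub>n(a,a) + 2st K\<^sub>n(a,b) + t\<^sup>2 K\<^sub>n(b,b)\<close> is the
  maximum of \<open>\<bar>s P(a) + t P(b)\<bar>\<^sup>2\<close> over all polynomials of degree less than \<open>n\<close> with unit norm in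
  \<open>L\<^sup>2(w\<^sub>c)\<close>. Such extremal values can be compared between different weights: substituting \<open>x = sin \<theta>\<close>
  and multiplying an extremal polynomial by a trigonometric polynomial of degree \<open>\<epsilon>n\<close> that is close to
  1 near the jump and exponentially small elsewhere, one sees that only the behaviour of the weight at
  the jump matters, up to factors tending to 1 as \<open>\<epsilon> \<rightarrow> 0\<close>.

  The weight is thus exchanged for \<open>exp (- \<theta> ln c / pi)\<close> on the unit circle, scaled so that its
  only jump, at \<open>\<theta> = 0\<close>, is from 1 to \<open>c\<^sup>2\<close>. Its moments are multiples of \<open>1 / (m + \<lambda>)\<close>, its
  orthogonal polynomials are the hypergeometric polynomials \<open>2F1(-n, 1+\<lambda>; 1; 1-z)\<close>, and in the
  Christoffel-Darboux formula, written with divided differences, one can pass to the limit termwise.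
  Polarization then gives the limit of \<open>K\<^sub>n(a,b)\<close> itself.
\<close>

section \<open>Hypergeometric polynomials on the unit circle\<close>

text \<open>Over one turn of the circle the model weight changes exponentially from
  \<open>c^2\<close> back to 1, so no second discontinuity arises and integrals against it reduce to
  boundary terms at the jump. The price is asymmetry. Polynomials in \<open>sin \<theta>\<close> are
  the trigonometric polynomials invariant under the reflection of \<open>\<theta>\<close> to
  \<open>pi - \<theta>\<close>, and the weight is not invariant. An extremal function on the circle
  must therefore be symmetrized, which requires its mirror image to be small in norm and to vanish
  at the evaluation points. The localizer costs about \<open>\<epsilon> n\<close> degrees in either
  direction. Each comparison thus sees the model kernel dilated by \<open>1 + \<epsilon>\<close> or
  \<open>1 - \<epsilon>\<close>, and the limit \<open>\<epsilon> \<rightarrow> 0\<close> needs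
  continuity of the limit kernel. Bounds on the diagonal alone would not give the off-diagonal
  values, hence two points at once; real \<open>s\<close> and \<open>t\<close> suffice because the
  limit kernel is real and symmetric. Every limit lets \<open>n\<close> and the points move
  together, which yields uniformity on compact sets and, with divided differences, treats
  \<open>x = y\<close> on the same footing.\<close>

definition circ_poly :: "complex \<Rightarrow> nat \<Rightarrow> complex poly" where
  "circ_poly a n = (\<Sum>k\<le>n. smult (of_nat (n choose k) * pochhammer a k / fact k) ([:-1, 1:] ^ k))"

lemma poly_circ_poly:
  "poly (circ_poly a n) z = (\<Sum>k\<le>n. of_nat (n choose k) * pochhammer a k / fact k * (z - 1) ^ k)"
  by (simp add: circ_poly_def poly_sum)

lemma degree_circ_poly_le: "degree (circ_poly a n) \<le> n"
  unfolding circ_poly_def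
proof (rule degree_sum_le)
  fix k assume "k \<in> {..n}"
  have "degree (smult (of_nat (n choose k) * pochhammer a k / fact k) ([:-1, 1:] ^ k)) \<le> degree ([:-1, 1::complex:] ^ k)"
    by (rule degree_smult_le)
  also have "\<dots> \<le> n" using \<open>k \<in> {..n}\<close> by (simp add: degree_linear_power)
  finally show "degree (smult (of_nat (n choose k) * pochhammer a k / fact k) ([:-1, 1:] ^ k)) \<le> n" .
qed simp

lemma coeff_circ_poly: "coeff (circ_poly a n) n = pochhammer a n / fact n"
proof -
  have "coeff (circ_poly a n) n = (\<Sum>k\<le>n. (of_nat (n choose k) * pochhammer a k / fact k) * coeff ([:-1, 1:] ^ k) n)"
    by (simp add: circ_poly_def coeff_sum)
  also have "\<dots> = (\<Sum>k\<in>{n}. (of_nat (n choose k) * pochhammer a k / fact k) * coeff ([:-1, 1:] ^ k) n)"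
    by (rule sum.mono_neutral_right) (auto simp: coeff_eq_0 degree_linear_power)
  also have "\<dots> = pochhammer a n / fact n"
    by (simp add: coeff_linear_power)
  finally show ?thesis .
qed

text \<open>The Szego recurrence; the role of the reversed polynomial is played by the parameter \<open>l\<close>.\<close>

lemma circ_poly_recs:
  fixes l z :: complex
  shows "of_nat (Suc n) * poly (circ_poly (1 + l) (Suc n)) z
           = (of_nat (Suc n) + l) * (z * poly (circ_poly (1 + l) n) z) - l * poly (circ_poly l n) z"
    and "of_nat (Suc n) * poly (circ_poly l (Suc n)) z
           = (of_nat (Suc n) - l) * poly (circ_poly l n) z + l * (z * poly (circ_poly (1 + l) n) z)"
proof -
  define c where "c m a k = of_nat (m choose k) * pochhammer a k / fact k" for m k and a :: complex
  \<comment> \<open>Powers of \<open>u = z - 1\<close> are the natural basis: multiplying by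
    \<open>z = 1 + u\<close> adds to a coefficient sequence its shift \<open>d\<close>, so both
    recurrences reduce to one identity per coefficient.\<close>
  define d where "d a k = (case k of 0 \<Rightarrow> 0 | Suc j \<Rightarrow> c n a j)" for k and a :: complex
  define u where "u = z - 1"
  have F: "poly (circ_poly a m) z = (\<Sum>k\<le>m. c m a k * u ^ k)" for a m
    by (simp add: poly_circ_poly c_def u_def)
  have F': "poly (circ_poly a n) z = (\<Sum>k\<le>Suc n. c n a k * u ^ k)" for a
    by (simp add: F) (simp add: c_def)
  have "u * poly (circ_poly a n) z = (\<Sum>k\<le>Suc n. d a k * u ^ k)" for a
    unfolding F sum.atMost_Suc_shift[of _ n] by (simp add: d_def sum_distrib_left algebra_simps)
  then have G: "z * poly (circ_poly a n) z = (\<Sum>k\<le>Suc n. (c n a k + d a k) * u ^ k)" for a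
    unfolding distrib_right sum.distrib F'[symmetric] by (simp add: u_def algebra_simps)
  have coef: "of_nat (Suc n) * c (Suc n) (1 + l) k
        = (of_nat (Suc n) + l) * (c n (1 + l) k + d (1 + l) k) - l * c n l k
     \<and> of_nat (Suc n) * c (Suc n) l k
        = (of_nat (Suc n) - l) * c n l k + l * (c n (1 + l) k + d (1 + l) k)" for k
  proof (cases k)
    case 0
    then show ?thesis by (simp add: c_def d_def algebra_simps)
  next
    case (Suc j)
    define p where "p = pochhammer (1 + l) j / fact (Suc j)"
    define X where "X = (of_nat (n choose j) :: complex)"
    define Y where "Y = (of_nat (n choose Suc j) :: complex)"
    have nz: "(1 + of_nat j :: complex) \<noteq> 0"
      by (metis of_nat_Suc of_nat_neq_0)
    have 1: "pochhammer l (Suc j) / fact (Suc j) = l * p"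
      by (simp add: p_def pochhammer_rec add.commute)
    have 2: "pochhammer (1 + l) (Suc j) / fact (Suc j) = (1 + l + of_nat j) * p"
      by (simp add: p_def pochhammer_Suc)
    have 3: "pochhammer (1 + l) j / fact j = (of_nat j + 1) * p"
      using nz by (simp add: p_def add.commute)
    have 4: "of_nat (Suc n choose Suc j) = X + Y"
      by (simp add: X_def Y_def)
    \<comment> \<open>The absorption identity is the only relation between the two binomial
      coefficients that is used; given it, both coefficient identities are polynomial identities in
      \<open>l\<close>, \<open>j\<close>, \<open>n\<close>, \<open>X\<close>, \<open>Y\<close> and
      \<open>p\<close>.\<close>
    have "of_nat (Suc j * (Suc n choose Suc j)) = (of_nat (Suc n * (n choose j)) :: complex)"
      by (simp only: Suc_times_binomial)
    then have 5: "(of_nat j + 1) * (X + Y) = (of_nat n + 1) * X"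
      by (simp only: of_nat_mult 4) (simp add: X_def add.commute)
    have c1: "c (Suc n) (1 + l) k = (X + Y) * ((1 + l + of_nat j) * p)"
      unfolding c_def Suc times_divide_eq_right[symmetric] 4 2 ..
    have c2: "c n (1 + l) k = Y * ((1 + l + of_nat j) * p)"
      unfolding c_def Suc times_divide_eq_right[symmetric] Y_def[symmetric] 2 ..
    have c3: "c (Suc n) l k = (X + Y) * (l * p)"
      unfolding c_def Suc times_divide_eq_right[symmetric] 4 1 ..
    have c4: "c n l k = Y * (l * p)"
      unfolding c_def Suc times_divide_eq_right[symmetric] Y_def[symmetric] 1 ..
    have c5: "d (1 + l) k = X * ((of_nat j + 1) * p)"
      unfolding d_def c_def Suc nat.case times_divide_eq_right[symmetric] X_def[symmetric] 3 ..
    define N where "N = (of_nat n + 1 :: complex)"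
    define m where "m = (of_nat j + 1 :: complex)"
    have 5: "m * (X + Y) = N * X" using 5 by (simp add: N_def m_def)
    have "N * ((X + Y) * ((l + m) * p)) = N * p * (l * (X + Y) + m * (X + Y))"
      by (simp add: algebra_simps)
    also have "\<dots> = p * ((N + l) * (l * Y + N * X) - l * (Y * l))"
      unfolding 5 by (simp add: algebra_simps)
    also have "\<dots> = (N + l) * (Y * ((l + m) * p) + X * (m * p)) - l * (Y * (l * p))"
      unfolding 5[symmetric] by (simp add: algebra_simps)
    finally have "N * ((X + Y) * ((l + m) * p)) = (N + l) * (Y * ((l + m) * p) + X * (m * p)) - l * (Y * (l * p))" .
    moreover have "N * ((X + Y) * (l * p)) = l * p * (N * X + N * Y)"
      by (simp add: algebra_simps)
    then have "N * ((X + Y) * (l * p)) = (N - l) * (Y * (l * p)) + l * (Y * ((l + m) * p) + X * (m * p))"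
      unfolding 5[symmetric] by (simp add: algebra_simps)
    moreover have "1 + l + of_nat j = l + m" by (simp add: m_def)
    moreover have "of_nat (Suc n) = N" by (simp add: N_def)
    ultimately show ?thesis
      unfolding c1 c2 c3 c4 c5 m_def[symmetric] by (simp only: simp_thms)
  qed
  show "of_nat (Suc n) * poly (circ_poly (1 + l) (Suc n)) z
           = (of_nat (Suc n) + l) * (z * poly (circ_poly (1 + l) n) z) - l * poly (circ_poly l n) z"
    unfolding G
    unfolding F[of _ "Suc n"] F' sum_distrib_left sum_subtractf[symmetric]
  proof (intro sum.cong refl)
    fix k
    have "(of_nat (Suc n) + l) * (x * v) - l * (y * v) = ((of_nat (Suc n) + l) * x - l * y) * v" for x y v :: complex
      by (simp only: distrib_left distrib_right left_diff_distrib mult.assoc)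
    then show "of_nat (Suc n) * (c (Suc n) (1 + l) k * u ^ k) = (of_nat (Suc n) + l) * ((c n (1 + l) k + d (1 + l) k) * u ^ k) - l * (c n l k * u ^ k)"
      by (simp only: mult.assoc[symmetric] coef)
  qed
  show "of_nat (Suc n) * poly (circ_poly l (Suc n)) z
           = (of_nat (Suc n) - l) * poly (circ_poly l n) z + l * (z * poly (circ_poly (1 + l) n) z)"
    unfolding G
    unfolding F[of _ "Suc n"] F' sum_distrib_left sum.distrib[symmetric]
  proof (intro sum.cong refl)
    fix k
    have "(of_nat (Suc n) - l) * (y * v) + l * (x * v) = ((of_nat (Suc n) - l) * y + l * x) * v" for x y v :: complex
      by (simp only: distrib_left distrib_right left_diff_distrib mult.assoc)
    then show "of_nat (Suc n) * (c (Suc n) l k * u ^ k) = (of_nat (Suc n) - l) * (c n l k * u ^ k) + l * ((c n (1 + l) k + d (1 + l) k) * u ^ k)"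
      by (simp only: mult.assoc[symmetric] coef)
  qed
qed

text \<open>For imaginary \<open>l\<close> and \<open>cnj z = 1 / z\<close>, conjugating one Szego
  recurrence and multiplying by a power of \<open>z\<close> produces the other. Thus
  \<open>circ_poly l n\<close> is the reversed polynomial of
  \<open>circ_poly (1 + l) n\<close>.\<close>

lemma circ_poly_reversal:
  assumes l: "cnj l = - l" and z: "norm z = 1"
  shows "poly (circ_poly l n) z = z ^ n * cnj (poly (circ_poly (1 + l) n) z)"
proof -
  have zz: "z * cnj z = 1"
    using z by (simp add: complex_norm_square[symmetric])
  \<comment> \<open>Each recurrence mixes both families, so the induction carries the two reversal
    formulas together.\<close>
  have "poly (circ_poly l n) z = z ^ n * cnj (poly (circ_poly (1 + l) n) z) \<and>
        poly (circ_poly (1 + l) n) z = z ^ n * cnj (poly (circ_poly l n) z)"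
  proof (induction n)
    case 0
    then show ?case by (simp add: poly_circ_poly)
  next
    case (Suc n)
    define A where "A = poly (circ_poly l n) z"
    define B where "B = poly (circ_poly (1 + l) n) z"
    have IH: "z ^ n * cnj B = A" "z ^ n * cnj A = B"
      using Suc[THEN conjunct1, symmetric] Suc[THEN conjunct2, symmetric] unfolding A_def B_def by - assumption+
    note r = circ_poly_recs[where n = n and l = l and z = z, folded A_def B_def]
    have sn: "(of_nat (Suc n) :: complex) \<noteq> 0" by (metis of_nat_neq_0)
    have "of_nat (Suc n) * (z ^ Suc n * cnj (poly (circ_poly (1 + l) (Suc n)) z))
        = z ^ Suc n * cnj (of_nat (Suc n) * poly (circ_poly (1 + l) (Suc n)) z)"
      by simp
    also have "\<dots> = z ^ Suc n * ((of_nat (Suc n) - l) * (cnj z * cnj B) + l * cnj A)"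
      unfolding r using l by simp
    also have "\<dots> = (of_nat (Suc n) - l) * ((z * cnj z) * (z ^ n * cnj B)) + l * (z * (z ^ n * cnj A))"
      by (simp add: algebra_simps)
    also have "\<dots> = of_nat (Suc n) * poly (circ_poly l (Suc n)) z"
      unfolding r zz mult_1_left IH ..
    finally have 1: "poly (circ_poly l (Suc n)) z = z ^ Suc n * cnj (poly (circ_poly (1 + l) (Suc n)) z)"
      using sn by (metis mult_cancel_left)
    have "of_nat (Suc n) * (z ^ Suc n * cnj (poly (circ_poly l (Suc n)) z))
        = z ^ Suc n * cnj (of_nat (Suc n) * poly (circ_poly l (Suc n)) z)"
      by simp
    also have "\<dots> = z ^ Suc n * ((of_nat (Suc n) + l) * cnj A - l * (cnj z * cnj B))"
      unfolding r using l by simp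
    also have "\<dots> = (of_nat (Suc n) + l) * (z * (z ^ n * cnj A)) - l * ((z * cnj z) * (z ^ n * cnj B))"
      by (simp add: algebra_simps)
    also have "\<dots> = of_nat (Suc n) * poly (circ_poly (1 + l) (Suc n)) z"
      unfolding r zz mult_1_left IH ..
    finally have 2: "poly (circ_poly (1 + l) (Suc n)) z = z ^ Suc n * cnj (poly (circ_poly l (Suc n)) z)"
      using sn by (metis mult_cancel_left)
    from 1 2 show ?case by blast
  qed
  then show ?thesis by blast
qed

text \<open>Telescoping: up to powers of \<open>w\<close>, one step of the recurrences changes the
  determinant on the right by precisely the next summand. Conjugates are replaced by
  \<open>poly (circ_poly l k) w / w ^ k\<close>, so the identity is algebraic and holds off the unit
  circle as well.\<close>

lemma circ_poly_christoffel_darboux: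
  fixes w z l :: complex
  assumes "w \<noteq> 0"
  shows "w ^ n * ((w - z) * (\<Sum>k<n. poly (circ_poly (1 + l) k) z * poly (circ_poly l k) w / w ^ k))
       = w * (poly (circ_poly l n) z * poly (circ_poly (1 + l) n) w
            - poly (circ_poly (1 + l) n) z * poly (circ_poly l n) w)"
proof (induction n)
  case 0
  then show ?case by (simp add: poly_circ_poly)
next
  case (Suc n)
  define A where "A = poly (circ_poly l n)"
  define B where "B = poly (circ_poly (1 + l) n)"
  define A' where "A' = poly (circ_poly l (Suc n))"
  define B' where "B' = poly (circ_poly (1 + l) (Suc n))"
  define N where "N = (of_nat (Suc n) :: complex)"
  have N0: "N \<noteq> 0" unfolding N_def by (metis of_nat_neq_0)
  have r: "N * B' x = (N + l) * (x * B x) - l * A x" "N * A' x = (N - l) * A x + l * (x * B x)" for x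
    using circ_poly_recs[of n l x] unfolding A_def A'_def B_def B'_def N_def by auto
  \<comment> \<open>The terms with \<open>A z * A w\<close> and \<open>B z * B w\<close> cancel, and
    \<open>(N + l) * (N - l) + l * l = N^2\<close> is the determinant of the recurrence
    coefficients.\<close>
  have "N^2 * (A' z * B' w - B' z * A' w) = (N * A' z) * (N * B' w) - (N * B' z) * (N * A' w)"
    by (simp add: power2_eq_square algebra_simps)
  also have "\<dots> = N^2 * (w * (A z * B w) - z * (B z * A w))"
    unfolding r by (simp add: power2_eq_square algebra_simps)
  finally have step: "A' z * B' w - B' z * A' w = w * (A z * B w) - z * (B z * A w)"
    using N0 by simp
  have "w ^ Suc n * ((w - z) * (S + B z * A w / w ^ n)) = w * (w ^ n * ((w - z) * S)) + w * ((w - z) * (B z * A w))" for S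
    using assms by (simp add: field_simps)
  then have "w ^ Suc n * ((w - z) * (\<Sum>k<Suc n. poly (circ_poly (1 + l) k) z * poly (circ_poly l k) w / w ^ k))
     = w * (w ^ n * ((w - z) * (\<Sum>k<n. poly (circ_poly (1 + l) k) z * poly (circ_poly l k) w / w ^ k)))
       + w * ((w - z) * (B z * A w))"
    unfolding sum.lessThan_Suc A_def B_def .
  also have "\<dots> = w * (w * (A z * B w - B z * A w) + (w - z) * (B z * A w))"
    by (simp only: Suc A_def B_def) (simp add: algebra_simps)
  also have "\<dots> = w * (A' z * B' w - B' z * A' w)"
    unfolding step by (simp add: algebra_simps)
  finally show ?case unfolding A'_def B'_def .
qed

text \<open>The Chu-Vandermonde identity in the form that evaluates \<open>2F1(-n, b; c; 1)\<close>.\<close>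

lemma alternating_pochhammer_sum:
  fixes b c :: complex
  assumes "\<And>i. c + of_nat i \<noteq> 0"
  shows "(\<Sum>i\<le>n. (-1) ^ i * of_nat (n choose i) * pochhammer b i / pochhammer c i)
       = pochhammer (c - b) n / pochhammer c n"
  using assms
proof (induction n arbitrary: b c)
  case 0
  then show ?case by simp
next
  case (Suc n)
  define t where "t b c i = pochhammer b i / pochhammer c i" for b c :: complex and i
  have nz: "pochhammer c k \<noteq> 0" "pochhammer (c + 1) k \<noteq> 0" for k
  proof -
    show "pochhammer c k \<noteq> 0"
      using Suc.prems by (simp add: pochhammer_eq_0_iff eq_neg_iff_add_eq_0)
    have "c + 1 \<noteq> - of_nat i" for i
      using Suc.prems[of "Suc i"] by (simp add: eq_neg_iff_add_eq_0 add_ac)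
    then show "pochhammer (c + 1) k \<noteq> 0"
      by (auto simp: pochhammer_eq_0_iff)
  qed
  have c0: "c \<noteq> 0" using Suc.prems[of 0] by simp
  have IH1: "(\<Sum>i\<le>n. (-1) ^ i * of_nat (n choose i) * t b c i) = pochhammer (c - b) n / pochhammer c n"
    using Suc.IH[of c b] Suc.prems by (simp add: t_def)
  have "c + 1 + of_nat i \<noteq> 0" for i using Suc.prems[of "Suc i"] by (simp add: algebra_simps)
  then have IH2: "(\<Sum>i\<le>n. (-1) ^ i * of_nat (n choose i) * t (b + 1) (c + 1) i)
      = pochhammer (c - b) n / pochhammer (c + 1) n"
    using Suc.IH[of "c + 1" "b + 1"] by (simp add: t_def)
  have ts: "t b c (Suc i) = b / c * t (b + 1) (c + 1) i" for i
    by (simp add: t_def pochhammer_rec)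
  \<comment> \<open>Pascal's rule splits off a sum that, after an index shift, has parameters
    \<open>b + 1\<close> and \<open>c + 1\<close>; this is why the induction generalizes over
    \<open>b\<close> and \<open>c\<close>.\<close>
  have "(\<Sum>i\<le>Suc n. (-1) ^ i * of_nat (Suc n choose i) * t b c i)
      = (\<Sum>i\<le>Suc n. (-1) ^ i * of_nat (n choose i) * t b c i)
        + (\<Sum>i\<le>Suc n. (-1) ^ i * (case i of 0 \<Rightarrow> 0 | Suc j \<Rightarrow> of_nat (n choose j)) * t b c i)"
    unfolding sum.distrib[symmetric]
    by (intro sum.cong refl) (auto simp: algebra_simps split: nat.split)
  also have "(\<Sum>i\<le>Suc n. (-1) ^ i * of_nat (n choose i) * t b c i)
      = (\<Sum>i\<le>n. (-1) ^ i * of_nat (n choose i) * t b c i)"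
    by simp
  also have "(\<Sum>i\<le>Suc n. (-1) ^ i * (case i of 0 \<Rightarrow> 0 | Suc j \<Rightarrow> of_nat (n choose j)) * t b c i)
      = - (b / c) * (\<Sum>i\<le>n. (-1) ^ i * of_nat (n choose i) * t (b + 1) (c + 1) i)"
    unfolding sum.atMost_Suc_shift[of _ n]
    by (simp add: ts sum_distrib_left sum_negf[symmetric] mult_ac)
  also have "(\<Sum>i\<le>n. (-1) ^ i * of_nat (n choose i) * t b c i) + \<dots>
      = pochhammer (c - b) n / pochhammer c n - b / c * (pochhammer (c - b) n / pochhammer (c + 1) n)"
    unfolding IH1 IH2 by simp
  also have "pochhammer c n = pochhammer c (Suc n) / (c + of_nat n)"
    using Suc.prems[of n] by (simp add: pochhammer_Suc)
  also have "pochhammer (c + 1) n = pochhammer c (Suc n) / c"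
    using c0 by (simp add: pochhammer_rec)
  also have "pochhammer (c - b) n / (pochhammer c (Suc n) / (c + of_nat n))
        - b / c * (pochhammer (c - b) n / (pochhammer c (Suc n) / c))
      = pochhammer (c - b) (Suc n) / pochhammer c (Suc n)"
    using nz(1)[of "Suc n"] c0 Suc.prems[of n]
    by (simp add: pochhammer_Suc[of "c - b"] diff_divide_distrib[symmetric]) (simp add: algebra_simps)
  finally show ?case by (simp add: t_def)
qed

text \<open>The Chu-Vandermonde sum with \<open>b = x\<close> and \<open>c = x + 1\<close>, because
  the quotient of the two Pochhammer symbols is \<open>x / (x + j)\<close>. It evaluates integrals
  of \<open>(cis \<theta> - 1) ^ i\<close> when the moments are proportional to
  \<open>1 / (m + \<lambda>)\<close>.\<close>

lemma binomial_partial_fraction: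
  fixes x :: complex
  assumes "\<And>i. x + of_nat i \<noteq> 0"
  shows "(\<Sum>j\<le>n. (-1) ^ j * of_nat (n choose j) / (x + of_nat j)) = fact n / pochhammer x (Suc n)"
proof -
  have nz: "x + 1 + of_nat i \<noteq> 0" for i using assms[of "Suc i"] by (simp add: algebra_simps)
  have x0: "x \<noteq> 0" using assms[of 0] by simp
  have p: "pochhammer x j / pochhammer (x + 1) j = x / (x + of_nat j)" for j
  proof -
    have "pochhammer x j * (x + of_nat j) = x * pochhammer (x + 1) j"
      using pochhammer_rec[of x j] by (simp add: pochhammer_Suc)
    moreover have "pochhammer (x + 1) j \<noteq> 0"
      using nz by (simp add: pochhammer_eq_0_iff eq_neg_iff_add_eq_0)
    ultimately show ?thesis using assms[of j] by (simp add: field_simps)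
  qed
  have "(\<Sum>j\<le>n. (-1) ^ j * of_nat (n choose j) / (x + of_nat j))
     = (\<Sum>j\<le>n. (-1) ^ j * of_nat (n choose j) * pochhammer x j / pochhammer (x + 1) j) / x"
    unfolding sum_divide_distrib times_divide_eq_right[symmetric] p using x0 by simp
  also have "\<dots> = fact n / pochhammer x (Suc n)"
    by (simp add: alternating_pochhammer_sum[of "x + 1", OF nz] pochhammer_rec pochhammer_fact)
  finally show ?thesis .
qed

section \<open>Confluent hypergeometric limits\<close>

definition kummer :: "complex \<Rightarrow> complex \<Rightarrow> complex" where
  "kummer a z = (\<Sum>k. pochhammer a k / (fact k)\<^sup>2 * z ^ k)"

text \<open>The divided difference of \<open>kummer a\<close>, with the division carried out in each
  power so that it makes sense at \<open>z = w\<close>. \<open>circ_dd\<close> does the same for the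
  circle polynomials, in the shifted variables \<open>z - 1\<close> and
  \<open>w - 1\<close>.\<close>

definition kummer_dd :: "complex \<Rightarrow> complex \<Rightarrow> complex \<Rightarrow> complex" where
  "kummer_dd a z w = (\<Sum>k. pochhammer a k / (fact k)\<^sup>2 * (\<Sum>i<k. z ^ i * w ^ (k - Suc i)))"

definition circ_dd :: "complex \<Rightarrow> nat \<Rightarrow> complex \<Rightarrow> complex \<Rightarrow> complex" where
  "circ_dd a n u v =
     (\<Sum>k\<le>n. of_nat (n choose k) * pochhammer a k / fact k * (\<Sum>i<k. u ^ i * v ^ (k - Suc i)))"

lemma power_diff_sum:
  fixes x y :: "'a::comm_ring_1"
  shows "x ^ n - y ^ n = (x - y) * (\<Sum>i<n. x ^ i * y ^ (n - Suc i))"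
  by (subst power_diff_sumr2) (simp add: mult.commute)

lemma circ_dd_eq:
  "poly (circ_poly a n) z - poly (circ_poly a n) w = (z - w) * circ_dd a n (z - 1) (w - 1)"
proof -
  have "poly (circ_poly a n) z - poly (circ_poly a n) w =
    (\<Sum>k\<le>n. of_nat (n choose k) * pochhammer a k / fact k * ((z - 1) ^ k - (w - 1) ^ k))"
    by (simp add: poly_circ_poly sum_subtractf[symmetric] right_diff_distrib)
  also have "\<dots> = (z - w) * circ_dd a n (z - 1) (w - 1)"
    unfolding power_diff_sum circ_dd_def sum_distrib_left[of "z - w"] by (intro sum.cong refl) simp
  finally show ?thesis .
qed

text \<open>One factorial reduces the Pochhammer symbol to geometric growth; the second factorial in
  the Kummer series is then left for convergence.\<close>

lemma norm_pochhammer_le: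
  fixes a :: complex
  shows "norm (pochhammer a k) / fact k \<le> (1 + norm a) ^ k"
proof (induction k)
  case (Suc k)
  have "norm (a + of_nat k) \<le> norm a + real k"
    using norm_triangle_ineq[of a "of_nat k"] by simp
  also have "\<dots> \<le> (1 + norm a) * real (Suc k)"
    by (simp add: algebra_simps)
  finally have "norm (a + of_nat k) / real (Suc k) \<le> 1 + norm a"
    by (simp add: divide_le_eq)
  then have "norm (pochhammer a k) / fact k * (norm (a + of_nat k) / real (Suc k))
      \<le> (1 + norm a) ^ k * (1 + norm a)"
    using Suc by (intro mult_mono) auto
  then show ?case by (simp add: pochhammer_Suc norm_mult mult.commute del: of_nat_Suc)
qed simp

lemma binomial_over_power_tendsto:
  "(\<lambda>n. real (n choose k) / real n ^ k) \<longlonglongrightarrow> 1 / fact k"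
proof (induction k)
  case 0
  then show ?case by simp
next
  case (Suc k)
  have "(\<lambda>n. real (n - k) / real n) \<longlonglongrightarrow> 1"
  proof (rule Lim_transform_eventually)
    show "(\<lambda>n. 1 - real k * (1 / real n)) \<longlonglongrightarrow> 1"
      using tendsto_diff[OF tendsto_const tendsto_mult[OF tendsto_const lim_1_over_n], of 1 "real k"] by simp
    show "\<forall>\<^sub>F n in sequentially. 1 - real k * (1 / real n) = real (n - k) / real n"
      using eventually_ge_at_top[of "Suc k"] by eventually_elim (simp add: of_nat_diff field_simps)
  qed
  from tendsto_divide[OF tendsto_mult[OF Suc this] tendsto_const[of "real (Suc k)"]]
  have "(\<lambda>n. real (n choose k) / real n ^ k * (real (n - k) / real n) / real (Suc k)) \<longlonglongrightarrow> 1 / fact (Suc k)"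
    by (simp add: mult.commute)
  moreover have "real (n choose k) / real n ^ k * (real (n - k) / real n) / real (Suc k)
      = real (n choose Suc k) / real n ^ Suc k" for n
  proof -
    have "real (Suc k * (n choose Suc k)) = real ((n - k) * (n choose k))"
      by (metis binomial_absorb_comp binomial_absorption)
    then have "real (n choose Suc k) = real (n - k) * real (n choose k) / real (Suc k)"
      by (simp only: of_nat_mult) (simp add: field_simps)
    then show ?thesis by (simp add: mult_ac)
  qed
  ultimately show ?case by simp
qed

lemma binomial_over_power_le: "real (n choose k) / real n ^ k \<le> 1 / fact k"
proof (cases "n = 0")
  case True
  then show ?thesis by (cases k) auto
next
  case False
  have "real ((n choose k) * fact k) \<le> real (n ^ k)"
    using binomial_fact_pow[of n k] by (simp only: of_nat_le_iff)
  with False show ?thesis by (simp add: field_simps)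
qed

text \<open>Tannery's theorem: with \<open>\<nu> t\<close> absorbed into the variables, the binomial
  coefficient over \<open>\<nu> t ^ k\<close> tends to \<open>1 / fact k\<close> and never exceeds
  it, so the terms are dominated by those of an exponential series. The filter is arbitrary so that
  the points may vary with the degree and may merge.\<close>

lemma circ_limits:
  fixes \<nu> :: "'a \<Rightarrow> nat" and u v :: "'a \<Rightarrow> complex" and a z w :: complex
  assumes F: "F \<noteq> bot" and \<nu>: "filterlim \<nu> sequentially F"
    and u: "((\<lambda>t. of_nat (\<nu> t) * u t) \<longlongrightarrow> z) F" and v: "((\<lambda>t. of_nat (\<nu> t) * v t) \<longlongrightarrow> w) F"
  shows "((\<lambda>t. poly (circ_poly a (\<nu> t)) (1 + u t)) \<longlongrightarrow> kummer a z) F"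
    and "((\<lambda>t. circ_dd a (\<nu> t) (u t) (v t) / of_nat (\<nu> t)) \<longlongrightarrow> kummer_dd a z w) F"
proof -
  define R where "R = 1 + max (norm z) (norm w)"
  have R1: "R \<ge> 1" by (simp add: R_def le_max_iff_disj)
  define U where "U t = of_nat (\<nu> t) * u t" for t
  define V where "V t = of_nat (\<nu> t) * v t" for t
  have U: "(U \<longlongrightarrow> z) F" and V: "(V \<longlongrightarrow> w) F"
    using u v by (simp_all add: U_def[abs_def] V_def[abs_def])
  have "\<forall>\<^sub>F t in F. norm (U t) < R" "\<forall>\<^sub>F t in F. norm (V t) < R"
    using order_tendstoD(2)[OF tendsto_norm[OF U], of R] order_tendstoD(2)[OF tendsto_norm[OF V], of R]
    by (auto simp: R_def)
  moreover have pos: "\<forall>\<^sub>F t in F. \<nu> t > 0"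
    by (rule eventually_compose_filterlim[OF eventually_gt_at_top \<nu>])
  ultimately have ev: "\<forall>\<^sub>F t in F. norm (U t) \<le> R \<and> norm (V t) \<le> R \<and> \<nu> t > 0"
    by eventually_elim auto
  define b where "b k t = (of_nat (\<nu> t choose k) :: complex) / of_nat (\<nu> t) ^ k * (pochhammer a k / fact k)" for k t
  have blim: "((\<lambda>t. b k t) \<longlongrightarrow> pochhammer a k / (fact k)\<^sup>2) F" for k
  proof -
    have "((\<lambda>t. complex_of_real (real (\<nu> t choose k) / real (\<nu> t) ^ k)) \<longlongrightarrow> complex_of_real (1 / fact k)) F"
      by (intro tendsto_of_real filterlim_compose[OF binomial_over_power_tendsto \<nu>])
    from tendsto_mult[OF this tendsto_const[of "pochhammer a k / fact k"]]
    show ?thesis by (simp add: b_def power2_eq_square)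
  qed
  define q where "q = 1 + norm a"
  have q1: "q \<ge> 1" by (simp add: q_def)
  have bbound: "norm (b k t) \<le> q ^ k / fact k" for k t
  proof -
    have "norm (b k t) = real (\<nu> t choose k) / real (\<nu> t) ^ k * (norm (pochhammer a k) / fact k)"
      by (simp add: b_def norm_mult norm_divide norm_power)
    also have "\<dots> \<le> 1 / fact k * q ^ k"
      unfolding q_def by (intro mult_mono binomial_over_power_le norm_pochhammer_le) auto
    finally show ?thesis by simp
  qed
  have summ: "summable (\<lambda>k. r ^ k / fact k)" for r :: real
    using summable_exp[of r] by (simp add: divide_inverse mult.commute)
  have "((\<lambda>t. \<Sum>k. b k t * U t ^ k) \<longlongrightarrow> (\<Sum>k. pochhammer a k / (fact k)\<^sup>2 * z ^ k)) F"
  proof (intro conjunct2[OF conjunct2[OF tannerys_theorem]])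
    show "((\<lambda>t. b k t * U t ^ k) \<longlongrightarrow> pochhammer a k / (fact k)\<^sup>2 * z ^ k) F" for k
      by (intro tendsto_mult blim tendsto_power U)
    show "summable (\<lambda>k. (q * R) ^ k / fact k)" by (rule summ)
    have "\<forall>\<^sub>F x in at_top \<times>\<^sub>F F. norm (U (snd x)) \<le> R \<and> norm (V (snd x)) \<le> R \<and> \<nu> (snd x) > 0"
      using eventually_prodI[OF eventually_True ev, of at_top] by simp
    then show "\<forall>\<^sub>F (k, t) in at_top \<times>\<^sub>F F. norm (b k t * U t ^ k) \<le> (q * R) ^ k / fact k"
    proof eventually_elim
      case (elim x)
      obtain k t where x: "x = (k, t)" by (cases x)
      have "norm (b k t * U t ^ k) \<le> q ^ k / fact k * R ^ k"
        unfolding norm_mult norm_power using elim x R1 q1 bbound[of k t]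
        by (intro mult_mono power_mono) auto
      then show ?case by (simp add: x power_mult_distrib)
    qed
  qed (fact F)
  moreover have "\<forall>\<^sub>F t in F. (\<Sum>k. b k t * U t ^ k) = poly (circ_poly a (\<nu> t)) (1 + u t)"
    using pos
  proof eventually_elim
    case (elim t)
    have "(\<Sum>k. b k t * U t ^ k) = (\<Sum>k\<le>\<nu> t. b k t * U t ^ k)"
      by (rule suminf_finite) (auto simp: b_def)
    also have "\<dots> = poly (circ_poly a (\<nu> t)) (1 + u t)"
      using elim by (simp add: poly_circ_poly b_def U_def power_mult_distrib mult_ac)
    finally show ?case .
  qed
  ultimately show "((\<lambda>t. poly (circ_poly a (\<nu> t)) (1 + u t)) \<longlongrightarrow> kummer a z) F"
    unfolding kummer_def by (rule Lim_transform_eventually)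
  define S where "S x y k = (\<Sum>i<k. x ^ i * y ^ (k - Suc i))" for x y :: complex and k
  have "((\<lambda>t. \<Sum>k. b k t * S (U t) (V t) k) \<longlongrightarrow> (\<Sum>k. pochhammer a k / (fact k)\<^sup>2 * S z w k)) F"
  proof (intro conjunct2[OF conjunct2[OF tannerys_theorem]])
    show "((\<lambda>t. b k t * S (U t) (V t) k) \<longlongrightarrow> pochhammer a k / (fact k)\<^sup>2 * S z w k) F" for k
      unfolding S_def by (intro tendsto_mult blim tendsto_sum tendsto_power U V)
    \<comment> \<open>The factor 2 pays for the \<open>k\<close> summands of \<open>S\<close>, by
      \<open>k \<le> 2 ^ k\<close>.\<close>
    show "summable (\<lambda>k. (2 * q * R) ^ k / fact k)" by (rule summ)
    have "\<forall>\<^sub>F x in at_top \<times>\<^sub>F F. norm (U (snd x)) \<le> R \<and> norm (V (snd x)) \<le> R \<and> \<nu> (snd x) > 0"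
      using eventually_prodI[OF eventually_True ev, of at_top] by simp
    then show "\<forall>\<^sub>F (k, t) in at_top \<times>\<^sub>F F. norm (b k t * S (U t) (V t) k) \<le> (2 * q * R) ^ k / fact k"
    proof eventually_elim
      case (elim x)
      obtain k t where x: "x = (k, t)" by (cases x)
      have "norm (S (U t) (V t) k) \<le> (\<Sum>i<k. R ^ k)"
        unfolding S_def
      proof (rule sum_norm_le)
        fix i assume "i \<in> {..<k}"
        have "norm (U t ^ i * V t ^ (k - Suc i)) \<le> R ^ i * R ^ (k - Suc i)"
          unfolding norm_mult norm_power using elim x R1 by (intro mult_mono power_mono) auto
        also have "\<dots> \<le> R ^ k"
          unfolding power_add[symmetric] using R1 \<open>i \<in> {..<k}\<close> by (intro power_increasing) auto
        finally show "norm (U t ^ i * V t ^ (k - Suc i)) \<le> R ^ k" .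
      qed
      also have "\<dots> = real k * R ^ k" by simp
      also have "\<dots> \<le> 2 ^ k * R ^ k"
        using R1 of_nat_less_two_power[of k, where ?'a = real] by (intro mult_right_mono) auto
      finally have "norm (b k t * S (U t) (V t) k) \<le> q ^ k / fact k * (2 ^ k * R ^ k)"
        unfolding norm_mult using bbound[of k t] q1 by (intro mult_mono) auto
      then show ?case by (simp add: x power_mult_distrib mult_ac)
    qed
  qed (fact F)
  moreover have "\<forall>\<^sub>F t in F. (\<Sum>k. b k t * S (U t) (V t) k) = circ_dd a (\<nu> t) (u t) (v t) / of_nat (\<nu> t)"
    using pos
  proof eventually_elim
    case (elim t)
    have "(\<Sum>k. b k t * S (U t) (V t) k) = (\<Sum>k\<le>\<nu> t. b k t * S (U t) (V t) k)"
      by (rule suminf_finite) (auto simp: b_def)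
    also have "\<dots> = (\<Sum>k\<le>\<nu> t. of_nat (\<nu> t choose k) * pochhammer a k / fact k * S (u t) (v t) k / of_nat (\<nu> t))"
    proof (intro sum.cong refl)
      fix k
      \<comment> \<open>\<open>S\<close> is homogeneous of degree \<open>k - 1\<close>, one less
        than the power of \<open>\<nu> t\<close> in \<open>b k t\<close>; this is the origin of the
        division by \<open>\<nu> t\<close> in the second limit.\<close>
      have "S (U t) (V t) k * of_nat (\<nu> t) = of_nat (\<nu> t) ^ k * S (u t) (v t) k"
        unfolding S_def sum_distrib_left sum_distrib_right
      proof (intro sum.cong refl)
        fix i assume "i \<in> {..<k}"
        then have "(of_nat (\<nu> t) :: complex) ^ k = of_nat (\<nu> t) ^ i * of_nat (\<nu> t) ^ (k - Suc i) * of_nat (\<nu> t)"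
          unfolding power_add[symmetric] power_Suc2[symmetric] by simp
        then show "U t ^ i * V t ^ (k - Suc i) * of_nat (\<nu> t) = of_nat (\<nu> t) ^ k * (u t ^ i * v t ^ (k - Suc i))"
          by (simp add: U_def V_def power_mult_distrib)
      qed
      then have "S (U t) (V t) k = of_nat (\<nu> t) ^ k * S (u t) (v t) k / of_nat (\<nu> t)"
        using elim by (simp add: field_simps)
      then show "b k t * S (U t) (V t) k = of_nat (\<nu> t choose k) * pochhammer a k / fact k * S (u t) (v t) k / of_nat (\<nu> t)"
        using elim by (simp add: b_def)
    qed
    also have "\<dots> = circ_dd a (\<nu> t) (u t) (v t) / of_nat (\<nu> t)"
      by (simp add: circ_dd_def S_def sum_divide_distrib)
    finally show ?case .
  qed
  ultimately show "((\<lambda>t. circ_dd a (\<nu> t) (u t) (v t) / of_nat (\<nu> t)) \<longlongrightarrow> kummer_dd a z w) F"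
    unfolding kummer_dd_def S_def by (rule Lim_transform_eventually)
qed

section \<open>Kummer functions and the limit kernel\<close>

lemma summable_kummer:
  fixes a z :: complex
  shows "summable (\<lambda>k. pochhammer a k / (fact k)\<^sup>2 * z ^ k)"
proof (rule summable_comparison_test')
  show "summable (\<lambda>k. ((1 + norm a) * norm z) ^ k / fact k)"
    using summable_exp[of "(1 + norm a) * norm z"] by (simp add: divide_inverse mult.commute)
  fix k
  have "norm (pochhammer a k / (fact k)\<^sup>2 * z ^ k) = norm (pochhammer a k) / fact k * norm z ^ k / fact k"
    by (simp add: norm_mult norm_divide norm_power power2_eq_square)
  also have "\<dots> \<le> (1 + norm a) ^ k * norm z ^ k / fact k"
    by (intro divide_right_mono mult_right_mono norm_pochhammer_le) auto
  finally show "norm (pochhammer a k / (fact k)\<^sup>2 * z ^ k) \<le> ((1 + norm a) * norm z) ^ k / fact k"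
    by (simp add: power_mult_distrib)
qed

lemma summable_kummer_dd:
  fixes a z :: complex
  shows "summable (\<lambda>k. pochhammer a k / (fact k)\<^sup>2 * (\<Sum>i<k. z ^ i * z ^ (k - Suc i)))"
proof -
  have "(\<lambda>k. diffs (\<lambda>k. pochhammer a k / (fact k)\<^sup>2) k * z ^ k) = (\<lambda>k. pochhammer a (Suc k) / (fact (Suc k))\<^sup>2 * (\<Sum>i<Suc k. z ^ i * z ^ (Suc k - Suc i)))"
  proof
    fix k
    have "(\<Sum>i<Suc k. z ^ i * z ^ (Suc k - Suc i)) = (\<Sum>i<Suc k. z ^ k)"
      by (intro sum.cong refl) (auto simp: power_add[symmetric])
    then show "diffs (\<lambda>k. pochhammer a k / (fact k)\<^sup>2) k * z ^ k
       = pochhammer a (Suc k) / (fact (Suc k))\<^sup>2 * (\<Sum>i<Suc k. z ^ i * z ^ (Suc k - Suc i))"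
      by (simp add: diffs_def)
  qed
  moreover have "summable (\<lambda>k. diffs (\<lambda>k. pochhammer a k / (fact k)\<^sup>2) k * z ^ k)"
    by (rule termdiff_converges_all) (rule summable_kummer)
  ultimately show ?thesis by (subst summable_Suc_iff[symmetric]) simp
qed

lemma kummer_dd_eq: "z \<noteq> w \<Longrightarrow> kummer_dd a z w = (kummer a z - kummer a w) / (z - w)"
proof -
  assume zw: "z \<noteq> w"
  have "kummer a z - kummer a w = (\<Sum>k. pochhammer a k / (fact k)\<^sup>2 * z ^ k - pochhammer a k / (fact k)\<^sup>2 * w ^ k)"
    unfolding kummer_def by (rule suminf_diff) (rule summable_kummer)+
  then have "(kummer a z - kummer a w) / (z - w)
     = (\<Sum>k. (pochhammer a k / (fact k)\<^sup>2 * z ^ k - pochhammer a k / (fact k)\<^sup>2 * w ^ k) / (z - w))"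
    using summable_diff[OF summable_kummer[of a z] summable_kummer[of a w]] by (simp add: suminf_divide)
  also have "\<dots> = kummer_dd a z w"
    unfolding kummer_dd_def right_diff_distrib[symmetric] power_diff_sum using zw by (simp add: mult_ac)
  finally show ?thesis ..
qed

lemma kummer_has_derivative: "(kummer a has_field_derivative kummer_dd a z z) (at z)"
proof -
  let ?c = "\<lambda>k. pochhammer a k / (fact k)\<^sup>2"
  have "DERIV (\<lambda>z. \<Sum>k. ?c k * z ^ k) z :> (\<Sum>k. diffs ?c k * z ^ k)"
    by (rule termdiffs_strong_converges_everywhere) (rule summable_kummer)
  also have "(\<Sum>k. diffs ?c k * z ^ k) = (\<Sum>k. ?c (Suc k) * (\<Sum>i<Suc k. z ^ i * z ^ (Suc k - Suc i)))"
  proof (rule suminf_cong)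
    fix k
    have "(\<Sum>i<Suc k. z ^ i * z ^ (Suc k - Suc i)) = (\<Sum>i<Suc k. z ^ k)"
      by (intro sum.cong refl) (auto simp: power_add[symmetric])
    then show "diffs ?c k * z ^ k = ?c (Suc k) * (\<Sum>i<Suc k. z ^ i * z ^ (Suc k - Suc i))"
      by (simp add: diffs_def)
  qed
  also have "\<dots> = kummer_dd a z z"
    unfolding kummer_dd_def using suminf_split_head[OF summable_kummer_dd[of a z]] by simp
  finally show ?thesis unfolding kummer_def[abs_def] .
qed

lemma G_kummer: "G a z = exp (- z / 2) * kummer a z"
  by (simp add: G_series kummer_def)

text \<open>Both cases of \<open>K_inf\<close> become one formula in divided differences. Off the
  diagonal \<open>u - v = 2 pi i (x - y)\<close> accounts for the different constants; on it, the
  terms from differentiating the exponential factors cancel in the difference of products.\<close>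

lemma K_inf_kummer:
  fixes x y c :: real
  defines "l \<equiv> jump_exponent c"
    and "u \<equiv> 2 * of_real pi * \<i> * of_real x" and "v \<equiv> 2 * of_real pi * \<i> * of_real y"
  shows "K_inf h c x y = 2 / of_real (h 0) * of_real (ln c / (c\<^sup>2 - 1)) * exp (- (u + v) / 2) *
     (kummer_dd (1 + l) u v * kummer l v - kummer (1 + l) v * kummer_dd l u v)"
proof (cases "x = y")
  case False
  define M1 M0 where "M1 = kummer (1 + l)" and "M0 = kummer l"
  have uv: "u - v = 2 * of_real pi * \<i> * of_real (x - y)"
    by (simp add: u_def v_def algebra_simps)
  then have ne: "u \<noteq> v" using False by auto
  have e: "exp (- (u + v) / 2) = exp (- u / 2) * exp (- v / 2)"
    by (simp add: exp_add[symmetric] diff_divide_distrib add_divide_distrib)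
  have num: "G (1 + l) u * G l v - G (1 + l) v * G l u = exp (- (u + v) / 2) * (M1 u * M0 v - M1 v * M0 u)"
    unfolding G_kummer e M1_def M0_def by (simp add: algebra_simps)
  have dd: "kummer_dd (1 + l) u v * kummer l v - kummer (1 + l) v * kummer_dd l u v
      = (M1 u * M0 v - M1 v * M0 u) / (2 * of_real pi * \<i> * of_real (x - y))"
    unfolding kummer_dd_eq[OF ne] uv M1_def M0_def
    by (simp add: diff_divide_distrib[symmetric] del: of_real_diff) (simp add: algebra_simps)
  have "K_inf h c x y = 1 / (of_real (h 0) * of_real pi * \<i>) * of_real (ln c / (c\<^sup>2 - 1)) *
      ((exp (- (u + v) / 2) * (M1 u * M0 v - M1 v * M0 u)) / of_real (x - y))"
    unfolding K_inf_def Let_def l_def[symmetric] u_def[symmetric] v_def[symmetric] num using False by simp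
  then show ?thesis unfolding dd by simp
next
  case True
  define M1 M0 where "M1 = kummer (1 + l)" and "M0 = kummer l"
  have uv: "v = u" by (simp add: u_def v_def True)
  have D: "deriv (G a) u = exp (- u / 2) * (kummer_dd a u u - kummer a u / 2)" for a
  proof (rule DERIV_imp_deriv)
    have "((\<lambda>z. exp (- z / 2) * kummer a z) has_field_derivative exp (- u / 2) * (kummer_dd a u u - kummer a u / 2)) (at u)"
      by (rule derivative_eq_intros refl kummer_has_derivative | simp)+ (simp add: algebra_simps)
    then show "(G a has_field_derivative exp (- u / 2) * (kummer_dd a u u - kummer a u / 2)) (at u)"
      by (subst G_kummer[abs_def])
  qed
  define E where "E = exp (- u / 2)"
  have e: "exp (- (u + v) / 2) = exp (- u / 2) * exp (- u / 2)"
    by (simp add: exp_add[symmetric] uv)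
  have "deriv (G (1 + l)) u * G l u - G (1 + l) u * deriv (G l) u
     = exp (- (u + v) / 2) * (kummer_dd (1 + l) u v * kummer l v - kummer (1 + l) v * kummer_dd l u v)"
    unfolding D G_kummer e unfolding uv E_def[symmetric] by (simp add: algebra_simps)
  then show ?thesis
    unfolding K_inf_def Let_def l_def[symmetric] u_def[symmetric] v_def[symmetric] using True by (simp add: mult.assoc)
qed

section \<open>The Christoffel-Darboux kernel on the circle\<close>

text \<open>The total mass of the model weight on the circle, which is also the squared norm of each
  polynomial \<open>circ_poly (1 + jump_exponent c) k\<close>.\<close>

definition circ_norm :: "real \<Rightarrow> real" where
  "circ_norm c = pi * (c\<^sup>2 - 1) / ln c"

text \<open>The unimodular factor, the same for all \<open>k\<close>, centres the frequencies: the
  indices \<open>k \<le> 2 * N\<close> give trigonometric polynomials of degree at most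
  \<open>N\<close>.\<close>

definition circ_basis :: "real \<Rightarrow> nat \<Rightarrow> nat \<Rightarrow> real \<Rightarrow> complex" where
  "circ_basis c N k \<theta> = cis (- (real N * \<theta>)) * poly (circ_poly (1 + jump_exponent c) k) (cis \<theta>)
      / of_real (sqrt (circ_norm c))"

definition circ_kernel :: "real \<Rightarrow> nat \<Rightarrow> real \<Rightarrow> real \<Rightarrow> complex" where
  "circ_kernel c N \<theta> \<phi> = (\<Sum>k<2 * N + 1. circ_basis c N k \<theta> * cnj (circ_basis c N k \<phi>))"

lemma circ_norm_pos: "c > 0 \<Longrightarrow> c \<noteq> 1 \<Longrightarrow> circ_norm c > 0"
proof (cases "c > 1")
  case True
  then show ?thesis by (simp add: circ_norm_def)
next
  case False
  assume "c > 0" "c \<noteq> 1"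
  with False have "ln c < 0" "c\<^sup>2 < 1"
    using power_strict_mono[of c 1 2] by auto
  then show ?thesis by (auto simp: circ_norm_def intro!: divide_neg_neg mult_pos_neg)
qed

lemma cnj_jump_exponent: "cnj (jump_exponent c) = - jump_exponent c"
  by (simp add: jump_exponent_def)

text \<open>For \<open>z \<noteq> w\<close> the reversal formula turns the kernel into the algebraic
  Christoffel-Darboux sum, and subtracting equal products at \<open>w\<close> exhibits the divided
  differences. Both sides are polynomials in \<open>z\<close>, so the case \<open>z = w\<close>
  follows by continuity.\<close>

lemma circ_poly_kernel:
  fixes z w l :: complex
  assumes l: "cnj l = - l" and w: "norm w = 1"
  shows "w ^ n * (\<Sum>k<n. poly (circ_poly (1 + l) k) z * cnj (poly (circ_poly (1 + l) k) w))
       = w * (circ_dd (1 + l) n (z - 1) (w - 1) * poly (circ_poly l n) w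
            - circ_dd l n (z - 1) (w - 1) * poly (circ_poly (1 + l) n) w)"
proof -
  have w0: "w \<noteq> 0" using w by auto
  define X where "X x = w ^ n * (\<Sum>k<n. poly (circ_poly (1 + l) k) x * cnj (poly (circ_poly (1 + l) k) w))" for x
  define Y where "Y x = w * (circ_dd (1 + l) n (x - 1) (w - 1) * poly (circ_poly l n) w
            - circ_dd l n (x - 1) (w - 1) * poly (circ_poly (1 + l) n) w)" for x
  have eq: "X x = Y x" if "x \<noteq> w" for x
  proof -
    have "cnj (poly (circ_poly (1 + l) k) w) = poly (circ_poly l k) w / w ^ k" for k
      using circ_poly_reversal[OF l w, of k] w0 by simp
    then have "(w - x) * X x = w ^ n * ((w - x) * (\<Sum>k<n. poly (circ_poly (1 + l) k) x * poly (circ_poly l k) w / w ^ k))"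
      by (simp add: X_def mult_ac)
    also have "\<dots> = w * ((poly (circ_poly l n) x - poly (circ_poly l n) w) * poly (circ_poly (1 + l) n) w
            - (poly (circ_poly (1 + l) n) x - poly (circ_poly (1 + l) n) w) * poly (circ_poly l n) w)"
      unfolding circ_poly_christoffel_darboux[OF w0] by (simp add: algebra_simps)
    also have "\<dots> = (w - x) * Y x"
      unfolding circ_dd_eq Y_def by (simp add: algebra_simps)
    finally show ?thesis using that by simp
  qed
  have "(X \<longlongrightarrow> X w) (at w)" "(Y \<longlongrightarrow> Y w) (at w)"
    unfolding X_def Y_def circ_dd_def by (intro tendsto_intros)+
  moreover have "(Y \<longlongrightarrow> X w) (at w)"
    using \<open>(X \<longlongrightarrow> X w) (at w)\<close>
    by (rule Lim_transform_eventually) (auto simp: eventually_at eq intro!: exI[of _ 1])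
  ultimately have "X w = Y w"
    using tendsto_unique[of "at w" Y] by auto
  with eq[of z] have "X z = Y z" by (cases "z = w") auto
  then show ?thesis unfolding X_def Y_def .
qed

lemma cis_slope_tendsto:
  fixes \<nu> :: "'a \<Rightarrow> nat" and X :: "'a \<Rightarrow> real"
  assumes \<nu>: "filterlim \<nu> sequentially F" and X: "(X \<longlongrightarrow> x) F"
  shows "((\<lambda>t. of_nat (\<nu> t) * (cis (2 * pi * X t / real (\<nu> t)) - 1)) \<longlongrightarrow> 2 * of_real pi * \<i> * of_real x) F"
proof -
  \<comment> \<open>Filling the removable singularity of \<open>(exp z - 1) / z\<close> avoids a
    case distinction when \<open>X t\<close> is 0.\<close>
  define sl where "sl z = (if z = 0 then 1 else (exp z - 1) / z)" for z :: complex
  have "(sl \<longlongrightarrow> 1) (at 0)"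
    unfolding sl_def using lim_exp_minus_1 by (rule Lim_transform_eventually) (auto simp: eventually_at intro!: exI[of _ 1])
  then have sl: "isCont sl 0" by (simp add: isCont_def sl_def)
  have "((\<lambda>t. inverse (real (\<nu> t))) \<longlongrightarrow> 0) F"
    using filterlim_compose[OF lim_inverse_n \<nu>] .
  from tendsto_mult[OF tendsto_mult[OF tendsto_const[of "2 * pi"] X] this]
  have th: "((\<lambda>t. 2 * pi * X t / real (\<nu> t)) \<longlongrightarrow> 0) F" by (simp add: divide_inverse)
  have "((\<lambda>t. \<i> * of_real (2 * pi * X t / real (\<nu> t))) \<longlongrightarrow> \<i> * of_real 0) F"
    by (intro tendsto_intros th)
  then have "((\<lambda>t. sl (\<i> * of_real (2 * pi * X t / real (\<nu> t)))) \<longlongrightarrow> 1) F"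
    using isCont_tendsto_compose[OF sl, of "\<lambda>t. \<i> * of_real (2 * pi * X t / real (\<nu> t))" F] by (simp add: sl_def)
  moreover have "((\<lambda>t. \<i> * of_real (2 * pi * X t)) \<longlongrightarrow> \<i> * of_real (2 * pi * x)) F"
    by (intro tendsto_intros X)
  ultimately have "((\<lambda>t. sl (\<i> * of_real (2 * pi * X t / real (\<nu> t))) * (\<i> * of_real (2 * pi * X t)))
      \<longlongrightarrow> 1 * (\<i> * of_real (2 * pi * x))) F"
    by (rule tendsto_mult)
  then have "((\<lambda>t. sl (\<i> * of_real (2 * pi * X t / real (\<nu> t))) * (\<i> * of_real (2 * pi * X t)))
      \<longlongrightarrow> 2 * of_real pi * \<i> * of_real x) F"
    by (simp add: mult_ac)
  then show ?thesis
  proof (rule Lim_transform_eventually)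
    have "\<forall>\<^sub>F t in F. \<nu> t > 0"
      by (rule eventually_compose_filterlim[OF eventually_gt_at_top \<nu>])
    then show "\<forall>\<^sub>F t in F. sl (\<i> * of_real (2 * pi * X t / real (\<nu> t))) * (\<i> * of_real (2 * pi * X t))
        = of_nat (\<nu> t) * (cis (2 * pi * X t / real (\<nu> t)) - 1)"
      by eventually_elim (auto simp: sl_def cis_conv_exp)
  qed
qed

text \<open>The phases of the basis functions combine with the factor
  \<open>cis (2 N \<phi>)\<close> left by the reversal into the symmetric phase
  \<open>cis (- N (\<theta> + \<phi>))\<close>. As \<open>N / (2 N + 1)\<close> tends to 1/2, its
  limit is \<open>exp (- (u + v) / 2)\<close>, exactly the exponential factors of the two functions
  \<open>G\<close>.\<close>

lemma circ_kernel_tendsto: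
  fixes N :: "'a \<Rightarrow> nat" and X Y :: "'a \<Rightarrow> real"
  assumes c: "c > 0" "c \<noteq> 1" and F: "F \<noteq> bot" and N: "filterlim N sequentially F"
    and X: "(X \<longlongrightarrow> x) F" and Y: "(Y \<longlongrightarrow> y) F"
  shows "((\<lambda>t. of_real (2 * pi / real (2 * N t + 1)) *
             circ_kernel c (N t) (2 * pi * X t / real (2 * N t + 1)) (2 * pi * Y t / real (2 * N t + 1)))
           \<longlongrightarrow> K_inf (\<lambda>_. 1) c x y) F"
proof -
  define l where "l = jump_exponent c"
  define \<nu> where "\<nu> t = 2 * N t + 1" for t
  define \<theta> where "\<theta> t = 2 * pi * X t / real (\<nu> t)" for t
  define \<phi> where "\<phi> t = 2 * pi * Y t / real (\<nu> t)" for t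
  define u where "u = 2 * of_real pi * \<i> * of_real x"
  define v where "v = 2 * of_real pi * \<i> * of_real y"
  define A where "A t = poly (circ_poly l (\<nu> t)) (cis (\<phi> t))" for t
  define B where "B t = poly (circ_poly (1 + l) (\<nu> t)) (cis (\<phi> t))" for t
  define DA where "DA t = circ_dd l (\<nu> t) (cis (\<theta> t) - 1) (cis (\<phi> t) - 1)" for t
  define DB where "DB t = circ_dd (1 + l) (\<nu> t) (cis (\<theta> t) - 1) (cis (\<phi> t) - 1)" for t
  have "filterlim (\<lambda>n. 2 * n + 1) sequentially sequentially"
    by (rule filterlim_subseq) (simp add: strict_mono_def)
  then have \<nu>: "filterlim \<nu> sequentially F"
    unfolding \<nu>_def using N by (rule filterlim_compose)
  have lim\<theta>: "((\<lambda>t. of_nat (\<nu> t) * (cis (\<theta> t) - 1)) \<longlongrightarrow> u) F"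
    unfolding \<theta>_def u_def by (rule cis_slope_tendsto[OF \<nu> X])
  have lim\<phi>: "((\<lambda>t. of_nat (\<nu> t) * (cis (\<phi> t) - 1)) \<longlongrightarrow> v) F"
    unfolding \<phi>_def v_def by (rule cis_slope_tendsto[OF \<nu> Y])
  have limA: "(A \<longlongrightarrow> kummer l v) F" and limB: "(B \<longlongrightarrow> kummer (1 + l) v) F"
    using circ_limits(1)[OF F \<nu> lim\<phi> lim\<phi>] by (simp_all add: A_def[abs_def] B_def[abs_def])
  have limDA: "((\<lambda>t. DA t / of_nat (\<nu> t)) \<longlongrightarrow> kummer_dd l u v) F"
    and limDB: "((\<lambda>t. DB t / of_nat (\<nu> t)) \<longlongrightarrow> kummer_dd (1 + l) u v) F"
    unfolding DA_def DB_def by (rule circ_limits(2)[OF F \<nu> lim\<theta> lim\<phi>])+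
  have half: "((\<lambda>t. real (N t) / real (\<nu> t)) \<longlongrightarrow> 1 / 2) F"
  proof (rule Lim_transform_eventually)
    have "((\<lambda>t. 1 / 2 - inverse (real (\<nu> t)) / 2) \<longlongrightarrow> 1 / 2 - 0 / 2) F"
      by (intro tendsto_intros filterlim_compose[OF lim_inverse_n \<nu>]) auto
    then show "((\<lambda>t. 1 / 2 - inverse (real (\<nu> t)) / 2) \<longlongrightarrow> 1 / 2) F" by simp
    show "\<forall>\<^sub>F t in F. 1 / 2 - inverse (real (\<nu> t)) / 2 = real (N t) / real (\<nu> t)"
      by (rule always_eventually) (simp add: \<nu>_def field_simps)
  qed
  have "((\<lambda>t. - (2 * pi * (X t + Y t) * (real (N t) / real (\<nu> t)))) \<longlongrightarrow> - (2 * pi * (x + y) * (1 / 2))) F"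
    by (intro tendsto_intros X Y half)
  then have "((\<lambda>t. cis (- (2 * pi * (X t + Y t) * (real (N t) / real (\<nu> t))))) \<longlongrightarrow> cis (- (2 * pi * (x + y) * (1 / 2)))) F"
    by (intro tendsto_cis)
  moreover have "cis (- (2 * pi * (x + y) * (1 / 2))) = exp (- (u + v) / 2)"
    unfolding cis_conv_exp by (rule arg_cong[of _ _ exp]) (simp add: u_def v_def field_simps)
  moreover have "- (2 * pi * (X t + Y t) * (real (N t) / real (\<nu> t))) = - (real (N t) * (\<theta> t + \<phi> t))" for t
    by (simp add: \<theta>_def \<phi>_def add_divide_distrib[symmetric] algebra_simps)
  ultimately have limE: "((\<lambda>t. cis (- (real (N t) * (\<theta> t + \<phi> t)))) \<longlongrightarrow> exp (- (u + v) / 2)) F"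
    by simp
  define D where "D = circ_norm c"
  have D: "D > 0" unfolding D_def by (rule circ_norm_pos[OF c])
  have main: "of_real (2 * pi / real (\<nu> t)) * circ_kernel c (N t) (\<theta> t) (\<phi> t)
      = of_real (2 * pi / D) * cis (- (real (N t) * (\<theta> t + \<phi> t))) *
        (DB t / of_nat (\<nu> t) * A t - B t * (DA t / of_nat (\<nu> t)))" for t
  proof -
    define S where "S = (\<Sum>k<\<nu> t. poly (circ_poly (1 + l) k) (cis (\<theta> t)) * cnj (poly (circ_poly (1 + l) k) (cis (\<phi> t))))"
    have sq: "complex_of_real (sqrt D) * complex_of_real (sqrt D) = of_real D"
      using D by (simp add: of_real_mult[symmetric] del: of_real_mult)
    have "circ_kernel c (N t) (\<theta> t) (\<phi> t) = cis (- (real (N t) * \<theta> t)) * cis (real (N t) * \<phi> t) * S / of_real D"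
      unfolding circ_kernel_def circ_basis_def S_def \<nu>_def[symmetric] D_def[symmetric] l_def[symmetric] sum_distrib_left
        sum_divide_distrib sq[symmetric]
      by (intro sum.cong refl) (simp add: cis_cnj)
    moreover have "cis (\<phi> t) ^ \<nu> t * S = cis (\<phi> t) * (DB t * A t - DA t * B t)"
      unfolding S_def DA_def DB_def A_def B_def
      by (rule circ_poly_kernel) (simp_all add: l_def cnj_jump_exponent)
    then have "cis (2 * real (N t) * \<phi> t) * S = DB t * A t - DA t * B t"
    proof -
      have "cis (\<phi> t) ^ \<nu> t = cis (\<phi> t) * cis (2 * real (N t) * \<phi> t)"
        by (simp add: \<nu>_def Complex.DeMoivre cis_mult algebra_simps)
      then have "cis (\<phi> t) * (cis (2 * real (N t) * \<phi> t) * S) = cis (\<phi> t) * (DB t * A t - DA t * B t)"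
        using \<open>cis (\<phi> t) ^ \<nu> t * S = _\<close> by (simp add: mult.assoc)
      then show ?thesis by simp
    qed
    moreover have "cis (- (real (N t) * \<theta> t)) * cis (real (N t) * \<phi> t)
        = cis (- (real (N t) * (\<theta> t + \<phi> t))) * cis (2 * real (N t) * \<phi> t)"
      by (simp add: cis_mult algebra_simps)
    ultimately have e1: "circ_kernel c (N t) (\<theta> t) (\<phi> t)
        = cis (- (real (N t) * (\<theta> t + \<phi> t))) * (DB t * A t - DA t * B t) / of_real D"
      by (simp add: mult.assoc)
    have e2: "DB t / of_nat (\<nu> t) * A t - B t * (DA t / of_nat (\<nu> t)) = (DB t * A t - DA t * B t) / of_nat (\<nu> t)"
      by (simp add: diff_divide_distrib mult.commute)
    show ?thesis unfolding e1 e2 by (simp add: mult_ac)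
  qed
  have "((\<lambda>t. of_real (2 * pi / D) * cis (- (real (N t) * (\<theta> t + \<phi> t))) *
        (DB t / of_nat (\<nu> t) * A t - B t * (DA t / of_nat (\<nu> t))))
     \<longlongrightarrow> of_real (2 * pi / D) * exp (- (u + v) / 2) *
        (kummer_dd (1 + l) u v * kummer l v - kummer (1 + l) v * kummer_dd l u v)) F"
    by (intro tendsto_intros limE limA limB limDA limDB)
  moreover have "K_inf (\<lambda>_. 1) c x y = of_real (2 * pi / D) * exp (- (u + v) / 2) *
        (kummer_dd (1 + l) u v * kummer l v - kummer (1 + l) v * kummer_dd l u v)"
    unfolding K_inf_kummer l_def[symmetric] u_def[symmetric] v_def[symmetric]
    by (simp add: D_def circ_norm_def)
  ultimately have "((\<lambda>t. of_real (2 * pi / real (\<nu> t)) * circ_kernel c (N t) (\<theta> t) (\<phi> t)) \<longlongrightarrow> K_inf (\<lambda>_. 1) c x y) F"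
    by (simp only: main)
  then show ?thesis
    by (simp only: \<theta>_def \<phi>_def \<nu>_def)
qed

section \<open>Orthogonality on the circle\<close>

text \<open>The circle is parametrized by \<open>{-pi/2..3*pi/2}\<close> and folded along \<open>\<theta> \<mapsto> pi - \<theta>\<close>, which preserves \<open>sin \<theta>\<close>:
  the second weight below is the value of the first one at \<open>pi - \<theta>\<close>.\<close>

definition halfcircle :: "real measure" where
  "halfcircle = restrict_space lborel {-pi/2..pi/2}"

definition arc_weight :: "real \<Rightarrow> real \<Rightarrow> real" where
  "arc_weight c \<theta> = jump c \<theta> * exp (- (ln c / pi * \<theta>))"

definition refl_weight :: "real \<Rightarrow> real \<Rightarrow> real" where
  "refl_weight c \<theta> = c * exp (ln c / pi * \<theta>)"

definition circ_integral :: "real \<Rightarrow> (real \<Rightarrow> complex) \<Rightarrow> complex" where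
  "circ_integral c F = (\<integral>\<theta>. F \<theta> * of_real (arc_weight c \<theta>) + F (pi - \<theta>) * of_real (refl_weight c \<theta>) \<partial>halfcircle)"

definition circ_sqnorm :: "real \<Rightarrow> (real \<Rightarrow> complex) \<Rightarrow> real" where
  "circ_sqnorm c F = (\<integral>\<theta>. (norm (F \<theta>))\<^sup>2 * arc_weight c \<theta> + (norm (F (pi - \<theta>)))\<^sup>2 * refl_weight c \<theta> \<partial>halfcircle)"

lemma space_halfcircle [simp]: "space halfcircle = {-pi/2..pi/2}"
  by (simp add: halfcircle_def space_restrict_space)

lemma integrable_halfcircle:
  fixes f :: "real \<Rightarrow> 'b::{banach, second_countable_topology}"
  shows "integrable halfcircle f \<longleftrightarrow> integrable lborel (\<lambda>x. indicator {-pi/2..pi/2} x *\<^sub>R f x)"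
  unfolding halfcircle_def by (rule integrable_restrict_space) simp

lemma integral_halfcircle:
  fixes f :: "real \<Rightarrow> 'b::{banach, second_countable_topology}"
  shows "integral\<^sup>L halfcircle f = integral\<^sup>L lborel (\<lambda>x. indicator {-pi/2..pi/2} x *\<^sub>R f x)"
  unfolding halfcircle_def by (rule integral_restrict_space) simp

lemma integrable_halfcircle_continuous:
  fixes f :: "real \<Rightarrow> 'b::{banach, second_countable_topology}"
  assumes "continuous_on {-pi/2..pi/2} f"
  shows "integrable halfcircle f"
  unfolding integrable_halfcircle using assms by (intro borel_integrable_compact) auto

lemma integrable_halfcircle_arc_weight:
  fixes f :: "real \<Rightarrow> complex"
  assumes f: "continuous_on UNIV f"
  shows "integrable halfcircle (\<lambda>\<theta>. f \<theta> * of_real (arc_weight c \<theta>))"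
proof -
  let ?g = "\<lambda>\<theta>. f \<theta> * of_real (exp (- (ln c / pi * \<theta>)))"
  have "continuous_on {-pi/2..pi/2} ?g"
    by (intro continuous_intros continuous_on_subset[OF f]) auto
  then have g: "integrable halfcircle ?g" by (rule integrable_halfcircle_continuous)
  have "{0..} \<inter> space halfcircle \<in> sets halfcircle"
    unfolding halfcircle_def space_restrict_space by (subst sets_restrict_space_iff) auto
  then have "integrable halfcircle (\<lambda>\<theta>. indicator ({0..} \<inter> space halfcircle) \<theta> *\<^sub>R ?g \<theta>)"
    by (rule integrable_mult_indicator) (rule g)
  then have "integrable halfcircle (\<lambda>\<theta>. ?g \<theta> + (c\<^sup>2 - 1) *\<^sub>R indicator ({0..} \<inter> space halfcircle) \<theta> *\<^sub>R ?g \<theta>)"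
    using g by (intro Bochner_Integration.integrable_add integrable_scaleR_right) auto
  then show ?thesis
    by (rule Bochner_Integration.integrable_cong[THEN iffD1, OF refl, rotated])
      (auto simp: arc_weight_def jump_def scaleR_conv_of_real algebra_simps indicator_def)
qed

lemma integrable_halfcircle_refl_weight:
  fixes f :: "real \<Rightarrow> complex"
  assumes f: "continuous_on UNIV f"
  shows "integrable halfcircle (\<lambda>\<theta>. f (pi - \<theta>) * of_real (refl_weight c \<theta>))"
proof (rule integrable_halfcircle_continuous)
  show "continuous_on {-pi/2..pi/2} (\<lambda>\<theta>. f (pi - \<theta>) * of_real (refl_weight c \<theta>))"
    unfolding refl_weight_def by (intro continuous_intros continuous_on_compose2[OF f]) auto
qed

lemma circ_integral_integrable:
  fixes F :: "real \<Rightarrow> complex"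
  assumes "continuous_on UNIV F"
  shows "integrable halfcircle (\<lambda>\<theta>. F \<theta> * of_real (arc_weight c \<theta>) + F (pi - \<theta>) * of_real (refl_weight c \<theta>))"
  using assms by (intro Bochner_Integration.integrable_add integrable_halfcircle_arc_weight integrable_halfcircle_refl_weight)

lemma circ_integral_sum:
  assumes "finite A" "\<And>i. i \<in> A \<Longrightarrow> continuous_on UNIV (F i)"
  shows "circ_integral c (\<lambda>\<theta>. \<Sum>i\<in>A. a i * F i \<theta>) = (\<Sum>i\<in>A. a i * circ_integral c (F i))"
proof -
  have "circ_integral c (\<lambda>\<theta>. \<Sum>i\<in>A. a i * F i \<theta>)
     = (\<integral>\<theta>. (\<Sum>i\<in>A. a i * (F i \<theta> * of_real (arc_weight c \<theta>) + F i (pi - \<theta>) * of_real (refl_weight c \<theta>))) \<partial>halfcircle)"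
    unfolding circ_integral_def
    by (intro Bochner_Integration.integral_cong refl) (simp add: sum_distrib_right sum.distrib distrib_left mult.assoc)
  also have "\<dots> = (\<Sum>i\<in>A. (\<integral>\<theta>. a i * (F i \<theta> * of_real (arc_weight c \<theta>) + F i (pi - \<theta>) * of_real (refl_weight c \<theta>)) \<partial>halfcircle))"
    using assms by (intro Bochner_Integration.integral_sum integrable_mult_right circ_integral_integrable) auto
  also have "\<dots> = (\<Sum>i\<in>A. a i * circ_integral c (F i))"
    by (simp add: circ_integral_def)
  finally show ?thesis .
qed

lemma circ_integral_cnj: "circ_integral c (\<lambda>\<theta>. cnj (F \<theta>)) = cnj (circ_integral c F)"
  unfolding circ_integral_def by (subst Bochner_Integration.integral_cnj[symmetric]) (intro Bochner_Integration.integral_cong refl, simp)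

lemma circ_sqnorm_circ_integral: "of_real (circ_sqnorm c F) = circ_integral c (\<lambda>\<theta>. F \<theta> * cnj (F \<theta>))"
  unfolding circ_integral_def circ_sqnorm_def integral_complex_of_real[symmetric]
  by (intro Bochner_Integration.integral_cong refl) (simp add: complex_norm_square[symmetric])

section \<open>Moments of the circle weight\<close>

lemma integral_exp_Icc:
  fixes \<mu> :: complex
  assumes "\<mu> \<noteq> 0" "a \<le> b"
  shows "(\<integral>\<theta>. indicator {a..b} \<theta> *\<^sub>R exp (\<mu> * of_real \<theta>) \<partial>lborel) = (exp (\<mu> * of_real b) - exp (\<mu> * of_real a)) / \<mu>"
proof -
  have "(\<integral>\<theta>. indicator {a..b} \<theta> *\<^sub>R exp (\<mu> * of_real \<theta>) \<partial>lborel)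
     = exp (\<mu> * of_real b) / \<mu> - exp (\<mu> * of_real a) / \<mu>"
  proof (rule integral_FTC_Icc)
    show "((\<lambda>\<theta>. exp (\<mu> * of_real \<theta>) / \<mu>) has_vector_derivative exp (\<mu> * of_real x)) (at x within {a..b})" for x
    proof -
      have "((\<lambda>z. exp (\<mu> * z) / \<mu>) has_field_derivative exp (\<mu> * of_real x)) (at (of_real x))"
        using assms by (auto intro!: derivative_eq_intros)
      from has_vector_derivative_real_field[OF this]
      show ?thesis by (simp add: has_vector_derivative_at_within)
    qed
  qed (use assms in \<open>auto intro!: continuous_intros\<close>)
  then show ?thesis by (simp add: diff_divide_distrib)
qed

text \<open>The weight is exponential along the circle, so the integral is a sum of boundary terms.
  It is continuous across the fold points \<open>pi / 2\<close> and \<open>- pi / 2\<close>, hence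
  only the jump at 0 contributes, with value \<open>(1 - c^2) / \<mu>\<close>.\<close>

lemma circ_integral_cis:
  fixes m :: int
  assumes c: "c > 0" "c \<noteq> 1"
  shows "circ_integral c (\<lambda>\<theta>. cis (of_int m * \<theta>)) = \<i> * of_real (c\<^sup>2 - 1) / (of_int m + jump_exponent c)"
proof -
  define \<eta> where "\<eta> = - (ln c / pi)"
  define \<mu> where "\<mu> = \<i> * of_int m + of_real \<eta>"
  define a where "a = exp (\<mu> * of_real (pi / 2))"
  have \<eta>0: "\<eta> \<noteq> 0" using c by (simp add: \<eta>_def)
  have \<mu>0: "\<mu> \<noteq> 0"
    using \<eta>0 by (auto simp: \<mu>_def complex_eq_iff)
  have a0: "a \<noteq> 0" by (simp add: a_def)
  have ai: "exp (\<mu> * of_real (- pi / 2)) = 1 / a"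
    by (simp add: a_def exp_minus inverse_eq_divide)
  have "a\<^sup>2 = exp (\<mu> * of_real pi)"
    by (simp add: a_def exp_double[symmetric])
  also have "\<dots> = exp (\<i> * of_real (of_int m * pi)) * exp (of_real (\<eta> * pi))"
    by (simp add: \<mu>_def exp_add[symmetric] algebra_simps)
  also have "exp (of_real (\<eta> * pi)) = complex_of_real (1 / c)"
    using c by (simp add: \<eta>_def exp_of_real exp_minus inverse_eq_divide)
  finally have a2: "a\<^sup>2 = cis (of_int m * pi) / of_real c"
    by (simp add: cis_conv_exp)
  have cc: "cis (of_int m * pi) * cis (of_int m * pi) = 1"
    using cis_multiple_2pi[of "of_int m"] by (simp add: cis_mult algebra_simps)
  have "circ_integral c (\<lambda>\<theta>. cis (of_int m * \<theta>))
     = (\<integral>\<theta>. (indicator {-pi/2..pi/2} \<theta> *\<^sub>R exp (\<mu> * of_real \<theta>)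
           + of_real (c\<^sup>2 - 1) * (indicator {0..pi/2} \<theta> *\<^sub>R exp (\<mu> * of_real \<theta>)))
           + of_real c * cis (of_int m * pi) * (indicator {-pi/2..pi/2} \<theta> *\<^sub>R exp ((- \<mu>) * of_real \<theta>)) \<partial>lborel)"
    unfolding circ_integral_def integral_halfcircle
  proof (intro Bochner_Integration.integral_cong refl)
    fix \<theta>
    have 1: "cis (of_int m * \<theta>) * of_real (exp (- (ln c / pi * \<theta>))) = exp (\<mu> * of_real \<theta>)"
      by (simp add: cis_conv_exp exp_of_real[symmetric] exp_add[symmetric] \<mu>_def \<eta>_def algebra_simps)
    have 2: "cis (of_int m * (pi - \<theta>)) * of_real (refl_weight c \<theta>) = of_real c * cis (of_int m * pi) * exp ((- \<mu>) * of_real \<theta>)"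
      by (simp add: refl_weight_def cis_conv_exp exp_of_real[symmetric] exp_add[symmetric] \<mu>_def \<eta>_def algebra_simps)
    have 3: "cis (of_int m * \<theta>) * of_real (arc_weight c \<theta>) = of_real (jump c \<theta>) * exp (\<mu> * of_real \<theta>)"
      unfolding 1[symmetric] arc_weight_def by simp
    show "indicator {-pi/2..pi/2} \<theta> *\<^sub>R (cis (of_int m * \<theta>) * of_real (arc_weight c \<theta>) + cis (of_int m * (pi - \<theta>)) * of_real (refl_weight c \<theta>))
       = indicator {-pi/2..pi/2} \<theta> *\<^sub>R exp (\<mu> * of_real \<theta>)
           + of_real (c\<^sup>2 - 1) * (indicator {0..pi/2} \<theta> *\<^sub>R exp (\<mu> * of_real \<theta>))
           + of_real c * cis (of_int m * pi) * (indicator {-pi/2..pi/2} \<theta> *\<^sub>R exp ((- \<mu>) * of_real \<theta>))"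
      unfolding 2 3 by (auto simp: indicator_def jump_def algebra_simps)
  qed
  also have "\<dots> = (\<integral>\<theta>. indicator {-pi/2..pi/2} \<theta> *\<^sub>R exp (\<mu> * of_real \<theta>) \<partial>lborel)
           + of_real (c\<^sup>2 - 1) * (\<integral>\<theta>. indicator {0..pi/2} \<theta> *\<^sub>R exp (\<mu> * of_real \<theta>) \<partial>lborel)
           + of_real c * cis (of_int m * pi) * (\<integral>\<theta>. indicator {-pi/2..pi/2} \<theta> *\<^sub>R exp ((- \<mu>) * of_real \<theta>) \<partial>lborel)"
  proof -
    have i: "integrable lborel (\<lambda>\<theta>. indicator {s..t} \<theta> *\<^sub>R exp (\<kappa> * complex_of_real \<theta>))" for s t \<kappa>
      by (rule borel_integrable_compact) (auto intro!: continuous_intros)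
    show ?thesis
      by (simp only: Bochner_Integration.integral_add Bochner_Integration.integrable_add
            integrable_mult_right integral_mult_right_zero i)
  qed
  also have "\<dots> = (a - 1 / a) / \<mu> + of_real (c\<^sup>2 - 1) * ((a - 1) / \<mu>)
           + of_real c * cis (of_int m * pi) * ((1 / a - a) / (- \<mu>))"
  proof -
    have e: "exp ((- \<mu>) * of_real (- pi / 2)) = a" "exp ((- \<mu>) * of_real (pi / 2)) = 1 / a"
      by (simp_all add: a_def exp_minus inverse_eq_divide)
    have "(\<integral>\<theta>. indicator {-pi/2..pi/2} \<theta> *\<^sub>R exp (\<mu> * of_real \<theta>) \<partial>lborel) = (a - 1 / a) / \<mu>"
      by (subst integral_exp_Icc) (use \<mu>0 ai in \<open>simp_all add: a_def\<close>)
    moreover have "(\<integral>\<theta>. indicator {0..pi/2} \<theta> *\<^sub>R exp (\<mu> * of_real \<theta>) \<partial>lborel) = (a - 1) / \<mu>"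
      by (subst integral_exp_Icc) (use \<mu>0 in \<open>simp_all add: a_def\<close>)
    moreover have "(\<integral>\<theta>. indicator {-pi/2..pi/2} \<theta> *\<^sub>R exp ((- \<mu>) * of_real \<theta>) \<partial>lborel) = (1 / a - a) / (- \<mu>)"
      by (subst integral_exp_Icc) (use \<mu>0 in \<open>simp_all only: e neg_equal_0_iff_equal, simp_all\<close>)
    ultimately show ?thesis by (simp only:)
  qed
  also have "\<dots> = of_real (1 - c\<^sup>2) / \<mu>"
  proof -
    \<comment> \<open>With \<open>a = exp (\<mu> * pi / 2)\<close>, this relation and its square
      \<open>(c * a^2)^2 = 1\<close> make the boundary terms at the fold points cancel.\<close>
    have k: "cis (of_int m * pi) = of_real c * a\<^sup>2"
      using a2 c by simp
    have "of_real c * a\<^sup>2 * (of_real c * a\<^sup>2) = 1"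
      using cc unfolding k .
    then have k2: "of_real c * (of_real c * a\<^sup>2) * a = 1 / a"
      using a0 by (simp add: power2_eq_square field_simps)
    have "a - 1 / a + of_real (c\<^sup>2 - 1) * (a - 1) - of_real c * (of_real c * a\<^sup>2) * (1 / a - a) = of_real (1 - c\<^sup>2)"
      using a0 k2 by (simp add: power2_eq_square algebra_simps)
    then have "((a - 1 / a) + of_real (c\<^sup>2 - 1) * (a - 1) - of_real c * cis (of_int m * pi) * (1 / a - a)) / \<mu> = of_real (1 - c\<^sup>2) / \<mu>"
      unfolding k by simp
    moreover have "x / \<mu> + p * (y / \<mu>) + q * (z / (- \<mu>)) = (x + p * y - q * z) / \<mu>" for x y z p q
      by (simp add: add_divide_distrib diff_divide_distrib)
    ultimately show ?thesis by simp
  qed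
  also have "\<mu> = \<i> * (of_int m + jump_exponent c)"
    by (simp add: \<mu>_def \<eta>_def jump_exponent_def algebra_simps)
  also have "of_real (1 - c\<^sup>2) / (\<i> * (of_int m + jump_exponent c)) = \<i> * of_real (c\<^sup>2 - 1) / (of_int m + jump_exponent c)"
  proof -
    have "of_real (1 - c\<^sup>2) / \<i> = \<i> * of_real (c\<^sup>2 - 1)"
      by (simp add: field_simps)
    then show ?thesis unfolding divide_divide_eq_left[symmetric] by simp
  qed
  finally show ?thesis .
qed

lemma jump_exponent_not_int:
  assumes "c > 0" "c \<noteq> 1"
  shows "jump_exponent c + of_int m \<noteq> 0"
proof -
  have "Im (jump_exponent c + of_int m) = ln c / pi"
    by (simp add: jump_exponent_def)
  moreover have "ln c / pi \<noteq> 0" using assms by simp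
  ultimately show ?thesis by (metis zero_complex.simps(2))
qed

lemma pochhammer_jump_exponent_nz:
  assumes "c > 0" "c \<noteq> 1"
  shows "pochhammer (jump_exponent c + of_int m) n \<noteq> 0"
proof -
  have "jump_exponent c + of_int m \<noteq> - of_nat k" for k
    using jump_exponent_not_int[OF assms, of "m + int k"] by (simp add: eq_neg_iff_add_eq_0 add.assoc)
  then show ?thesis by (simp add: pochhammer_eq_0_iff)
qed

text \<open>Binomial expansion turns the integral into a double sum over moments; the inner sum is a
  partial fraction and the outer one a Chu-Vandermonde sum. Orthogonality can be read off the
  result, since \<open>pochhammer (- of_nat k) n\<close> vanishes for \<open>k < n\<close>.\<close>

lemma circ_integral_circ_poly_cis:
  fixes k n :: nat
  assumes c: "c > 0" "c \<noteq> 1"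
  defines "l \<equiv> jump_exponent c"
  shows "circ_integral c (\<lambda>\<theta>. poly (circ_poly (1 + l) n) (cis \<theta>) * cis (- (real k * \<theta>)))
     = \<i> * of_real (c\<^sup>2 - 1) * (pochhammer (- of_nat k) n / pochhammer (l - of_nat k) (Suc n))"
proof -
  define x where "x = l - of_nat k"
  have xn: "x + of_nat i \<noteq> 0" for i
    using jump_exponent_not_int[OF c, of "int i - int k"] by (simp add: x_def l_def algebra_simps)
  have xn1: "x + 1 + of_nat i \<noteq> 0" for i
    using xn[of "Suc i"] by (simp add: algebra_simps)
  have x0: "x \<noteq> 0" using xn[of 0] by simp
  define b where "b i = of_nat (n choose i) * pochhammer (1 + l) i / fact i" for i
  have pw: "(cis \<theta> - 1) ^ i = (\<Sum>j\<le>i. of_nat (i choose j) * (-1) ^ (i - j) * cis (real j * \<theta>))" for i \<theta>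
  proof -
    have "(cis \<theta> + (- 1)) ^ i = (\<Sum>j\<le>i. of_nat (i choose j) * cis \<theta> ^ j * (-1) ^ (i - j))"
      by (rule binomial_ring)
    then show ?thesis by (simp add: Complex.DeMoivre mult_ac)
  qed
  have "circ_integral c (\<lambda>\<theta>. poly (circ_poly (1 + l) n) (cis \<theta>) * cis (- (real k * \<theta>)))
      = circ_integral c (\<lambda>\<theta>. \<Sum>i\<le>n. b i * (\<Sum>j\<le>i. of_nat (i choose j) * (-1) ^ (i - j) * cis (of_int (int j - int k) * \<theta>)))"
  proof (rule arg_cong[of _ _ "circ_integral c"], rule ext)
    fix \<theta>
    have "cis (real j * \<theta>) * cis (- (real k * \<theta>)) = cis (of_int (int j - int k) * \<theta>)" for j
      by (simp add: cis_mult algebra_simps)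
    then show "poly (circ_poly (1 + l) n) (cis \<theta>) * cis (- (real k * \<theta>))
      = (\<Sum>i\<le>n. b i * (\<Sum>j\<le>i. of_nat (i choose j) * (-1) ^ (i - j) * cis (of_int (int j - int k) * \<theta>)))"
      by (simp add: poly_circ_poly b_def pw sum_distrib_right mult.assoc)
  qed
  also have "\<dots> = (\<Sum>i\<le>n. b i * (\<Sum>j\<le>i. of_nat (i choose j) * (-1) ^ (i - j) *
       (\<i> * of_real (c\<^sup>2 - 1) / (of_int (int j - int k) + l))))"
    by (subst circ_integral_sum; (subst circ_integral_sum)?) (auto intro!: continuous_intros simp: circ_integral_cis[OF c] l_def simp del: of_int_diff)
  also have "\<dots> = \<i> * of_real (c\<^sup>2 - 1) * (\<Sum>i\<le>n. b i * (-1) ^ i * (\<Sum>j\<le>i. (-1) ^ j * of_nat (i choose j) / (x + of_nat j)))"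
    unfolding sum_distrib_left
  proof (intro sum.cong refl)
    fix i j :: nat assume "j \<in> {..i}"
    then have "(-1 :: complex) ^ (i - j) = (-1) ^ i * (-1) ^ j"
      by (auto simp: minus_one_power_iff)
    then show "b i * (of_nat (i choose j) * (-1) ^ (i - j) * (\<i> * of_real (c\<^sup>2 - 1) / (of_int (int j - int k) + l)))
       = \<i> * of_real (c\<^sup>2 - 1) * (b i * (-1) ^ i * ((-1) ^ j * of_nat (i choose j) / (x + of_nat j)))"
      by (simp add: x_def algebra_simps)
  qed
  also have "(\<Sum>i\<le>n. b i * (-1) ^ i * (\<Sum>j\<le>i. (-1) ^ j * of_nat (i choose j) / (x + of_nat j)))
      = (\<Sum>i\<le>n. (-1) ^ i * of_nat (n choose i) * pochhammer (1 + l) i / pochhammer (x + 1) i) / x"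
    unfolding binomial_partial_fraction[OF xn] sum_divide_distrib
    by (intro sum.cong refl) (simp add: b_def pochhammer_rec mult_ac)
  also have "\<dots> = pochhammer (x + 1 - (1 + l)) n / pochhammer x (Suc n)"
    unfolding alternating_pochhammer_sum[OF xn1] by (simp add: pochhammer_rec)
  also have "x + 1 - (1 + l) = - of_nat k" by (simp add: x_def)
  finally show ?thesis unfolding x_def .
qed

section \<open>Orthonormal expansion on the circle\<close>

lemma cnj_pochhammer: "cnj (pochhammer a n) = pochhammer (cnj a) n"
  by (induction n) (simp_all add: pochhammer_Suc)

lemma coeff_circ_poly_nz:
  assumes "c > 0" "c \<noteq> 1"
  shows "coeff (circ_poly (1 + jump_exponent c) n) n \<noteq> 0"
  using pochhammer_jump_exponent_nz[OF assms, of 1 n] by (simp add: coeff_circ_poly add.commute)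

lemma degree_circ_poly:
  assumes "c > 0" "c \<noteq> 1"
  shows "degree (circ_poly (1 + jump_exponent c) n) = n"
  using le_degree[OF coeff_circ_poly_nz[OF assms, of n]] degree_circ_poly_le[of _ n] by (simp add: le_antisym)

lemma continuous_circ_basis [continuous_intros]: "continuous_on A (circ_basis c N k)"
  unfolding circ_basis_def by (cases "sqrt (circ_norm c) = 0") (auto intro!: continuous_intros)

text \<open>The lower-degree factor is expanded in powers of \<open>cis \<theta>\<close>. Every
  power below \<open>j\<close> is orthogonal to the \<open>j\<close>-th polynomial, so a term
  survives only for \<open>k = j\<close>, and there only the leading coefficient matters.\<close>

lemma circ_basis_orthogonal_le:
  assumes c: "c > 0" "c \<noteq> 1" and "k \<le> j"
  shows "circ_integral c (\<lambda>\<theta>. circ_basis c N j \<theta> * cnj (circ_basis c N k \<theta>)) = (if j = k then 1 else 0)"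
proof -
  define l where "l = jump_exponent c"
  define D where "D = circ_norm c"
  have D: "D > 0" unfolding D_def by (rule circ_norm_pos[OF c])
  have sq: "complex_of_real (sqrt D) * complex_of_real (sqrt D) = of_real D"
    using D by (simp add: of_real_mult[symmetric] del: of_real_mult)
  define B where "B k = circ_poly (1 + l) k" for k
  define I where "I i = circ_integral c (\<lambda>\<theta>. poly (B j) (cis \<theta>) * cis (- (real i * \<theta>)))" for i
  have I: "I i = \<i> * of_real (c\<^sup>2 - 1) * (pochhammer (- of_nat i) j / pochhammer (l - of_nat i) (Suc j))" for i
    unfolding I_def B_def l_def by (rule circ_integral_circ_poly_cis[OF c])
  have "circ_integral c (\<lambda>\<theta>. circ_basis c N j \<theta> * cnj (circ_basis c N k \<theta>))
     = circ_integral c (\<lambda>\<theta>. \<Sum>i\<le>k. cnj (coeff (B k) i) / of_real D * (poly (B j) (cis \<theta>) * cis (- (real i * \<theta>))))"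
  proof (rule arg_cong[of _ _ "circ_integral c"], rule ext)
    fix \<theta>
    have "cnj (poly (B k) (cis \<theta>)) = (\<Sum>i\<le>k. cnj (coeff (B k) i) * cis (- (real i * \<theta>)))"
      unfolding poly_altdef using degree_circ_poly[OF c, of k]
      by (simp add: B_def l_def Complex.DeMoivre cis_cnj)
    moreover have "circ_basis c N j \<theta> * cnj (circ_basis c N k \<theta>)
      = (cis (- (real N * \<theta>)) * cis (real N * \<theta>)) * (poly (B j) (cis \<theta>) * cnj (poly (B k) (cis \<theta>))) / of_real D"
      unfolding sq[symmetric] by (simp add: circ_basis_def B_def l_def D_def cis_cnj)
    ultimately show "circ_basis c N j \<theta> * cnj (circ_basis c N k \<theta>)
      = (\<Sum>i\<le>k. cnj (coeff (B k) i) / of_real D * (poly (B j) (cis \<theta>) * cis (- (real i * \<theta>))))"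
      by (simp add: cis_mult sum_distrib_left sum_divide_distrib mult_ac)
  qed
  also have "\<dots> = (\<Sum>i\<le>k. cnj (coeff (B k) i) / of_real D * I i)"
    unfolding I_def by (rule circ_integral_sum) (auto intro!: continuous_intros)
  also have "\<dots> = (if j = k then cnj (coeff (B k) k) / of_real D * I k else 0)"
  proof -
    have z: "I i = 0" if "i < j" for i
      using that by (simp add: I pochhammer_of_nat_eq_0_lemma)
    have "(\<Sum>i\<le>k. cnj (coeff (B k) i) / of_real D * I i) = (\<Sum>i\<in>(if j = k then {k} else {}). cnj (coeff (B k) i) / of_real D * I i)"
      using \<open>k \<le> j\<close> z by (intro sum.mono_neutral_right) (auto split: if_splits)
    then show ?thesis by simp
  qed
  also have "\<dots> = (if j = k then 1 else 0)"
  proof (cases "j = k")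
    case True
    have l0: "l \<noteq> 0" using jump_exponent_not_int[OF c, of 0] by (simp add: l_def)
    have cl: "cnj (1 + l) = 1 - l" by (simp add: l_def cnj_jump_exponent)
    have nz: "pochhammer (1 - l) k \<noteq> 0"
    proof -
      have "pochhammer (1 - l) k = cnj (pochhammer (1 + l) k)"
        unfolding cnj_pochhammer cl ..
      moreover have "pochhammer (1 + l) k \<noteq> 0"
        using pochhammer_jump_exponent_nz[OF c, of 1 k] by (simp add: l_def add.commute)
      ultimately show ?thesis by (metis complex_cnj_zero_iff)
    qed
    have "pochhammer (l - of_nat k) (Suc k) = pochhammer (l - of_nat k) k * l"
      by (simp add: pochhammer_Suc)
    \<comment> \<open>Reflection produces \<open>pochhammer (1 - l) k\<close>, the numerator of the
      conjugated leading coefficient. It stands in the denominator of \<open>I k\<close>, so the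
      norm does not depend on \<open>k\<close>.\<close>
    also have "pochhammer (l - of_nat k) k = (-1) ^ k * pochhammer (1 - l) k"
    proof -
      have "pochhammer (1 - l) k = (-1) ^ k * pochhammer (l - of_nat k) k"
        using pochhammer_minus[of "l - 1" k] by simp
      then show ?thesis by (simp add: power_mult_distrib[symmetric])
    qed
    finally have p: "pochhammer (l - of_nat k) (Suc k) = (-1) ^ k * pochhammer (1 - l) k * l" .
    have "cnj (coeff (B k) k) * I k = \<i> * of_real (c\<^sup>2 - 1) / l"
    proof -
      have 1: "cnj (coeff (B k) k) = pochhammer (1 - l) k / fact k"
        unfolding B_def coeff_circ_poly complex_cnj_divide cnj_pochhammer cl by simp
      have 2: "I k = \<i> * of_real (c\<^sup>2 - 1) * (fact k / (pochhammer (1 - l) k * l))"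
        unfolding I True p pochhammer_same by simp
      show ?thesis unfolding 1 2 using nz l0 by (simp only: times_divide_times_eq times_divide_eq_right) simp
    qed
    also have "\<dots> = of_real D"
      using c by (simp add: l_def jump_exponent_def D_def circ_norm_def field_simps)
    finally show ?thesis using True D by simp
  qed simp
  finally show ?thesis .
qed

lemma circ_basis_orthonormal:
  assumes c: "c > 0" "c \<noteq> 1"
  shows "circ_integral c (\<lambda>\<theta>. circ_basis c N j \<theta> * cnj (circ_basis c N k \<theta>)) = (if j = k then 1 else 0)"
proof (cases "k \<le> j")
  case True
  then show ?thesis by (rule circ_basis_orthogonal_le[OF c])
next
  case False
  then have "circ_integral c (\<lambda>\<theta>. cnj (circ_basis c N k \<theta> * cnj (circ_basis c N j \<theta>))) = 0"
    unfolding circ_integral_cnj by (subst circ_basis_orthogonal_le[OF c]) auto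
  then show ?thesis using False by (simp add: mult.commute)
qed

lemma circ_sqnorm_basis_sum:
  assumes c: "c > 0" "c \<noteq> 1"
  shows "circ_sqnorm c (\<lambda>\<theta>. \<Sum>k<m. a k * circ_basis c N k \<theta>) = (\<Sum>k<m. (norm (a k))\<^sup>2)"
proof -
  have "of_real (circ_sqnorm c (\<lambda>\<theta>. \<Sum>k<m. a k * circ_basis c N k \<theta>))
     = circ_integral c (\<lambda>\<theta>. \<Sum>j<m. a j * (\<Sum>k<m. cnj (a k) * (circ_basis c N j \<theta> * cnj (circ_basis c N k \<theta>))))"
    unfolding circ_sqnorm_circ_integral
    by (rule arg_cong[of _ _ "circ_integral c"], rule ext, unfold cnj_sum sum_product, unfold sum_distrib_left)
      (intro sum.cong refl, simp add: mult_ac)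
  also have "\<dots> = (\<Sum>j<m. a j * (\<Sum>k<m. cnj (a k) * (if j = k then 1 else 0)))"
    by (subst circ_integral_sum; (subst circ_integral_sum)?) (auto intro!: continuous_intros simp: circ_basis_orthonormal[OF c])
  also have "\<dots> = (\<Sum>j<m. a j * cnj (a j))"
    by (intro sum.cong refl) (simp add: if_distrib cong: if_cong)
  also have "\<dots> = of_real (\<Sum>k<m. (norm (a k))\<^sup>2)"
    by (simp add: complex_norm_square[symmetric])
  finally show ?thesis by (simp only: of_real_eq_iff)
qed

lemma poly_graded_basis:
  fixes q :: "nat \<Rightarrow> 'a::field poly"
  assumes q: "\<And>k. degree (q k) = k" "\<And>k. q k \<noteq> 0" and "p = 0 \<or> degree p < n"
  shows "\<exists>a. p = (\<Sum>k<n. smult (a k) (q k))"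
  using assms(3)
proof (induction n arbitrary: p)
  case 0
  then show ?case by simp
next
  case (Suc n)
  define r where "r = p - smult (coeff p n / coeff (q n) n) (q n)"
  have lc: "coeff (q n) n \<noteq> 0" using q[of n] by (metis leading_coeff_0_iff)
  have "coeff r i = 0" if "i \<ge> n" for i
  proof (cases "i = n")
    case True
    then show ?thesis using lc by (simp add: r_def)
  next
    case False
    with that have "coeff p i = 0" "coeff (q n) i = 0"
      using Suc.prems q(1)[of n] by (auto intro!: coeff_eq_0)
    then show ?thesis by (simp add: r_def)
  qed
  then have "r = 0 \<or> degree r < n"
    by (metis leading_coeff_0_iff not_less)
  from Suc.IH[OF this] obtain a where a: "r = (\<Sum>k<n. smult (a k) (q k))" by blast
  have "p = (\<Sum>k<Suc n. smult ((a(n := coeff p n / coeff (q n) n)) k) (q k))"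
    using a by (simp add: r_def algebra_simps)
  then show ?case by blast
qed

section \<open>Trigonometric polynomials and extremal values\<close>

definition trig_poly :: "nat \<Rightarrow> (real \<Rightarrow> complex) \<Rightarrow> bool" where
  "trig_poly N f \<longleftrightarrow> (\<exists>P. degree P \<le> 2 * N \<and> (\<forall>\<theta>. f \<theta> = cis (- (real N * \<theta>)) * poly P (cis \<theta>)))"

lemma trig_polyI: "degree P \<le> 2 * N \<Longrightarrow> (\<And>\<theta>. f \<theta> = cis (- (real N * \<theta>)) * poly P (cis \<theta>)) \<Longrightarrow> trig_poly N f"
  unfolding trig_poly_def by blast

lemma trig_poly_mult:
  assumes "trig_poly N f" "trig_poly M g"
  shows "trig_poly (N + M) (\<lambda>\<theta>. f \<theta> * g \<theta>)"
proof -
  obtain P Q where P: "degree P \<le> 2 * N" "\<And>\<theta>. f \<theta> = cis (- (real N * \<theta>)) * poly P (cis \<theta>)"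
    and Q: "degree Q \<le> 2 * M" "\<And>\<theta>. g \<theta> = cis (- (real M * \<theta>)) * poly Q (cis \<theta>)"
    using assms unfolding trig_poly_def by blast
  have c: "cis (- (real (N + M) * \<theta>)) = cis (- (real N * \<theta>)) * cis (- (real M * \<theta>))" for \<theta>
    by (simp add: cis_mult algebra_simps)
  show ?thesis
  proof (rule trig_polyI[of "P * Q"])
    show "degree (P * Q) \<le> 2 * (N + M)"
      by (rule order.trans[OF degree_mult_le]) (use P(1) Q(1) in simp)
  qed (unfold c P(2) Q(2), simp)
qed

lemma trig_poly_1: "trig_poly 0 (\<lambda>\<theta>. 1)"
  by (rule trig_polyI[of 1]) auto

lemma trig_poly_power: "trig_poly N f \<Longrightarrow> trig_poly (k * N) (\<lambda>\<theta>. f \<theta> ^ k)"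
  by (induction k) (auto intro: trig_poly_1 trig_poly_mult)

lemma trig_poly_const_1: "trig_poly 1 (\<lambda>\<theta>. 1)"
  by (rule trig_polyI[of "[:0, 1:]"]) (auto simp: cis_mult)

lemma trig_poly_mono:
  assumes "trig_poly N f" "N \<le> M"
  shows "trig_poly M f"
proof -
  have "trig_poly (N + (M - N) * 1) (\<lambda>\<theta>. f \<theta> * 1 ^ (M - N))"
    by (intro trig_poly_mult trig_poly_power trig_poly_const_1 assms)
  then show ?thesis using assms by simp
qed

lemma trig_poly_scale: "trig_poly N f \<Longrightarrow> trig_poly N (\<lambda>\<theta>. a * f \<theta>)"
  using trig_poly_mult[of 0 "\<lambda>_. a" N f] trig_polyI[of "[:a:]" 0 "\<lambda>_. a"] by simp

lemma trig_poly_add: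
  assumes "trig_poly N f" "trig_poly N g"
  shows "trig_poly N (\<lambda>\<theta>. f \<theta> + g \<theta>)"
proof -
  obtain P Q where P: "degree P \<le> 2 * N" "\<And>\<theta>. f \<theta> = cis (- (real N * \<theta>)) * poly P (cis \<theta>)"
    and Q: "degree Q \<le> 2 * N" "\<And>\<theta>. g \<theta> = cis (- (real N * \<theta>)) * poly Q (cis \<theta>)"
    using assms unfolding trig_poly_def by blast
  show ?thesis
  proof (rule trig_polyI[of "P + Q"])
    show "degree (P + Q) \<le> 2 * N" by (rule degree_add_le) (use P Q in auto)
  qed (unfold P(2) Q(2), simp add: algebra_simps)
qed

lemma trig_poly_sum:
  assumes "finite A" "\<And>i. i \<in> A \<Longrightarrow> trig_poly N (f i)"
  shows "trig_poly N (\<lambda>\<theta>. \<Sum>i\<in>A. f i \<theta>)"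
  using assms
proof (induction A rule: finite_induct)
  case empty
  then show ?case by (auto intro!: trig_polyI[of 0])
next
  case (insert i A)
  then show ?case by (simp add: trig_poly_add)
qed

lemma trig_poly_cos: "trig_poly 1 (\<lambda>\<theta>. of_real (cos \<theta>))"
proof (rule trig_polyI[of "[:1/2, 0, 1/2:]"])
  fix \<theta>
  have "of_real (cos \<theta>) = (cis \<theta> + cis (- \<theta>)) / 2" by (simp add: complex_eq_iff)
  moreover have "cis (- \<theta>) * (cis \<theta> * cis \<theta>) = cis \<theta>" by (simp add: cis_mult)
  ultimately show "complex_of_real (cos \<theta>) = cis (- (real 1 * \<theta>)) * poly [:1/2, 0, 1/2:] (cis \<theta>)"
    by (simp add: field_simps)
qed simp

lemma trig_poly_sin: "trig_poly 1 (\<lambda>\<theta>. of_real (sin \<theta>))"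
proof (rule trig_polyI[of "[:\<i>/2, 0, - \<i>/2:]"])
  fix \<theta>
  have "of_real (sin \<theta>) = (\<i> * cis (- \<theta>) - \<i> * cis \<theta>) / 2" by (simp add: complex_eq_iff)
  moreover have "cis (- \<theta>) * (cis \<theta> * cis \<theta>) = cis \<theta>" by (simp add: cis_mult)
  ultimately show "complex_of_real (sin \<theta>) = cis (- (real 1 * \<theta>)) * poly [:\<i>/2, 0, - \<i>/2:] (cis \<theta>)"
    by (simp add: field_simps)
qed simp

lemma trig_poly_bump: "trig_poly 1 (\<lambda>\<theta>. of_real ((1 + cos (\<theta> + a)) / 2))"
proof (rule trig_polyI[of "[:cis (- a) / 4, 1 / 2, cis a / 4:]"])
  fix \<theta>
  have "of_real ((1 + cos b) / 2) = 1 / 2 + (cis (- b) + cis b) / 4" for b by (simp add: complex_eq_iff field_simps)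
  then have "of_real ((1 + cos (\<theta> + a)) / 2) = 1 / 2 + (cis (- (\<theta> + a)) + cis (\<theta> + a)) / 4" .
  also have "\<dots> = cis (- \<theta>) * cis \<theta> / 2 + (cis (- a) * cis (- \<theta>) + cis (- \<theta>) * (cis \<theta> * cis \<theta>) * cis a) / 4"
    by (simp add: cis_mult add_ac)
  also have "\<dots> = cis (- (real 1 * \<theta>)) * poly [:cis (- a) / 4, 1 / 2, cis a / 4:] (cis \<theta>)"
    by (simp add: field_simps)
  finally show "complex_of_real ((1 + cos (\<theta> + a)) / 2) = cis (- (real 1 * \<theta>)) * poly [:cis (- a) / 4, 1 / 2, cis a / 4:] (cis \<theta>)" .
qed simp

lemma trig_poly_poly_sin:
  assumes "degree P \<le> n"
  shows "trig_poly n (\<lambda>\<theta>. poly P (of_real (sin \<theta>)))"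
proof -
  have "trig_poly n (\<lambda>\<theta>. \<Sum>i\<le>degree P. coeff P i * of_real (sin \<theta>) ^ i)"
  proof (intro trig_poly_sum trig_poly_scale)
    fix i assume "i \<in> {..degree P}"
    with assms show "trig_poly n (\<lambda>\<theta>. of_real (sin \<theta>) ^ i)"
      using trig_poly_power[OF trig_poly_sin, of i] by (auto intro: trig_poly_mono)
  qed simp
  then show ?thesis by (simp add: poly_altdef)
qed

lemma trig_poly_continuous: "trig_poly N f \<Longrightarrow> continuous_on A f"
proof -
  assume "trig_poly N f"
  then obtain P where "f = (\<lambda>\<theta>. cis (- (real N * \<theta>)) * poly P (cis \<theta>))"
    unfolding trig_poly_def by blast
  then show ?thesis by (auto intro!: continuous_intros)
qed

lemma trig_poly_circ_basis: "k \<le> 2 * N \<Longrightarrow> trig_poly N (circ_basis c N k)"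
  using degree_circ_poly_le[of "1 + jump_exponent c" k]
  by (intro trig_polyI[of "smult (1 / of_real (sqrt (circ_norm c))) (circ_poly (1 + jump_exponent c) k)"])
    (auto simp: circ_basis_def intro: order.trans[OF degree_smult_le])

lemma trig_poly_circ_basis_expansion:
  assumes c: "c > 0" "c \<noteq> 1" and f: "trig_poly N f"
  obtains a where "f = (\<lambda>\<theta>. \<Sum>k<2 * N + 1. a k * circ_basis c N k \<theta>)"
proof -
  obtain P where P: "degree P \<le> 2 * N" "\<And>\<theta>. f \<theta> = cis (- (real N * \<theta>)) * poly P (cis \<theta>)"
    using f unfolding trig_poly_def by blast
  have "circ_poly (1 + jump_exponent c) k \<noteq> 0" for k
    using coeff_circ_poly_nz[OF c, of k] by auto
  then obtain a where a: "P = (\<Sum>k<2 * N + 1. smult (a k) (circ_poly (1 + jump_exponent c) k))"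
    using poly_graded_basis[of "circ_poly (1 + jump_exponent c)" P "2 * N + 1"] degree_circ_poly[OF c] P(1)
    by auto
  have D: "complex_of_real (sqrt (circ_norm c)) \<noteq> 0"
    using circ_norm_pos[OF c] by simp
  have "f = (\<lambda>\<theta>. \<Sum>k<2 * N + 1. (a k * of_real (sqrt (circ_norm c))) * circ_basis c N k \<theta>)"
  proof
    fix \<theta>
    show "f \<theta> = (\<Sum>k<2 * N + 1. (a k * of_real (sqrt (circ_norm c))) * circ_basis c N k \<theta>)"
      unfolding P(2) a poly_sum sum_distrib_left circ_basis_def
      using D by (intro sum.cong refl) (simp add: mult_ac)
  qed
  then show ?thesis by (rule that)
qed

section \<open>Trigonometric polynomials symmetric about \<open>pi / 2\<close>\<close>

fun sin_cheb :: "nat \<Rightarrow> complex poly" where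
  "sin_cheb 0 = [:2:]"
| "sin_cheb (Suc 0) = [:0, 2 * \<i>:]"
| "sin_cheb (Suc (Suc k)) = [:0, 2 * \<i>:] * sin_cheb (Suc k) + sin_cheb k"

lemma degree_sin_cheb: "degree (sin_cheb k) \<le> k"
proof (induction k rule: sin_cheb.induct)
  case (3 k)
  have "degree ([:0, 2 * \<i>:] * sin_cheb (Suc k)) \<le> Suc (Suc k)"
    using degree_mult_le[of "[:0, 2 * \<i>:]" "sin_cheb (Suc k)"] 3(1) by simp
  then show ?case
    unfolding sin_cheb.simps(3) by (rule degree_add_le) (use 3(2) in simp)
qed simp_all

text \<open>The numbers \<open>cis \<theta>\<close> and \<open>cis (pi - \<theta>)\<close> have sum
  \<open>2 * \<i> * sin \<theta>\<close> and product -1. The recursion of \<open>sin_cheb\<close> is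
  the two-term recurrence of their power sums.\<close>

lemma poly_sin_cheb: "poly (sin_cheb k) (of_real (sin \<theta>)) = cis \<theta> ^ k + cis (pi - \<theta>) ^ k"
proof (induction k rule: sin_cheb.induct)
  case 2
  show ?case by (simp add: complex_eq_iff)
next
  case (3 k)
  define z w where "z = cis \<theta>" and "w = cis (pi - \<theta>)"
  have s: "2 * \<i> * of_real (sin \<theta>) = z + w" by (simp add: complex_eq_iff z_def w_def)
  have p: "z * w = - 1" by (simp add: z_def w_def cis_mult)
  have "poly (sin_cheb (Suc (Suc k))) (of_real (sin \<theta>)) = (z + w) * (z ^ Suc k + w ^ Suc k) + (z ^ k + w ^ k)"
    unfolding s[symmetric] unfolding z_def w_def 3[symmetric] by (simp add: mult_ac)
  also have "\<dots> = z ^ Suc (Suc k) + w ^ Suc (Suc k) + (z * w + 1) * (z ^ k + w ^ k)"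
    by (simp add: algebra_simps)
  finally show ?case unfolding p by (simp add: z_def w_def)
qed simp

text \<open>Symmetrizing a single frequency gives, up to a constant, a power sum of
  \<open>cis \<theta>\<close> and \<open>cis (pi - \<theta>)\<close>, hence a polynomial in
  \<open>sin \<theta>\<close>.\<close>

lemma trig_poly_symmetrize:
  assumes "trig_poly N f"
  obtains P where "degree P \<le> N" "\<And>\<theta>. f \<theta> + f (pi - \<theta>) = poly P (of_real (sin \<theta>))"
proof -
  obtain Q where Q: "degree Q \<le> 2 * N" "\<And>\<theta>. f \<theta> = cis (- (real N * \<theta>)) * poly Q (cis \<theta>)"
    using assms unfolding trig_poly_def by blast
  define m where "m j = (if N \<le> j then j - N else N - j)" for j
  \<comment> \<open>For negative frequencies: \<open>cis (- m \<theta>)\<close> is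
    \<open>cis (- m pi)\<close> times \<open>cis (pi - \<theta>) ^ m\<close>, so a negative power of
    one generator is a positive power of the other.\<close>
  define s where "s j = (if N \<le> j then 1 else cis (- (real (m j) * pi)))" for j
  define P where "P = (\<Sum>j\<le>degree Q. smult (coeff Q j * s j) (sin_cheb (m j)))"
  show ?thesis
  proof
    show "degree P \<le> N"
      unfolding P_def
    proof (rule degree_sum_le)
      fix j assume "j \<in> {..degree Q}"
      then have "m j \<le> N" using Q(1) by (auto simp: m_def)
      then show "degree (smult (coeff Q j * s j) (sin_cheb (m j))) \<le> N"
        using degree_smult_le[of "coeff Q j * s j" "sin_cheb (m j)"] degree_sin_cheb[of "m j"] by linarith
    qed simp
    fix \<theta>
    have t: "cis (- (real N * \<theta>)) * cis \<theta> ^ j + cis (- (real N * (pi - \<theta>))) * cis (pi - \<theta>) ^ j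
        = s j * poly (sin_cheb (m j)) (of_real (sin \<theta>))" for j
    proof (cases "N \<le> j")
      case True
      then have "cis (- (real N * x)) * cis x ^ j = cis x ^ m j" for x
        by (simp add: Complex.DeMoivre cis_mult m_def of_nat_diff algebra_simps)
      then show ?thesis using True by (simp add: poly_sin_cheb s_def)
    next
      case False
      then have e: "cis (- (real N * x)) * cis x ^ j = cis (- (real (m j) * x))" for x
        by (simp add: Complex.DeMoivre cis_mult m_def of_nat_diff algebra_simps)
      have "s j * cis \<theta> ^ m j = cis (- (real (m j) * (pi - \<theta>)))" "s j * cis (pi - \<theta>) ^ m j = cis (- (real (m j) * \<theta>))"
        using False by (simp_all add: s_def Complex.DeMoivre cis_mult algebra_simps)
      then show ?thesis unfolding e by (simp add: poly_sin_cheb distrib_left)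
    qed
    have "f \<theta> + f (pi - \<theta>) = (\<Sum>j\<le>degree Q. coeff Q j * (cis (- (real N * \<theta>)) * cis \<theta> ^ j + cis (- (real N * (pi - \<theta>))) * cis (pi - \<theta>) ^ j))"
      unfolding Q(2) poly_altdef by (simp add: sum_distrib_left sum.distrib[symmetric] algebra_simps)
    also have "\<dots> = poly P (of_real (sin \<theta>))"
      unfolding t P_def by (simp add: poly_sum mult.assoc)
    finally show "f \<theta> + f (pi - \<theta>) = poly P (of_real (sin \<theta>))" .
  qed
qed

text \<open>By the Cauchy-Schwarz inequality, this is the maximum of \<open>\<bar>s f(a) + t f(b)\<bar>\<^sup>2\<close> over the unit ball of the span of the orthonormal
  functions \<open>e 0, ..., e (n - 1)\<close>.\<close>

definition two_point :: "(nat \<Rightarrow> real \<Rightarrow> complex) \<Rightarrow> nat \<Rightarrow> real \<Rightarrow> real \<Rightarrow> real \<Rightarrow> real \<Rightarrow> real" where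
  "two_point e n s t a b = (\<Sum>k<n. (norm (of_real s * e k a + of_real t * e k b))\<^sup>2)"

lemma two_point_nonneg: "two_point e n s t a b \<ge> 0"
  by (simp add: two_point_def sum_nonneg)

lemma two_point_kernel:
  "two_point e n s t a b = s\<^sup>2 * Re (\<Sum>k<n. e k a * cnj (e k a)) + 2 * s * t * Re (\<Sum>k<n. e k a * cnj (e k b))
      + t\<^sup>2 * Re (\<Sum>k<n. e k b * cnj (e k b))"
proof -
  have "(norm (of_real s * e k a + of_real t * e k b))\<^sup>2
     = s\<^sup>2 * Re (e k a * cnj (e k a)) + 2 * s * t * Re (e k a * cnj (e k b)) + t\<^sup>2 * Re (e k b * cnj (e k b))" for k
    unfolding cmod_power2 by (simp add: power2_eq_square algebra_simps)
  then show ?thesis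
    unfolding two_point_def Re_sum by (simp only: sum.distrib sum_distrib_left)
qed

lemma two_point_bound:
  assumes "f = (\<lambda>x. \<Sum>k<n. u k * e k x)"
  shows "(norm (of_real s * f a + of_real t * f b))\<^sup>2 \<le> two_point e n s t a b * (\<Sum>k<n. (norm (u k))\<^sup>2)"
proof -
  define v where "v k = of_real s * e k a + of_real t * e k b" for k
  have "of_real s * f a + of_real t * f b = (\<Sum>k<n. u k * v k)"
    unfolding assms v_def by (simp add: sum_distrib_left sum.distrib[symmetric] algebra_simps)
  then have "norm (of_real s * f a + of_real t * f b) \<le> (\<Sum>k<n. norm (v k) * norm (u k))"
    using norm_sum[of "\<lambda>k. u k * v k" "{..<n}"] by (simp add: norm_mult mult.commute)
  then have "(norm (of_real s * f a + of_real t * f b))\<^sup>2 \<le> (\<Sum>k<n. norm (v k) * norm (u k))\<^sup>2"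
    by (intro power_mono) auto
  also have "\<dots> \<le> (\<Sum>k<n. (norm (v k))\<^sup>2) * (\<Sum>k<n. (norm (u k))\<^sup>2)"
    by (rule Cauchy_Schwarz_ineq_sum)
  finally show ?thesis by (simp add: two_point_def v_def)
qed

text \<open>The conjugated values are the equality case of Cauchy-Schwarz. With these coefficients
  the functional and the squared norm both equal the extremal value, so in a comparison it can be
  cancelled once.\<close>

lemma two_point_attained:
  fixes e n s t a b
  defines "u \<equiv> (\<lambda>k. cnj (of_real s * e k a + of_real t * e k b))"
    and "f \<equiv> (\<lambda>x. \<Sum>k<n. cnj (of_real s * e k a + of_real t * e k b) * e k x)"
  shows "of_real s * f a + of_real t * f b = of_real (two_point e n s t a b)"
    and "(\<Sum>k<n. (norm (u k))\<^sup>2) = two_point e n s t a b"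
proof -
  have "of_real s * f a + of_real t * f b
      = (\<Sum>k<n. (of_real s * e k a + of_real t * e k b) * cnj (of_real s * e k a + of_real t * e k b))"
    unfolding f_def by (simp add: sum_distrib_left sum.distrib[symmetric] algebra_simps)
  then show "of_real s * f a + of_real t * f b = of_real (two_point e n s t a b)"
    by (simp only: two_point_def of_real_sum complex_norm_square)
  show "(\<Sum>k<n. (norm (u k))\<^sup>2) = two_point e n s t a b"
    unfolding u_def complex_mod_cnj two_point_def ..
qed

section \<open>The weight on the interval\<close>

lemma real_analytic_on_imp_continuous_on:
  assumes "f real_analytic_on S"
  shows "continuous_on S f"
  unfolding continuous_on_eq_continuous_within
proof
  fix x assume "x \<in> S"
  then obtain r a where r: "r > 0" and a: "\<And>y. y \<in> ball x r \<inter> S \<Longrightarrow> (\<lambda>k. a k * (y - x) ^ k) sums f y"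
    using assms unfolding real_analytic_on_def by blast
  show "continuous (at x within S) f"
  \<comment> \<open>A point of convergence other than the centre makes the power series continuous
    at the centre; without one, \<open>x\<close> is isolated in \<open>S\<close>.\<close>
  proof (cases "\<exists>y\<in>ball x r \<inter> S. y \<noteq> x")
    case False
    then have "\<forall>\<^sub>F y in at x within S. f x = f y"
      unfolding eventually_at using r by (auto simp: dist_commute intro!: exI[of _ r])
    from Lim_transform_eventually[OF tendsto_const this]
    show ?thesis unfolding continuous_within .
  next
    case True
    then obtain y where y: "y \<in> ball x r \<inter> S" "y \<noteq> x" by blast
    define g where "g z = (\<Sum>k. a k * z ^ k)" for z
    have "isCont g 0"
      unfolding g_def by (rule isCont_powser[OF sums_summable[OF a[OF y(1)]]]) (use y in simp)
    then have "(g \<longlongrightarrow> g 0) (at 0)" by (simp add: isCont_def)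
    have cont: "isCont (\<lambda>z. g (z - x)) x"
      by (rule isCont_o2[where f = "\<lambda>z. z - x" and g = g]) (use \<open>isCont g 0\<close> in \<open>auto intro!: continuous_intros\<close>)
    have fg: "f z = g (z - x)" if "z \<in> ball x r \<inter> S" for z
      unfolding g_def using sums_unique[OF a[OF that]] .
    have "((\<lambda>z. g (z - x)) \<longlongrightarrow> g (x - x)) (at x within S)"
      using cont unfolding isCont_def by (rule tendsto_within_subset) simp
    then have "(f \<longlongrightarrow> g (x - x)) (at x within S)"
      by (rule Lim_transform_eventually) (use r fg in \<open>auto simp: eventually_at dist_commute intro!: exI[of _ r]\<close>)
    then show ?thesis unfolding continuous_within using fg[of x] r \<open>x \<in> S\<close> by simp
  qed
qed

lemma om_bounds:
  assumes "c > 0"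
  obtains C where "C > 0" "\<And>\<theta>. \<theta> \<in> {-pi/2..pi/2} \<Longrightarrow> arc_weight c \<theta> \<le> C \<and> 1 \<le> C * arc_weight c \<theta> \<and> refl_weight c \<theta> \<le> C \<and> 1 \<le> C * refl_weight c \<theta>"
proof -
  define E where "E = exp (\<bar>ln c\<bar>)"
  \<comment> \<open>The bracket dominates every value of \<open>jump c\<close>, the constant
    \<open>c\<close> and all their reciprocals; \<open>E\<close> dominates the exponentials.\<close>
  define C where "C = (1 + c + c\<^sup>2 + 1 / c + 1 / c\<^sup>2) * E"
  have E: "E > 0" by (simp add: E_def)
  show ?thesis
  proof
    show "C > 0" unfolding C_def using assms E by (intro mult_pos_pos add_pos_pos) auto
    fix \<theta> :: real assume th: "\<theta> \<in> {-pi/2..pi/2}"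
    have "\<bar>\<theta> / pi\<bar> \<le> 1" using th by (simp add: field_simps abs_le_iff)
    then have "\<bar>ln c * (\<theta> / pi)\<bar> \<le> \<bar>ln c\<bar>"
      unfolding abs_mult by (metis mult.right_neutral mult_left_mono abs_ge_zero)
    then have b: "\<bar>ln c / pi * \<theta>\<bar> \<le> \<bar>ln c\<bar>" by simp
    define x where "x = exp (ln c / pi * \<theta>)"
    define y where "y = exp (- (ln c / pi * \<theta>))"
    have x: "x > 0" "x \<le> E" "y > 0" "y \<le> E" "x * y = 1"
      using abs_le_D1[OF b] abs_le_D2[OF b] by (simp_all only: x_def y_def E_def exp_add[symmetric] exp_le_cancel_iff exp_gt_zero) simp
    have j: "jump c \<theta> > 0" "jump c \<theta> \<le> 1 + c + c\<^sup>2 + 1 / c + 1 / c\<^sup>2" "1 / jump c \<theta> \<le> 1 + c + c\<^sup>2 + 1 / c + 1 / c\<^sup>2"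
      using assms by (auto simp: jump_def intro!: add_nonneg_nonneg)
    have k: "c \<le> 1 + c + c\<^sup>2 + 1 / c + 1 / c\<^sup>2" "1 / c \<le> 1 + c + c\<^sup>2 + 1 / c + 1 / c\<^sup>2"
      using assms by (auto intro!: add_nonneg_nonneg)
    have 1: "arc_weight c \<theta> = jump c \<theta> * y" "refl_weight c \<theta> = c * x"
      by (simp_all add: arc_weight_def refl_weight_def x_def y_def)
    have "jump c \<theta> * y \<le> C" unfolding C_def using x j by (intro mult_mono) auto
    moreover have "c * x \<le> C" unfolding C_def using x k assms by (intro mult_mono) auto
    moreover have "1 / jump c \<theta> * x \<le> C" unfolding C_def using x j by (intro mult_mono) auto
    then have "(1 / jump c \<theta> * x) * (jump c \<theta> * y) \<le> C * (jump c \<theta> * y)"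
      using x j by (intro mult_right_mono) auto
    moreover have "(1 / jump c \<theta> * x) * (jump c \<theta> * y) = 1" using j x(5) by simp
    moreover have "1 / c * y \<le> C" unfolding C_def using x k assms by (intro mult_mono) auto
    then have "(1 / c * y) * (c * x) \<le> C * (c * x)"
      using x assms by (intro mult_right_mono) auto
    moreover have "(1 / c * y) * (c * x) = 1" using x(5) assms by (simp add: mult.commute)
    ultimately show "arc_weight c \<theta> \<le> C \<and> 1 \<le> C * arc_weight c \<theta> \<and> refl_weight c \<theta> \<le> C \<and> 1 \<le> C * refl_weight c \<theta>"
      unfolding 1 by simp
  qed
qed

lemma powr_le_powr_two:
  fixes x \<alpha> \<gamma> :: real
  assumes "0 < x" "x \<le> 2" "\<alpha> \<le> \<gamma>"
  shows "x powr \<gamma> \<le> 2 powr (\<gamma> - \<alpha>) * x powr \<alpha>"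
proof -
  have "x powr \<gamma> = x powr (\<gamma> - \<alpha>) * x powr \<alpha>" by (simp add: powr_add[symmetric])
  also have "\<dots> \<le> 2 powr (\<gamma> - \<alpha>) * x powr \<alpha>"
    using assms by (intro mult_right_mono powr_mono2) auto
  finally show ?thesis .
qed

locale jump_jacobi =
  fixes \<alpha> \<beta> c :: real and h :: "real \<Rightarrow> real" and p :: "nat \<Rightarrow> real poly"
  assumes h_cont: "continuous_on {-1..1} h" and h_pos: "\<And>x. x \<in> {-1..1} \<Longrightarrow> h x > 0"
    and c: "c > 0" "c \<noteq> 1"
    and orthonormal: "orthonormal_polys (jump_jacobi_weight \<alpha> \<beta> h c) p"
begin

text \<open>The factor \<open>cos \<theta>\<close> is the Jacobian of
  \<open>x = sin \<theta>\<close>.\<close>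

definition polar_weight :: "real \<Rightarrow> real" where
  "polar_weight \<theta> = jump_jacobi_weight \<alpha> \<beta> h c (sin \<theta>) * cos \<theta>"

lemma h0: "h 0 > 0" by (rule h_pos) simp

lemma jump_sin: "\<theta> \<in> {-pi/2..pi/2} \<Longrightarrow> jump c (sin \<theta>) = jump c \<theta>"
proof -
  assume th: "\<theta> \<in> {-pi/2..pi/2}"
  have "sin \<theta> < 0 \<longleftrightarrow> \<theta> < 0"
  proof
    assume "\<theta> < 0"
    then have "sin (- \<theta>) > 0" using th by (intro sin_gt_zero) auto
    then show "sin \<theta> < 0" by simp
  next
    assume "sin \<theta> < 0"
    then show "\<theta> < 0" using sin_ge_zero[of \<theta>] th by force
  qed
  then show ?thesis by (simp add: jump_def)
qed

text \<open>Since \<open>(1 - sin \<theta>) * (1 + sin \<theta>)\<close> is the square of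
  \<open>cos \<theta>\<close>, a high power of \<open>cos \<theta>\<close> outweighs any power-type
  zero or singularity at the endpoints, both of the weight and of its reciprocal.\<close>

lemma polar_weight_bounds:
  obtains A C where "A > 0" "C > 0"
    "\<And>\<theta>. \<theta> \<in> {-pi/2..pi/2} \<Longrightarrow> 0 \<le> polar_weight \<theta> \<and> cos \<theta> ^ (2 * A) \<le> C * polar_weight \<theta> \<and> cos \<theta> ^ (2 * A) * polar_weight \<theta> \<le> C"
proof -
  \<comment> \<open>Large enough for \<open>A - (\<alpha> + 1)\<close>,
    \<open>A - (\<beta> + 1)\<close>, \<open>A + \<alpha>\<close> and \<open>A + \<beta>\<close> to
    be nonnegative; the exponents \<open>\<alpha> + 1\<close> and \<open>\<beta> + 1\<close> come
    from bounding the Jacobian \<open>cos \<theta>\<close> below by its square.\<close>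
  obtain A :: nat where A: "real A \<ge> \<bar>\<alpha>\<bar> + \<bar>\<beta>\<bar> + 1" using real_arch_simple by blast
  obtain x1 x2 where x1: "x1 \<in> {-1..1}" "\<And>x. x \<in> {-1..1} \<Longrightarrow> h x1 \<le> h x"
    and x2: "x2 \<in> {-1..1}" "\<And>x. x \<in> {-1..1} \<Longrightarrow> h x \<le> h x2"
    using continuous_attains_inf[of "{-1..1::real}" h] continuous_attains_sup[of "{-1..1::real}" h] h_cont by auto
  define g where "g = h x1 * min 1 (c\<^sup>2)"
  define M where "M = h x2 * max 1 (c\<^sup>2)"
  have g: "g > 0" unfolding g_def using h_pos[OF x1(1)] c by simp
  have M: "M > 0" unfolding M_def using h_pos[OF x2(1)] by (simp add: less_max_iff_disj)
  define a where "a = 2 powr (real A - (\<alpha> + 1)) * 2 powr (real A - (\<beta> + 1))"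
  define b where "b = 2 powr (real A + \<alpha>) * 2 powr (real A + \<beta>)"
  have hj: "g \<le> h s * jump c s" "h s * jump c s \<le> M" if "s \<in> {-1..1}" for s
  proof -
    have "min 1 (c\<^sup>2) \<le> jump c s" "jump c s \<le> max 1 (c\<^sup>2)" by (auto simp: jump_def)
    moreover have "min 1 (c\<^sup>2) \<ge> 0" "jump c s \<ge> 0" by (auto simp: jump_def)
    moreover have "h x1 \<le> h s" "h s \<le> h x2" "0 \<le> h s" "0 \<le> h x2"
      using x1(2)[OF that] x2(2)[OF that] h_pos[OF that] h_pos[OF x2(1)] by auto
    ultimately show "g \<le> h s * jump c s" "h s * jump c s \<le> M"
      unfolding g_def M_def by (auto intro: mult_mono)
  qed
  show ?thesis
  proof
    have "real A > 0" using A by linarith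
    then show "A > 0" by simp
    show "a / g + b * M > 0" using g M by (simp add: a_def b_def add_pos_pos)
    fix \<theta> :: real assume th: "\<theta> \<in> {-pi/2..pi/2}"
    define s where "s = sin \<theta>"
    have cs: "cos \<theta> \<ge> 0" using th by (intro cos_ge_zero) auto
    show "0 \<le> polar_weight \<theta> \<and> cos \<theta> ^ (2 * A) \<le> (a / g + b * M) * polar_weight \<theta> \<and> cos \<theta> ^ (2 * A) * polar_weight \<theta> \<le> a / g + b * M"
    proof (cases "cos \<theta> = 0")
      case True
      \<comment> \<open>At the endpoints the weight vanishes through its Jacobian and the power of
        \<open>cos \<theta>\<close> through \<open>A > 0\<close>, whatever the values of the real
        powers.\<close>
      then show ?thesis using \<open>A > 0\<close> g M by (simp add: polar_weight_def a_def b_def power_0_left)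
    next
      case False
      with cs have cpos: "cos \<theta> > 0" by simp
      have c2: "(cos \<theta>)\<^sup>2 = (1 - s) * (1 + s)"
        unfolding s_def by (simp add: cos_squared_eq power2_eq_square algebra_simps)
      have s: "-1 < s" "s < 1"
      proof -
        have "(1 - s) * (1 + s) > 0" using c2 cpos by (metis zero_less_power)
        moreover have "-1 \<le> s" "s \<le> 1" by (simp_all add: s_def)
        ultimately show "-1 < s" "s < 1" by (auto simp: zero_less_mult_iff)
      qed
      define H where "H = h s * jump c s"
      have H: "g \<le> H" "H \<le> M" unfolding H_def using hj[of s] s by auto
      define Q where "Q = (1 - s) powr \<alpha> * (1 + s) powr \<beta>"
      have Q: "Q > 0" using s by (simp add: Q_def)
      have polar_weight: "polar_weight \<theta> = Q * H * cos \<theta>"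
        by (simp add: polar_weight_def jump_jacobi_weight_def s_def[symmetric] Q_def H_def)
      have W0: "polar_weight \<theta> > 0" unfolding polar_weight using Q H g cpos by auto
      have cA: "cos \<theta> ^ (2 * A) = (1 - s) powr real A * (1 + s) powr real A"
        unfolding power_mult c2 power_mult_distrib using s by (simp add: powr_realpow)
      have "cos \<theta> ^ (2 * A) \<le> (2 powr (real A - (\<alpha> + 1)) * (1 - s) powr (\<alpha> + 1)) * (2 powr (real A - (\<beta> + 1)) * (1 + s) powr (\<beta> + 1))"
        unfolding cA using s A by (intro mult_mono powr_le_powr_two) auto
      also have "\<dots> = a * (Q * (cos \<theta>)\<^sup>2)"
        unfolding c2 a_def Q_def using s by (simp add: powr_add)
      also have "\<dots> \<le> a * (Q * cos \<theta>)"
      proof -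
        have "(cos \<theta>)\<^sup>2 \<le> cos \<theta>" using cs cos_le_one[of \<theta>] by (simp add: power2_eq_square mult_left_le)
        then show ?thesis using Q by (intro mult_left_mono) (auto simp: a_def)
      qed
      also have "\<dots> = a / g * (Q * g * cos \<theta>)" using g by simp
      also have "\<dots> \<le> a / g * polar_weight \<theta>"
        unfolding polar_weight using H Q cs g by (intro mult_left_mono mult_right_mono) (auto simp: a_def)
      also have "\<dots> \<le> (a / g + b * M) * polar_weight \<theta>"
        using W0 M by (intro mult_right_mono) (auto simp: b_def)
      finally have 1: "cos \<theta> ^ (2 * A) \<le> (a / g + b * M) * polar_weight \<theta>" .
      have "cos \<theta> ^ (2 * A) * polar_weight \<theta> = ((1 - s) powr (real A + \<alpha>) * (1 + s) powr (real A + \<beta>)) * H * cos \<theta>"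
        unfolding polar_weight cA Q_def by (simp add: powr_add mult_ac)
      also have "\<dots> \<le> (2 powr (real A + \<alpha>) * 2 powr (real A + \<beta>)) * M * 1"
        using s A H g cs by (intro mult_mono powr_mono2) auto
      also have "\<dots> \<le> a / g + b * M" using g by (simp add: a_def b_def)
      finally show ?thesis using 1 W0 by simp
    qed
  qed
qed

lemma polar_weight_near_0:
  assumes "\<epsilon> > 0"
  obtains \<rho> where "\<rho> > 0" "\<rho> < pi/2"
    "\<And>\<theta>. \<bar>\<theta>\<bar> < \<rho> \<Longrightarrow> polar_weight \<theta> \<le> (1 + \<epsilon>) * h 0 * arc_weight c \<theta> \<and> h 0 * arc_weight c \<theta> \<le> (1 + \<epsilon>) * polar_weight \<theta>"
proof -
  \<comment> \<open>This is \<open>polar_weight \<theta> / arc_weight c \<theta>\<close> near 0: the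
    common jump cancels, and what remains is continuous with value \<open>h 0\<close>.\<close>
  define V where "V \<theta> = (1 - sin \<theta>) powr \<alpha> * (1 + sin \<theta>) powr \<beta> * h (sin \<theta>) * cos \<theta> * exp (ln c / pi * \<theta>)" for \<theta>
  have hc: "isCont h 0"
    by (rule continuous_on_interior[OF h_cont]) (simp add: interior_atLeastAtMost_real)
  have hs: "isCont (\<lambda>\<theta>. h (sin \<theta>)) 0"
    by (rule isCont_o2[where f = sin and g = h]) (use hc in auto)
  have "isCont V 0"
    unfolding V_def by (intro isCont_mult continuous_at_within_powr hs) auto
  then have V: "(V \<longlongrightarrow> h 0) (at 0)" by (simp add: isCont_def V_def)
  have "h 0 < (1 + \<epsilon>) * h 0" "h 0 / (1 + \<epsilon>) < h 0"
    using assms h0 by (simp_all add: field_simps)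
  then have "\<forall>\<^sub>F \<theta> in at 0. V \<theta> < (1 + \<epsilon>) * h 0" "\<forall>\<^sub>F \<theta> in at 0. h 0 / (1 + \<epsilon>) < V \<theta>"
    using order_tendstoD[OF V] by blast+
  then have "\<forall>\<^sub>F \<theta> in at 0. V \<theta> < (1 + \<epsilon>) * h 0 \<and> h 0 / (1 + \<epsilon>) < V \<theta>"
    by eventually_elim simp
  then obtain d where d: "d > 0" "\<And>\<theta>. \<theta> \<noteq> 0 \<Longrightarrow> \<bar>\<theta>\<bar> < d \<Longrightarrow> V \<theta> < (1 + \<epsilon>) * h 0 \<and> h 0 / (1 + \<epsilon>) < V \<theta>"
    unfolding eventually_at by (auto simp: dist_real_def)
  have d': "V \<theta> < (1 + \<epsilon>) * h 0 \<and> h 0 / (1 + \<epsilon>) < V \<theta>" if "\<bar>\<theta>\<bar> < d" for \<theta>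
    using d(2)[OF _ that] \<open>h 0 < _\<close> \<open>_ < h 0\<close> by (cases "\<theta> = 0") (auto simp: V_def)
  show ?thesis
  proof (rule that[of "min d (pi/4)"])
    show "min d (pi / 4) > 0" using d by simp
    show "min d (pi / 4) < pi / 2" using pi_gt_zero min.cobounded2[of d "pi / 4"] by linarith
    fix \<theta> assume "\<bar>\<theta>\<bar> < min d (pi / 4)"
    then have th: "\<bar>\<theta>\<bar> < d" "\<theta> \<in> {-pi/2..pi/2}" by auto
    have e: "exp (ln c / pi * \<theta>) * exp (- (ln c / pi * \<theta>)) = 1" by (simp add: exp_add[symmetric])
    have om: "arc_weight c \<theta> > 0" using c by (simp add: arc_weight_def jump_def)
    have "V \<theta> * arc_weight c \<theta> = (1 - sin \<theta>) powr \<alpha> * (1 + sin \<theta>) powr \<beta> * h (sin \<theta>) * cos \<theta> * jump c \<theta> *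
         (exp (ln c / pi * \<theta>) * exp (- (ln c / pi * \<theta>)))"
      by (simp add: V_def arc_weight_def mult_ac del: mult_exp_exp)
    then have polar_weight: "polar_weight \<theta> = V \<theta> * arc_weight c \<theta>"
      unfolding e polar_weight_def jump_jacobi_weight_def jump_sin[OF th(2)] by simp
    have "V \<theta> * arc_weight c \<theta> \<le> ((1 + \<epsilon>) * h 0) * arc_weight c \<theta>"
      using d'[OF th(1)] om by (intro mult_right_mono) auto
    moreover have "h 0 \<le> (1 + \<epsilon>) * V \<theta>"
      using d'[OF th(1)] assms by (simp add: field_simps)
    then have "h 0 * arc_weight c \<theta> \<le> ((1 + \<epsilon>) * V \<theta>) * arc_weight c \<theta>"
      using om by (intro mult_right_mono) auto
    ultimately show "polar_weight \<theta> \<le> (1 + \<epsilon>) * h 0 * arc_weight c \<theta> \<and> h 0 * arc_weight c \<theta> \<le> (1 + \<epsilon>) * polar_weight \<theta>"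
      unfolding polar_weight by (simp add: mult_ac)
  qed
qed

end

section \<open>Localization\<close>

text \<open>The power of \<open>cos \<theta>\<close> controls the weight at the endpoints, and the last two factors make the
  localizer vanish at \<open>pi - a\<close> and \<open>pi - b\<close>, so that symmetrizing does not disturb the values at \<open>a\<close> and \<open>b\<close>.\<close>

definition localizer :: "nat \<Rightarrow> nat \<Rightarrow> real \<Rightarrow> real \<Rightarrow> real \<Rightarrow> real" where
  "localizer A m a b \<theta> =
     cos \<theta> ^ A * ((1 + cos \<theta>) / 2) ^ m * ((1 + cos (\<theta> + a)) / 2) * ((1 + cos (\<theta> + b)) / 2)"

lemma trig_poly_localizer: "trig_poly (A + m + 2) (\<lambda>\<theta>. of_real (localizer A m a b \<theta>))"
proof -
  have "trig_poly (A * 1 + m * 1 + 1 + 1) (\<lambda>\<theta>. of_real (cos \<theta>) ^ A * of_real ((1 + cos (\<theta> + 0)) / 2) ^ m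
      * of_real ((1 + cos (\<theta> + a)) / 2) * of_real ((1 + cos (\<theta> + b)) / 2))"
    by (intro trig_poly_mult trig_poly_power trig_poly_cos trig_poly_bump)
  then show ?thesis by (simp add: localizer_def)
qed

lemma localizer_reflect_0: "localizer A m a b (pi - a) = 0" "localizer A m a b (pi - b) = 0"
  by (simp_all add: localizer_def)

lemma bump_bounds:
  fixes x :: real
  shows "0 \<le> (1 + cos x) / 2" "(1 + cos x) / 2 \<le> 1"
proof -
  have "0 \<le> 1 + cos x" by (metis add.right_inverse add_left_mono cos_ge_minus_one)
  then show "0 \<le> (1 + cos x) / 2" by simp
  have "1 + cos x \<le> 1 + 1" by (rule add_left_mono) (rule cos_le_one)
  then show "(1 + cos x) / 2 \<le> 1" by simp
qed

text \<open>The factors that depend on \<open>a\<close> and \<open>b\<close> lie between 0 and 1 and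
  are dropped, so the bounds built on this one are uniform in the evaluation points.\<close>

lemma localizer_sq_le: "(localizer A m a b \<theta>)\<^sup>2 \<le> cos \<theta> ^ (2 * A) * (((1 + cos \<theta>) / 2) ^ m)\<^sup>2"
proof -
  define u where "u = ((1 + cos (\<theta> + a)) / 2) * ((1 + cos (\<theta> + b)) / 2)"
  have u: "0 \<le> u" "u \<le> 1"
    unfolding u_def by (rule mult_nonneg_nonneg mult_le_one, (rule bump_bounds)+)+
  have "(localizer A m a b \<theta>)\<^sup>2 = cos \<theta> ^ (2 * A) * (((1 + cos \<theta>) / 2) ^ m)\<^sup>2 * u\<^sup>2"
  proof -
    have "(x * y * v * w)\<^sup>2 = x\<^sup>2 * y\<^sup>2 * (v * w)\<^sup>2" for x y v w :: real
      by (simp add: power_mult_distrib)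
    then show ?thesis unfolding localizer_def u_def power_even_eq .
  qed
  also have "\<dots> \<le> cos \<theta> ^ (2 * A) * (((1 + cos \<theta>) / 2) ^ m)\<^sup>2 * 1"
    using u by (intro mult_left_mono) (auto simp: power_le_one power_mult)
  finally show ?thesis by simp
qed

lemma localizer_sq_le_geometric:
  assumes "(1 + cos \<theta>) / 2 \<le> q" "0 \<le> q" "q \<le> 1"
  shows "(localizer A m a b \<theta>)\<^sup>2 \<le> cos \<theta> ^ (2 * A) * q ^ m"
proof -
  have "(((1 + cos \<theta>) / 2) ^ m)\<^sup>2 \<le> (q ^ m)\<^sup>2"
    using assms bump_bounds[of \<theta>] by (intro power_mono) auto
  also have "\<dots> \<le> q ^ m"
    using assms by (simp add: power2_eq_square mult_left_le power_le_one)
  finally show ?thesis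
    using localizer_sq_le[of A m a b \<theta>] by (smt (verit) mult_left_mono power_mult zero_le_power zero_le_power2)
qed

lemma localizer_sq_le_1: "(localizer A m a b \<theta>)\<^sup>2 \<le> 1"
proof -
  have "cos \<theta> ^ (2 * A) \<le> 1"
    unfolding power_mult by (rule power_le_one) (auto simp: power_le_one_iff abs_square_le_1)
  then show ?thesis
    using localizer_sq_le_geometric[of \<theta> 1 A m a b] bump_bounds[of \<theta>] by auto
qed

context jump_jacobi begin

text \<open>Near 0 the weights agree up to \<open>1 + \<epsilon> / 2\<close> and the squared
  localizer is at most 1. Elsewhere, including the reflected half of the circle, a power of
  \<open>q < 1\<close> beats all constants, while the power of \<open>cos \<theta>\<close> absorbs
  the endpoint behaviour. The first bound serves the passage from interval to circle, the other two
  the way back; \<open>1 + 1 / \<epsilon>\<close> is the price of separating a function from its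
  mirror image.\<close>

lemma localized_weights:
  assumes "\<epsilon> > 0"
  obtains A m0 where "\<And>m a b \<theta>. m \<ge> m0 \<Longrightarrow> \<theta> \<in> {-pi/2..pi/2} \<Longrightarrow>
     (localizer A m a b \<theta>)\<^sup>2 * arc_weight c \<theta> + (localizer A m a b (pi - \<theta>))\<^sup>2 * refl_weight c \<theta> \<le> (1 + \<epsilon>) / h 0 * polar_weight \<theta>
   \<and> (localizer A m a b \<theta>)\<^sup>2 * polar_weight \<theta> \<le> (1 + \<epsilon>) * h 0 * arc_weight c \<theta>
   \<and> (1 + 1 / \<epsilon>) * (localizer A m a b (pi - \<theta>))\<^sup>2 * polar_weight \<theta> \<le> (1 + \<epsilon>) * h 0 * refl_weight c \<theta>"
proof -
  obtain A C where C: "C > 0"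
    "\<And>\<theta>. \<theta> \<in> {-pi/2..pi/2} \<Longrightarrow> 0 \<le> polar_weight \<theta> \<and> cos \<theta> ^ (2 * A) \<le> C * polar_weight \<theta> \<and> cos \<theta> ^ (2 * A) * polar_weight \<theta> \<le> C"
    by (rule polar_weight_bounds) blast
  obtain B where B: "B > 0" "\<And>\<theta>. \<theta> \<in> {-pi/2..pi/2} \<Longrightarrow> arc_weight c \<theta> \<le> B \<and> 1 \<le> B * arc_weight c \<theta> \<and> refl_weight c \<theta> \<le> B \<and> 1 \<le> B * refl_weight c \<theta>"
    using om_bounds[OF c(1)] by blast
  obtain \<rho> where \<rho>: "\<rho> > 0" "\<rho> < pi/2"
    "\<And>\<theta>. \<bar>\<theta>\<bar> < \<rho> \<Longrightarrow> polar_weight \<theta> \<le> (1 + \<epsilon> / 2) * h 0 * arc_weight c \<theta> \<and> h 0 * arc_weight c \<theta> \<le> (1 + \<epsilon> / 2) * polar_weight \<theta>"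
    using polar_weight_near_0[of "\<epsilon> / 2"] assms by auto
  \<comment> \<open>The value of the bump at the edge of the neighbourhood. On the reflected half
    the bump is at most 1/2, hence at most \<open>q\<close> too.\<close>
  define q where "q = (1 + cos \<rho>) / 2"
  have cr: "0 < cos \<rho>" "cos \<rho> < 1"
    using \<rho> cos_gt_zero[of \<rho>] cos_monotone_0_pi[of 0 \<rho>] by auto
  have q: "1/2 \<le> q" "0 \<le> q" "q < 1" using cr by (auto simp: q_def)
  \<comment> \<open>The three bounds are, in order, for the mirror term near 0, for each of the two
    terms away from 0, and for the mirror term weighted by
    \<open>1 + 1 / \<epsilon>\<close>.\<close>
  define \<kappa> where "\<kappa> = min (\<epsilon> / 2 / (h 0 * C * B)) (min (1 / (2 * h 0 * C * B)) (h 0 / (C * B * (1 + 1 / \<epsilon>))))"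
  have \<kappa>: "\<kappa> > 0" using assms h0 C(1) B(1) by (auto simp: \<kappa>_def intro!: divide_pos_pos mult_pos_pos add_pos_pos)
  obtain m0 where m0: "q ^ m0 < \<kappa>" using real_arch_pow_inv[OF \<kappa> q(3)] by blast
  show ?thesis
  proof (rule that[of m0 A])
    fix m :: nat and a b \<theta> :: real assume m: "m0 \<le> m" and th: "\<theta> \<in> {-pi/2..pi/2}"
    define X where "X = (localizer A m a b \<theta>)\<^sup>2"
    define Y where "Y = (localizer A m a b (pi - \<theta>))\<^sup>2"
    define r where "r = q ^ m"
    have "r \<le> q ^ m0" unfolding r_def using q m by (intro power_decreasing) auto
    then have "r \<le> \<kappa>" using m0 by simp
    then have "r \<le> \<epsilon> / 2 / (h 0 * C * B)" "r \<le> 1 / (2 * h 0 * C * B)" "r \<le> h 0 / (C * B * (1 + 1 / \<epsilon>))"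
      unfolding \<kappa>_def by auto
    then have r: "r * C * B \<le> \<epsilon> / 2 / h 0" "r * C * B \<le> 1 / 2 / h 0" "(1 + 1 / \<epsilon>) * (r * C * B) \<le> h 0"
      using assms h0 C(1) B(1) by (simp_all add: pos_le_divide_eq add_pos_pos mult_ac del: divide_divide_eq_left divide_divide_eq_right)
    have r0: "r \<ge> 0" using q by (simp add: r_def)
    note Wb = C(2)[OF th] and ob = B(2)[OF th]
    have cos0: "cos \<theta> \<ge> 0" using th by (intro cos_ge_zero) auto
    have Y: "Y \<le> cos \<theta> ^ (2 * A) * r"
    proof -
      have "Y \<le> cos (pi - \<theta>) ^ (2 * A) * q ^ m"
        unfolding Y_def by (rule localizer_sq_le_geometric) (use q cos0 in auto)
      then show ?thesis by (simp add: r_def power_mult)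
    qed
    have Y0: "Y \<ge> 0" and X0: "X \<ge> 0" by (simp_all add: X_def Y_def)
    have o0: "arc_weight c \<theta> \<ge> 0" "refl_weight c \<theta> \<ge> 0" using c by (auto simp: arc_weight_def refl_weight_def jump_def)
    have far: "cos \<theta> ^ (2 * A) * r * z \<le> r * C * B * polar_weight \<theta>" if "0 \<le> z" "z \<le> B" for z
    proof -
      have "cos \<theta> ^ (2 * A) * r * z \<le> (C * polar_weight \<theta>) * r * B"
        using Wb r0 that C(1) by (intro mult_mono) (auto simp: power_mult)
      then show ?thesis by (simp add: mult_ac)
    qed
    have far2: "cos \<theta> ^ (2 * A) * r * polar_weight \<theta> \<le> r * C * B * z" if "1 \<le> B * z" for z
    proof -
      have "cos \<theta> ^ (2 * A) * r * polar_weight \<theta> = r * (cos \<theta> ^ (2 * A) * polar_weight \<theta>)" by simp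
      also have "\<dots> \<le> r * (C * (B * z))"
        using Wb r0 that C(1) by (intro mult_left_mono) (auto intro: order.trans[OF _ mult_left_mono[of 1 "B * z" C, simplified]])
      finally show ?thesis by (simp add: mult_ac)
    qed
    have Yom: "Y * refl_weight c \<theta> \<le> r * C * B * polar_weight \<theta>"
      using mult_right_mono[OF Y o0(2)] far[of "refl_weight c \<theta>"] o0 ob by linarith
    have YW: "Y * polar_weight \<theta> \<le> r * C * B * refl_weight c \<theta>"
      using mult_right_mono[OF Y, of "polar_weight \<theta>"] far2[of "refl_weight c \<theta>"] Wb ob by linarith
    have 3: "(1 + 1 / \<epsilon>) * Y * polar_weight \<theta> \<le> (1 + \<epsilon>) * h 0 * refl_weight c \<theta>"
    proof -
      have "(1 + 1 / \<epsilon>) * (Y * polar_weight \<theta>) \<le> (1 + 1 / \<epsilon>) * (r * C * B * refl_weight c \<theta>)"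
        using YW assms by (intro mult_left_mono) auto
      also have "\<dots> = ((1 + 1 / \<epsilon>) * (r * C * B)) * refl_weight c \<theta>" by simp
      also have "\<dots> \<le> ((1 + \<epsilon>) * h 0) * refl_weight c \<theta>"
      proof (rule mult_right_mono)
        have "h 0 \<le> (1 + \<epsilon>) * h 0" using assms h0 by simp
        then show "(1 + 1 / \<epsilon>) * (r * C * B) \<le> (1 + \<epsilon>) * h 0" using r(3) by linarith
      qed (fact o0)
      finally show ?thesis by (simp add: mult_ac)
    qed
    have e0: "1 / h 0 > 0" using h0 by simp
    have "X * arc_weight c \<theta> + Y * refl_weight c \<theta> \<le> (1 + \<epsilon>) / h 0 * polar_weight \<theta> \<and> X * polar_weight \<theta> \<le> (1 + \<epsilon>) * h 0 * arc_weight c \<theta>"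
    proof (cases "\<bar>\<theta>\<bar> < \<rho>")
      case True
      have X1: "X \<le> 1" unfolding X_def by (rule localizer_sq_le_1)
      have "X * arc_weight c \<theta> \<le> 1 * arc_weight c \<theta>" by (rule mult_right_mono[OF X1 o0(1)])
      also have "\<dots> \<le> (1 + \<epsilon> / 2) / h 0 * polar_weight \<theta>"
        using \<rho>(3)[OF True] h0 by (simp add: field_simps)
      finally have "X * arc_weight c \<theta> \<le> (1 + \<epsilon> / 2) / h 0 * polar_weight \<theta>" .
      moreover have "Y * refl_weight c \<theta> \<le> \<epsilon> / 2 / h 0 * polar_weight \<theta>"
        using Yom mult_right_mono[OF r(1), of "polar_weight \<theta>"] Wb by linarith
      moreover have "(1 + \<epsilon> / 2) / h 0 * polar_weight \<theta> + \<epsilon> / 2 / h 0 * polar_weight \<theta> = (1 + \<epsilon>) / h 0 * polar_weight \<theta>"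
        using h0 by (simp add: field_simps)
      moreover have "X * polar_weight \<theta> \<le> 1 * polar_weight \<theta>" using Wb by (intro mult_right_mono X1) auto
      moreover have "(1 + \<epsilon> / 2) * h 0 * arc_weight c \<theta> \<le> (1 + \<epsilon>) * h 0 * arc_weight c \<theta>"
        using assms h0 o0 by (intro mult_right_mono) auto
      ultimately show ?thesis using \<rho>(3)[OF True] by linarith
    next
      case False
      have "cos \<theta> \<le> cos \<rho>"
      proof -
        have "cos \<bar>\<theta>\<bar> \<le> cos \<rho>" using False th \<rho> by (intro cos_monotone_0_pi_le) auto
        then show ?thesis by simp
      qed
      then have X: "X \<le> cos \<theta> ^ (2 * A) * r"
        unfolding X_def r_def by (intro localizer_sq_le_geometric) (use q in \<open>auto simp: q_def\<close>)
      have "X * arc_weight c \<theta> \<le> r * C * B * polar_weight \<theta>"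
        using mult_right_mono[OF X o0(1)] far[of "arc_weight c \<theta>"] o0 ob by linarith
      moreover have "r * C * B * polar_weight \<theta> \<le> 1 / 2 / h 0 * polar_weight \<theta>"
        using Wb by (intro mult_right_mono r) auto
      moreover have "1 / h 0 * polar_weight \<theta> \<le> (1 + \<epsilon>) / h 0 * polar_weight \<theta>"
        using Wb assms h0 by (intro mult_right_mono divide_right_mono) auto
      moreover have "1 / h 0 * polar_weight \<theta> = 1 / 2 / h 0 * polar_weight \<theta> + 1 / 2 / h 0 * polar_weight \<theta>"
        by (simp add: field_simps)
      moreover have "X * polar_weight \<theta> \<le> r * C * B * arc_weight c \<theta>"
        using mult_right_mono[OF X, of "polar_weight \<theta>"] far2[of "arc_weight c \<theta>"] Wb ob by linarith
      moreover have "r * C * B * arc_weight c \<theta> \<le> ((1 + \<epsilon>) * h 0) * arc_weight c \<theta>"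
      proof (rule mult_right_mono)
        have "r * C * B \<ge> 0" using r0 C(1) B(1) by simp
        then have "1 * (r * C * B) \<le> (1 + 1 / \<epsilon>) * (r * C * B)" using assms by (intro mult_right_mono) auto
        moreover have "h 0 \<le> (1 + \<epsilon>) * h 0" using assms h0 by simp
        ultimately show "r * C * B \<le> (1 + \<epsilon>) * h 0" using r(3) by linarith
      qed (fact o0)
      ultimately show ?thesis using Yom by linarith
    qed
    then show "(localizer A m a b \<theta>)\<^sup>2 * arc_weight c \<theta> + (localizer A m a b (pi - \<theta>))\<^sup>2 * refl_weight c \<theta> \<le> (1 + \<epsilon>) / h 0 * polar_weight \<theta>
   \<and> (localizer A m a b \<theta>)\<^sup>2 * polar_weight \<theta> \<le> (1 + \<epsilon>) * h 0 * arc_weight c \<theta>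
   \<and> (1 + 1 / \<epsilon>) * (localizer A m a b (pi - \<theta>))\<^sup>2 * polar_weight \<theta> \<le> (1 + \<epsilon>) * h 0 * refl_weight c \<theta>"
      using 3 unfolding X_def Y_def by blast
  qed
qed

end

section \<open>Comparison of extremal values\<close>

text \<open>Serves to cancel an extremal value that may be 0, which is where
  \<open>0 \<le> y\<close> enters.\<close>

lemma le_of_self_mult_le:
  fixes x y :: real
  assumes "x * x \<le> y * x" "0 \<le> x" "0 \<le> y"
  shows "x \<le> y"
  using assms by (metis mult_right_le_imp_le order_le_less)

lemma poly_map_poly_of_real:
  "poly (map_poly complex_of_real q) (of_real x) = of_real (poly q x)"
  by (induction q) (simp_all add: map_poly_pCons)

context jump_jacobi begin

abbreviation (input) w where "w \<equiv> jump_jacobi_weight \<alpha> \<beta> h c"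

section \<open>Orthonormal polynomials in the angular variable\<close>

lemma degree_p: "degree (p n) = n" and p_nz: "p n \<noteq> 0"
proof -
  show "degree (p n) = n" using orthonormal by (simp add: orthonormal_polys_def)
  have "lead_coeff (p n) > 0" using orthonormal unfolding orthonormal_polys_def by blast
  then show "p n \<noteq> 0" by auto
qed

text \<open>The Bochner integral of a non-integrable function is 0 by convention,
  whereas \<open>p 0\<close> has norm 1.\<close>

lemma w_integrable: "set_integrable lborel {-1..1} w"
proof -
  obtain a where a: "p 0 = [:a:]" using degree_p[of 0] by (metis degree_eq_zeroE)
  have 1: "(LINT x:{-1..1}|lborel. poly (p 0) x * poly (p 0) x * w x) = 1"
    using orthonormal by (auto simp: orthonormal_polys_def)
  have "set_integrable lborel {-1..1} (\<lambda>x. a * a * w x)"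
  proof (rule ccontr)
    assume "\<not> set_integrable lborel {-1..1} (\<lambda>x. a * a * w x)"
    then have "(LINT x:{-1..1}|lborel. a * a * w x) = 0"
      unfolding set_integrable_def set_lebesgue_integral_def by (rule not_integrable_integral_eq)
    then show False using 1 by (auto simp: a)
  qed
  moreover have "a \<noteq> 0" using p_nz[of 0] a by auto
  ultimately show ?thesis
    using set_integrable_mult_right_iff[of "a * a" lborel "{-1..1}" w] by simp
qed

lemma poly_w_integrable: "set_integrable lborel {-1..1} (\<lambda>x. poly q x * w x)"
proof -
  have "compact (poly q ` {-1..1})" by (intro compact_continuous_image continuous_intros) auto
  then have "bounded (poly q ` {-1..1})" by (rule compact_imp_bounded)
  then obtain B where "\<forall>y\<in>poly q ` {-1..1}. norm y \<le> B" unfolding bounded_iff by blast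
  then have B: "\<And>x. x \<in> {-1..1} \<Longrightarrow> \<bar>poly q x\<bar> \<le> B" by simp
  let ?f = "\<lambda>x. indicator {-1..1} x *\<^sub>R w x"
  have f: "integrable lborel ?f" using w_integrable by (simp add: set_integrable_def)
  have "integrable lborel (\<lambda>x. poly q x * ?f x)"
  proof (rule Bochner_Integration.integrable_bound)
    show "integrable lborel (\<lambda>x. B * ?f x)" using f by (rule integrable_mult_right)
    have "poly q \<in> borel_measurable lborel"
      by (simp, rule borel_measurable_continuous_onI) (intro continuous_intros)
    then show "(\<lambda>x. poly q x * ?f x) \<in> borel_measurable lborel"
      using borel_measurable_integrable[OF f] by (rule borel_measurable_times)
    show "AE x in lborel. norm (poly q x * ?f x) \<le> norm (B * ?f x)"
    proof (intro AE_I2)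
      fix x
      show "norm (poly q x * ?f x) \<le> norm (B * ?f x)"
      proof (cases "x \<in> {-1..1}")
        case True
        have "\<bar>poly q x\<bar> \<le> \<bar>B\<bar>" using B[OF True] by linarith
        then show ?thesis unfolding norm_mult by (intro mult_right_mono) auto
      qed simp
    qed
  qed
  then show ?thesis by (simp add: set_integrable_def mult_ac)
qed

lemma poly_polar_weight_integral:
  shows "integrable halfcircle (\<lambda>\<theta>. poly q (sin \<theta>) * polar_weight \<theta>)"
    and "(\<integral>\<theta>. poly q (sin \<theta>) * polar_weight \<theta> \<partial>halfcircle) = (LINT x:{-1..1}|lborel. poly q x * w x)"
proof -
  have i: "set_integrable lborel {sin (-pi/2)..sin (pi/2)} (\<lambda>x. poly q x * w x)"
    using poly_w_integrable by simp
  have d: "(sin has_real_derivative cos x) (at x)" for x :: real by (rule DERIV_sin)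
  have cc: "continuous_on {-pi/2..pi/2} cos" by (intro continuous_intros)
  have cp: "x \<in> {-pi/2..pi/2} \<Longrightarrow> 0 \<le> cos x" for x :: real by (rule cos_ge_zero) auto
  note s = integral_substitution[OF i d cc cp]
  have e: "indicator {-pi/2..pi/2} \<theta> *\<^sub>R (poly q (sin \<theta>) * polar_weight \<theta>) = poly q (sin \<theta>) * w (sin \<theta>) * cos \<theta> * indicator {-pi/2..pi/2} \<theta>" for \<theta>
    by (simp add: polar_weight_def mult_ac)
  show "integrable halfcircle (\<lambda>\<theta>. poly q (sin \<theta>) * polar_weight \<theta>)"
    using s(1) unfolding integrable_halfcircle e set_integrable_def by (simp add: mult_ac)
  show "(\<integral>\<theta>. poly q (sin \<theta>) * polar_weight \<theta> \<partial>halfcircle) = (LINT x:{-1..1}|lborel. poly q x * w x)"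
    using s(2) unfolding integral_halfcircle e set_lebesgue_integral_def by (simp add: mult_ac)
qed

lemma poly_square_integral:
  "(\<integral>\<theta>. (poly (\<Sum>k<n. smult (u k) (p k)) (sin \<theta>))\<^sup>2 * polar_weight \<theta> \<partial>halfcircle) = (\<Sum>k<n. (u k)\<^sup>2)"
proof -
  have "(\<integral>\<theta>. (poly (\<Sum>k<n. smult (u k) (p k)) (sin \<theta>))\<^sup>2 * polar_weight \<theta> \<partial>halfcircle)
    = (\<integral>\<theta>. (\<Sum>j<n. \<Sum>k<n. u j * u k * (poly (p j * p k) (sin \<theta>) * polar_weight \<theta>)) \<partial>halfcircle)"
    unfolding poly_sum poly_smult power2_eq_square sum_product
    unfolding sum_distrib_right
    by (intro Bochner_Integration.integral_cong sum.cong refl) (simp add: mult_ac)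
  also have "\<dots> = (\<Sum>j<n. \<Sum>k<n. u j * u k * (\<integral>\<theta>. poly (p j * p k) (sin \<theta>) * polar_weight \<theta> \<partial>halfcircle))"
    by (simp add: Bochner_Integration.integral_sum poly_polar_weight_integral(1) integrable_mult_right Bochner_Integration.integrable_sum del: poly_mult)
  also have "\<dots> = (\<Sum>j<n. \<Sum>k<n. u j * u k * (if j = k then 1 else 0))"
    unfolding poly_polar_weight_integral(2) using orthonormal by (simp add: orthonormal_polys_def)
  also have "\<dots> = (\<Sum>j<n. (u j)\<^sup>2)"
    by (intro sum.cong refl) (simp add: power2_eq_square if_distrib cong: if_cong)
  finally show ?thesis .
qed

definition p_fun :: "nat \<Rightarrow> real \<Rightarrow> complex" where
  "p_fun k x = of_real (poly (p k) x)"

text \<open>The coefficients are complex whereas orthonormality concerns real polynomials; the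
  squared modulus separates the real and imaginary parts of the coefficients because the
  \<open>p k\<close> are real.\<close>

lemma complex_poly_integral:
  assumes P: "P = (\<Sum>k<n. smult (u k) (map_poly of_real (p k)))"
  shows "poly P (of_real x) = (\<Sum>k<n. u k * p_fun k x)"
    and "integrable halfcircle (\<lambda>\<theta>. (norm (poly P (of_real (sin \<theta>))))\<^sup>2 * polar_weight \<theta>)"
    and "(\<integral>\<theta>. (norm (poly P (of_real (sin \<theta>))))\<^sup>2 * polar_weight \<theta> \<partial>halfcircle) = (\<Sum>k<n. (norm (u k))\<^sup>2)"
proof -
  show *: "poly P (of_real x) = (\<Sum>k<n. u k * p_fun k x)" for x
    by (simp add: P poly_sum p_fun_def poly_map_poly_of_real)
  define R where "R = (\<Sum>k<n. smult (Re (u k)) (p k))"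
  define I where "I = (\<Sum>k<n. smult (Im (u k)) (p k))"
  have n: "(norm (poly P (of_real (sin \<theta>))))\<^sup>2 * polar_weight \<theta> = poly (R * R) (sin \<theta>) * polar_weight \<theta> + poly (I * I) (sin \<theta>) * polar_weight \<theta>" for \<theta>
    unfolding cmod_power2 * R_def I_def by (simp add: p_fun_def poly_sum power2_eq_square algebra_simps)
  show "integrable halfcircle (\<lambda>\<theta>. (norm (poly P (of_real (sin \<theta>))))\<^sup>2 * polar_weight \<theta>)"
    unfolding n by (intro Bochner_Integration.integrable_add poly_polar_weight_integral)
  have "(\<integral>\<theta>. (norm (poly P (of_real (sin \<theta>))))\<^sup>2 * polar_weight \<theta> \<partial>halfcircle)
     = (\<integral>\<theta>. poly (R * R) (sin \<theta>) * polar_weight \<theta> \<partial>halfcircle) + (\<integral>\<theta>. poly (I * I) (sin \<theta>) * polar_weight \<theta> \<partial>halfcircle)"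
    unfolding n by (intro Bochner_Integration.integral_add poly_polar_weight_integral)
  also have "\<dots> = (\<Sum>k<n. (norm (u k))\<^sup>2)"
    unfolding cmod_power2 sum.distrib using poly_square_integral[where n = n and u = "\<lambda>k. Re (u k)"]
      poly_square_integral[where n = n and u = "\<lambda>k. Im (u k)"]
    by (simp add: R_def[symmetric] I_def[symmetric] power2_eq_square)
  finally show "(\<integral>\<theta>. (norm (poly P (of_real (sin \<theta>))))\<^sup>2 * polar_weight \<theta> \<partial>halfcircle) = (\<Sum>k<n. (norm (u k))\<^sup>2)" .
qed

lemma complex_poly_expansion:
  assumes "degree P < n"
  obtains u where "P = (\<Sum>k<n. smult (u k) (map_poly complex_of_real (p k)))"
proof -
  have 1: "degree (map_poly complex_of_real (p k)) = k" for k
    by (simp add: degree_map_poly degree_p)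
  have 2: "map_poly complex_of_real (p k) \<noteq> 0" for k
    using p_nz[of k] by (simp add: map_poly_eq_0_iff)
  show ?thesis
    using poly_graded_basis[of "\<lambda>k. map_poly complex_of_real (p k)" P n, OF 1 2] assms that by blast
qed

lemma circ_sqnorm_integrable:
  fixes F :: "real \<Rightarrow> complex"
  assumes "continuous_on UNIV F"
  shows "integrable halfcircle (\<lambda>\<theta>. (norm (F \<theta>))\<^sup>2 * arc_weight c \<theta> + (norm (F (pi - \<theta>)))\<^sup>2 * refl_weight c \<theta>)"
proof -
  have "continuous_on UNIV (\<lambda>\<theta>. F \<theta> * cnj (F \<theta>))" using assms by (intro continuous_intros)
  from integrable_Re[OF circ_integral_integrable[OF this, of c]]
  show ?thesis by (simp add: complex_norm_square[symmetric] del: of_real_power)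
qed

text \<open>The extremal polynomial for the interval, times the localizer, competes in the circle
  problem. The product multiplies the values at \<open>a\<close> and \<open>b\<close> by those of
  the localizer, which is why these rescale \<open>s\<close> and \<open>t\<close> on the smaller
  side.\<close>

lemma two_point_upper:
  assumes e0: "\<epsilon> > 0" and n: "n > 0"
    and loc: "\<And>\<theta>. \<theta> \<in> {-pi/2..pi/2} \<Longrightarrow> (localizer A m a b \<theta>)\<^sup>2 * arc_weight c \<theta> + (localizer A m a b (pi - \<theta>))\<^sup>2 * refl_weight c \<theta> \<le> (1 + \<epsilon>) / h 0 * polar_weight \<theta>"
    and N: "N = n + A + m + 1"
  shows "two_point p_fun n (s * localizer A m a b a) (t * localizer A m a b b) (sin a) (sin b)
      \<le> (1 + \<epsilon>) / h 0 * two_point (circ_basis c N) (2 * N + 1) s t a b"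
proof -
  define L where "L = localizer A m a b"
  define Q where "Q = two_point p_fun n (s * L a) (t * L b) (sin a) (sin b)"
  define u where "u k = cnj (of_real (s * L a) * p_fun k (sin a) + of_real (t * L b) * p_fun k (sin b))" for k
  define P where "P = (\<Sum>k<n. smult (u k) (map_poly of_real (p k)))"
  define T where "T \<theta> = poly P (of_real (sin \<theta>)) * of_real (L \<theta>)" for \<theta>
  note Pi = complex_poly_integral[OF P_def]
  have sq: "(\<Sum>k<n. (norm (u k))\<^sup>2) = Q"
    unfolding u_def Q_def by (rule two_point_attained(2))
  have att: "of_real (s * L a) * poly P (of_real (sin a)) + of_real (t * L b) * poly P (of_real (sin b)) = of_real Q"
    unfolding Pi(1) u_def Q_def by (rule two_point_attained(1))
  have "degree P \<le> n - 1"
    unfolding P_def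
  proof (rule degree_sum_le)
    fix k assume "k \<in> {..<n}"
    then show "degree (smult (u k) (map_poly of_real (p k))) \<le> n - 1"
      using degree_smult_le[of "u k" "map_poly of_real (p k)"] by (simp add: degree_map_poly degree_p)
  qed simp
  then have "trig_poly ((n - 1) + (A + m + 2)) T"
    unfolding T_def L_def by (intro trig_poly_mult trig_poly_poly_sin trig_poly_localizer)
  \<comment> \<open>The degree \<open>n - 1\<close> of the polynomial and the degree
    \<open>A + m + 2\<close> of the localizer add up to \<open>N\<close>.\<close>
  then have T: "trig_poly N T" using N n by (simp add: add.assoc)
  then obtain v where v: "T = (\<lambda>\<theta>. \<Sum>k<2 * N + 1. v k * circ_basis c N k \<theta>)"
    using trig_poly_circ_basis_expansion[OF c] by blast
  have "(norm (of_real s * T a + of_real t * T b))\<^sup>2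
      \<le> two_point (circ_basis c N) (2 * N + 1) s t a b * (\<Sum>k<2 * N + 1. (norm (v k))\<^sup>2)"
    by (rule two_point_bound[OF v])
  also have "(\<Sum>k<2 * N + 1. (norm (v k))\<^sup>2) = circ_sqnorm c T"
    unfolding v by (rule circ_sqnorm_basis_sum[OF c, symmetric])
  also have "of_real s * T a + of_real t * T b = of_real Q"
    unfolding att[symmetric] T_def by (simp add: mult_ac)
  finally have 1: "Q\<^sup>2 \<le> two_point (circ_basis c N) (2 * N + 1) s t a b * circ_sqnorm c T"
    by simp
  have "circ_sqnorm c T \<le> (\<integral>\<theta>. (1 + \<epsilon>) / h 0 * ((norm (poly P (of_real (sin \<theta>))))\<^sup>2 * polar_weight \<theta>) \<partial>halfcircle)"
    unfolding circ_sqnorm_def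
  proof (rule integral_mono)
    show "integrable halfcircle (\<lambda>\<theta>. (norm (T \<theta>))\<^sup>2 * arc_weight c \<theta> + (norm (T (pi - \<theta>)))\<^sup>2 * refl_weight c \<theta>)"
      by (rule circ_sqnorm_integrable[OF trig_poly_continuous[OF T]])
    show "integrable halfcircle (\<lambda>\<theta>. (1 + \<epsilon>) / h 0 * ((norm (poly P (of_real (sin \<theta>))))\<^sup>2 * polar_weight \<theta>))"
      by (intro integrable_mult_right Pi)
    fix \<theta> assume "\<theta> \<in> space halfcircle"
    then have th: "\<theta> \<in> {-pi/2..pi/2}" by simp
    define x where "x = (norm (poly P (of_real (sin \<theta>))))\<^sup>2"
    have "(norm (T \<theta>))\<^sup>2 * arc_weight c \<theta> + (norm (T (pi - \<theta>)))\<^sup>2 * refl_weight c \<theta>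
        = x * ((L \<theta>)\<^sup>2 * arc_weight c \<theta> + (L (pi - \<theta>))\<^sup>2 * refl_weight c \<theta>)"
      by (simp add: T_def x_def norm_mult power_mult_distrib algebra_simps)
    also have "\<dots> \<le> x * ((1 + \<epsilon>) / h 0 * polar_weight \<theta>)"
      unfolding L_def by (intro mult_left_mono loc th) (simp add: x_def)
    finally show "(norm (T \<theta>))\<^sup>2 * arc_weight c \<theta> + (norm (T (pi - \<theta>)))\<^sup>2 * refl_weight c \<theta> \<le> (1 + \<epsilon>) / h 0 * ((norm (poly P (of_real (sin \<theta>))))\<^sup>2 * polar_weight \<theta>)"
      by (simp add: x_def mult_ac)
  qed
  also have "\<dots> = (1 + \<epsilon>) / h 0 * Q"
    using Pi(3) by (simp add: sq)
  finally have 2: "circ_sqnorm c T \<le> (1 + \<epsilon>) / h 0 * Q" .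
  have "Q * Q \<le> ((1 + \<epsilon>) / h 0 * two_point (circ_basis c N) (2 * N + 1) s t a b) * Q"
    using 1 mult_left_mono[OF 2 two_point_nonneg[of "circ_basis c N" "2 * N + 1" s t a b]]
    by (simp add: power2_eq_square mult_ac)
  moreover have "Q \<ge> 0" unfolding Q_def by (rule two_point_nonneg)
  moreover have "(1 + \<epsilon>) / h 0 * two_point (circ_basis c N) (2 * N + 1) s t a b \<ge> 0"
    using e0 h0 two_point_nonneg by (intro mult_nonneg_nonneg) auto
  ultimately have "Q \<le> (1 + \<epsilon>) / h 0 * two_point (circ_basis c N) (2 * N + 1) s t a b"
    by (rule le_of_self_mult_le)
  then show ?thesis unfolding Q_def L_def .
qed

text \<open>Weighted so that the main term \<open>x\<close> loses only the factor
  \<open>1 + \<epsilon>\<close>; the large factor falls on the mirror term, where the localizer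
  compensates for it.\<close>

lemma norm_add_sq_le:
  fixes x y :: complex
  assumes "\<epsilon> > 0"
  shows "(norm (x + y))\<^sup>2 \<le> (1 + \<epsilon>) * (norm x)\<^sup>2 + (1 + 1 / \<epsilon>) * (norm y)\<^sup>2"
proof -
  have "(norm (x + y))\<^sup>2 \<le> (norm x + norm y)\<^sup>2" by (intro power_mono norm_triangle_ineq) auto
  moreover have "(\<epsilon> * norm x - norm y)\<^sup>2 / \<epsilon> \<ge> 0" using assms by simp
  moreover have "(1 + \<epsilon>) * (norm x)\<^sup>2 + (1 + 1 / \<epsilon>) * (norm y)\<^sup>2 = (norm x + norm y)\<^sup>2 + (\<epsilon> * norm x - norm y)\<^sup>2 / \<epsilon>"
    using assms by (simp add: power2_eq_square field_simps)
  ultimately show ?thesis by linarith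
qed

text \<open>The reverse of \<open>two_point_upper\<close>. The localized extremal function on the
  circle is added to its mirror image to become a polynomial in \<open>sin \<theta>\<close>. Its
  values at \<open>a\<close> and \<open>b\<close> survive because the localizer vanishes at
  \<open>pi - a\<close> and \<open>pi - b\<close>, and the bound on the reflected localizer keeps
  the norm under control.\<close>

lemma two_point_lower:
  assumes e0: "\<epsilon> > 0"
    and loc: "\<And>\<theta>. \<theta> \<in> {-pi/2..pi/2} \<Longrightarrow> (localizer A m a b \<theta>)\<^sup>2 * polar_weight \<theta> \<le> (1 + \<epsilon>) * h 0 * arc_weight c \<theta>"
    and loc': "\<And>\<theta>. \<theta> \<in> {-pi/2..pi/2} \<Longrightarrow> (1 + 1 / \<epsilon>) * (localizer A m a b (pi - \<theta>))\<^sup>2 * polar_weight \<theta> \<le> (1 + \<epsilon>) * h 0 * refl_weight c \<theta>"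
    and n: "n = N + A + m + 3"
  shows "two_point (circ_basis c N) (2 * N + 1) (s * localizer A m a b a) (t * localizer A m a b b) a b
      \<le> (1 + \<epsilon>)\<^sup>2 * h 0 * two_point p_fun n s t (sin a) (sin b)"
proof -
  define L where "L = localizer A m a b"
  define Q where "Q = two_point (circ_basis c N) (2 * N + 1) (s * L a) (t * L b) a b"
  define u where "u k = cnj (of_real (s * L a) * circ_basis c N k a + of_real (t * L b) * circ_basis c N k b)" for k
  define T where "T = (\<lambda>\<theta>. \<Sum>k<2 * N + 1. u k * circ_basis c N k \<theta>)"
  have sq: "circ_sqnorm c T = Q"
    unfolding T_def circ_sqnorm_basis_sum[OF c] u_def Q_def by (rule two_point_attained(2))
  have att: "of_real (s * L a) * T a + of_real (t * L b) * T b = of_real Q"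
    unfolding T_def u_def Q_def by (rule two_point_attained(1))
  have T: "trig_poly N T"
    unfolding T_def by (intro trig_poly_sum trig_poly_scale trig_poly_circ_basis) auto
  have "trig_poly (N + (A + m + 2)) (\<lambda>\<theta>. T \<theta> * of_real (L \<theta>))"
    unfolding L_def by (intro trig_poly_mult T trig_poly_localizer)
  then obtain P where P: "degree P \<le> N + (A + m + 2)"
    "\<And>\<theta>. T \<theta> * of_real (L \<theta>) + T (pi - \<theta>) * of_real (L (pi - \<theta>)) = poly P (of_real (sin \<theta>))"
    by (rule trig_poly_symmetrize) blast
  have "degree P < n" using P(1) n by simp
  then obtain v where v: "P = (\<Sum>k<n. smult (v k) (map_poly complex_of_real (p k)))"
    by (rule complex_poly_expansion)
  note Pi = complex_poly_integral[OF v]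
  have Pa: "poly P (of_real (sin a)) = T a * of_real (L a)" "poly P (of_real (sin b)) = T b * of_real (L b)"
    unfolding P(2)[symmetric] L_def by (simp_all add: localizer_reflect_0)
  have "(norm (of_real s * poly P (of_real (sin a)) + of_real t * poly P (of_real (sin b))))\<^sup>2
      \<le> two_point p_fun n s t (sin a) (sin b) * (\<Sum>k<n. (norm (v k))\<^sup>2)"
    unfolding Pi(1) by (rule two_point_bound) (rule refl)
  also have "of_real s * poly P (of_real (sin a)) + of_real t * poly P (of_real (sin b)) = of_real Q"
    unfolding att[symmetric] Pa by (simp add: mult_ac)
  finally have 1: "Q\<^sup>2 \<le> two_point p_fun n s t (sin a) (sin b) * (\<Sum>k<n. (norm (v k))\<^sup>2)" by simp
  have "(\<Sum>k<n. (norm (v k))\<^sup>2) = (\<integral>\<theta>. (norm (poly P (of_real (sin \<theta>))))\<^sup>2 * polar_weight \<theta> \<partial>halfcircle)"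
    by (rule Pi(3)[symmetric])
  also have "\<dots> \<le> (\<integral>\<theta>. ((1 + \<epsilon>)\<^sup>2 * h 0) * ((norm (T \<theta>))\<^sup>2 * arc_weight c \<theta> + (norm (T (pi - \<theta>)))\<^sup>2 * refl_weight c \<theta>) \<partial>halfcircle)"
  proof (rule integral_mono)
    show "integrable halfcircle (\<lambda>\<theta>. (norm (poly P (of_real (sin \<theta>))))\<^sup>2 * polar_weight \<theta>)" by (rule Pi)
    show "integrable halfcircle (\<lambda>\<theta>. ((1 + \<epsilon>)\<^sup>2 * h 0) * ((norm (T \<theta>))\<^sup>2 * arc_weight c \<theta> + (norm (T (pi - \<theta>)))\<^sup>2 * refl_weight c \<theta>))"
      by (intro integrable_mult_right circ_sqnorm_integrable trig_poly_continuous[OF T])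
    fix \<theta> assume "\<theta> \<in> space halfcircle"
    then have th: "\<theta> \<in> {-pi/2..pi/2}" by simp
    define x where "x = (norm (T \<theta>))\<^sup>2"
    define y where "y = (norm (T (pi - \<theta>)))\<^sup>2"
    have "0 \<le> polar_weight \<theta>" using polar_weight_bounds th by metis
    then have "(norm (poly P (of_real (sin \<theta>))))\<^sup>2 * polar_weight \<theta>
        \<le> ((1 + \<epsilon>) * (norm (T \<theta> * of_real (L \<theta>)))\<^sup>2 + (1 + 1 / \<epsilon>) * (norm (T (pi - \<theta>) * of_real (L (pi - \<theta>))))\<^sup>2) * polar_weight \<theta>"
      unfolding P(2)[symmetric] by (intro mult_right_mono norm_add_sq_le e0)
    also have "\<dots> = (1 + \<epsilon>) * x * ((L \<theta>)\<^sup>2 * polar_weight \<theta>) + y * ((1 + 1 / \<epsilon>) * (L (pi - \<theta>))\<^sup>2 * polar_weight \<theta>)"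
      by (simp add: x_def y_def norm_mult power_mult_distrib algebra_simps)
    also have "\<dots> \<le> (1 + \<epsilon>) * x * ((1 + \<epsilon>) * h 0 * arc_weight c \<theta>) + y * ((1 + \<epsilon>) * h 0 * refl_weight c \<theta>)"
      unfolding L_def using e0 by (intro add_mono mult_left_mono loc loc' th) (auto simp: x_def y_def)
    \<comment> \<open>The second term is enlarged by \<open>1 + \<epsilon>\<close> only to give both
      terms the common factor \<open>(1 + \<epsilon>)\<^sup>2 * h 0\<close>.\<close>
    also have "\<dots> \<le> (1 + \<epsilon>) * x * ((1 + \<epsilon>) * h 0 * arc_weight c \<theta>) + (1 + \<epsilon>) * (y * ((1 + \<epsilon>) * h 0 * refl_weight c \<theta>))"
    proof -
      have "y * ((1 + \<epsilon>) * h 0 * refl_weight c \<theta>) \<ge> 0"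
        using e0 h0 c by (auto simp: y_def refl_weight_def intro!: mult_nonneg_nonneg)
      then have "1 * (y * ((1 + \<epsilon>) * h 0 * refl_weight c \<theta>)) \<le> (1 + \<epsilon>) * (y * ((1 + \<epsilon>) * h 0 * refl_weight c \<theta>))"
        using e0 by (intro mult_right_mono) auto
      then show ?thesis by simp
    qed
    also have "\<dots> = ((1 + \<epsilon>)\<^sup>2 * h 0) * (x * arc_weight c \<theta> + y * refl_weight c \<theta>)"
      by (simp add: power2_eq_square algebra_simps)
    finally show "(norm (poly P (of_real (sin \<theta>))))\<^sup>2 * polar_weight \<theta> \<le> ((1 + \<epsilon>)\<^sup>2 * h 0) * ((norm (T \<theta>))\<^sup>2 * arc_weight c \<theta> + (norm (T (pi - \<theta>)))\<^sup>2 * refl_weight c \<theta>)"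
      unfolding x_def y_def .
  qed
  also have "\<dots> = ((1 + \<epsilon>)\<^sup>2 * h 0) * Q"
    unfolding sq[symmetric] circ_sqnorm_def by simp
  finally have 2: "(\<Sum>k<n. (norm (v k))\<^sup>2) \<le> ((1 + \<epsilon>)\<^sup>2 * h 0) * Q" .
  have "Q * Q \<le> ((1 + \<epsilon>)\<^sup>2 * h 0 * two_point p_fun n s t (sin a) (sin b)) * Q"
    using 1 mult_left_mono[OF 2 two_point_nonneg[of p_fun n s t "sin a" "sin b"]]
    by (simp add: power2_eq_square mult_ac)
  moreover have "Q \<ge> 0" unfolding Q_def by (rule two_point_nonneg)
  moreover have "(1 + \<epsilon>)\<^sup>2 * h 0 * two_point p_fun n s t (sin a) (sin b) \<ge> 0"
    using h0 two_point_nonneg by (intro mult_nonneg_nonneg) auto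
  ultimately have "Q \<le> (1 + \<epsilon>)\<^sup>2 * h 0 * two_point p_fun n s t (sin a) (sin b)"
    by (rule le_of_self_mult_le)
  then show ?thesis unfolding Q_def L_def .
qed

end

section \<open>Locally uniform limits\<close>

text \<open>Convergence along the product filter bounds \<open>f n w\<close> for all
  \<open>w\<close> near \<open>z\<close> at once. Keeping \<open>w\<close> fixed and letting
  \<open>n\<close> grow carries the bound over to \<open>g w\<close>, so continuity of
  \<open>g\<close> comes out of the convergence itself.\<close>

lemma locally_uniform_limit_near:
  fixes f :: "nat \<Rightarrow> 'a::topological_space \<Rightarrow> 'b::metric_space"
  assumes lim: "\<And>z. ((\<lambda>(n, w). f n w) \<longlongrightarrow> g z) (sequentially \<times>\<^sub>F nhds z)" and "\<epsilon> > 0"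
  obtains N U where "open U" "z \<in> U" "\<And>w. w \<in> U \<Longrightarrow> dist (g w) (g z) \<le> \<epsilon>"
    "\<And>n w. n \<ge> N \<Longrightarrow> w \<in> U \<Longrightarrow> dist (f n w) (g z) < \<epsilon>"
proof -
  have "\<forall>\<^sub>F x in sequentially \<times>\<^sub>F nhds z. dist (case x of (n, w) \<Rightarrow> f n w) (g z) < \<epsilon>"
    using tendstoD[OF lim \<open>\<epsilon> > 0\<close>] .
  then obtain P Q where P: "eventually P sequentially" and Q: "eventually Q (nhds z)"
    and PQ: "\<And>n w. P n \<Longrightarrow> Q w \<Longrightarrow> dist (f n w) (g z) < \<epsilon>"
    unfolding eventually_prod_filter by auto
  obtain N where N: "\<And>n. n \<ge> N \<Longrightarrow> P n" using P unfolding eventually_sequentially by blast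
  obtain U where U: "open U" "z \<in> U" "\<And>w. w \<in> U \<Longrightarrow> Q w" using Q unfolding eventually_nhds by blast
  have near: "dist (g w) (g z) \<le> \<epsilon>" if "w \<in> U" for w
  proof -
    have "filterlim (\<lambda>n. (n, w)) (sequentially \<times>\<^sub>F nhds w) sequentially"
      by (intro filterlim_Pair filterlim_ident tendsto_const)
    from filterlim_compose[OF lim this] have "(\<lambda>n. f n w) \<longlonglongrightarrow> g w" by simp
    then have "(\<lambda>n. dist (f n w) (g z)) \<longlonglongrightarrow> dist (g w) (g z)" by (intro tendsto_intros)
    moreover have "\<forall>\<^sub>F n in sequentially. dist (f n w) (g z) \<le> \<epsilon>"
      unfolding eventually_sequentially using PQ N U(3)[OF that] by (intro exI[of _ N]) (auto intro: less_imp_le)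
    ultimately show ?thesis by (rule tendsto_upperbound) simp
  qed
  show ?thesis by (rule that[OF U(1,2) near]) (use PQ N U(3) in auto)
qed

lemma locally_uniform_limit_isCont:
  fixes f :: "nat \<Rightarrow> 'a::t2_space \<Rightarrow> 'b::metric_space"
  assumes lim: "\<And>z. ((\<lambda>(n, w). f n w) \<longlongrightarrow> g z) (sequentially \<times>\<^sub>F nhds z)"
  shows "isCont g z"
  unfolding isCont_def
proof (rule tendstoI)
  fix \<epsilon> :: real assume "\<epsilon> > 0"
  then have "\<epsilon> / 2 > 0" by simp
  obtain N U where U: "open U" "z \<in> U" "\<And>w. w \<in> U \<Longrightarrow> dist (g w) (g z) \<le> \<epsilon> / 2"
    by (rule locally_uniform_limit_near[OF lim \<open>\<epsilon> / 2 > 0\<close>]) blast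
  then show "\<forall>\<^sub>F w in at z. dist (g w) (g z) < \<epsilon>"
    unfolding eventually_at_topological using \<open>\<epsilon> > 0\<close> by (intro exI[of _ U]) fastforce
qed

text \<open>Around every point the estimate holds with one index on one neighbourhood; a finite
  subcover gives a common index.\<close>

lemma locally_uniform_limit_compact:
  fixes f :: "nat \<Rightarrow> 'a::topological_space \<Rightarrow> 'b::metric_space"
  assumes lim: "\<And>z. ((\<lambda>(n, w). f n w) \<longlongrightarrow> g z) (sequentially \<times>\<^sub>F nhds z)" and "compact C"
  shows "uniform_limit C f g sequentially"
proof (rule uniform_limitI)
  fix \<epsilon> :: real assume "\<epsilon> > 0"
  then have e: "\<epsilon> / 2 > 0" by simp
  have "\<exists>N U. open U \<and> z \<in> U \<and> (\<forall>n\<ge>N. \<forall>w\<in>U. dist (f n w) (g w) < \<epsilon>)" for z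
  proof -
    obtain N U where U: "open U" "z \<in> U" "\<And>w. w \<in> U \<Longrightarrow> dist (g w) (g z) \<le> \<epsilon> / 2"
      "\<And>n w. n \<ge> N \<Longrightarrow> w \<in> U \<Longrightarrow> dist (f n w) (g z) < \<epsilon> / 2"
      by (rule locally_uniform_limit_near[OF lim e]) blast
    have "dist (f n w) (g w) < \<epsilon>" if "n \<ge> N" "w \<in> U" for n w
      using U(3)[OF that(2)] U(4)[OF that] dist_triangle2[of "f n w" "g w" "g z"] by linarith
    then show ?thesis using U by blast
  qed
  then obtain N U where U: "\<And>z. open (U z)" "\<And>z. z \<in> U z"
    "\<And>z n w. n \<ge> N z \<Longrightarrow> w \<in> U z \<Longrightarrow> dist (f n w) (g w) < \<epsilon>"
    by metis
  obtain D where D: "D \<subseteq> C" "finite D" "C \<subseteq> (\<Union>z\<in>D. U z)"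
    using compactE_image[OF \<open>compact C\<close>, of C U] U by (metis UN_I subsetI)
  show "\<forall>\<^sub>F n in sequentially. \<forall>x\<in>C. dist (f n x) (g x) < \<epsilon>"
    unfolding eventually_sequentially
  proof (intro exI allI impI ballI)
    fix n w assume n: "Max (insert 0 (N ` D)) \<le> n" and "w \<in> C"
    then obtain z where z: "z \<in> D" "w \<in> U z" using D by blast
    then have "N z \<le> n" using n D(2) by (meson Max_ge finite_imageI finite_insert imageI insertI2 order.trans)
    then show "dist (f n w) (g w) < \<epsilon>" using U(3) z by blast
  qed
qed

section \<open>The limit kernel and the rescaled circle problem\<close>

definition k_inf :: "real \<Rightarrow> real \<Rightarrow> real \<Rightarrow> complex" where
  "k_inf c x y = K_inf (\<lambda>_. 1) c x y"

text \<open>The limit of the rescaled two-point forms of the model weight, with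
  \<open>s = 1\<close>.\<close>

definition q_inf :: "real \<Rightarrow> real \<Rightarrow> real \<Rightarrow> real \<Rightarrow> real" where
  "q_inf c t x y = Re (k_inf c x x) + 2 * t * Re (k_inf c x y) + t\<^sup>2 * Re (k_inf c y y)"

lemma K_inf_scale: "K_inf h c x y = k_inf c x y / of_real (h 0)"
  by (simp add: K_inf_def k_inf_def Let_def)

lemma k_inf_sym: "k_inf c x y = k_inf c y x"
proof (cases "x = y")
  case False
  then have "complex_of_real (x - y) \<noteq> 0" "complex_of_real (y - x) \<noteq> 0"
    by (simp_all only: of_real_eq_0_iff eq_iff_diff_eq_0[symmetric]) auto
  then have "(u * v - w * z) / complex_of_real (x - y) = (w * z - u * v) / complex_of_real (y - x)" for u v w z
    by (simp add: field_simps)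
  then show ?thesis using False unfolding k_inf_def K_inf_def Let_def by (simp only: if_True not_False_eq_True refl) auto
qed simp

lemma circ_kernel_tendsto':
  assumes c: "c > 0" "c \<noteq> 1"
  shows "((\<lambda>(N, x, y). of_real (2 * pi / real (2 * N + 1)) *
             circ_kernel c N (2 * pi * x / real (2 * N + 1)) (2 * pi * y / real (2 * N + 1)))
           \<longlongrightarrow> (case z of (x, y) \<Rightarrow> k_inf c x y)) (sequentially \<times>\<^sub>F nhds z)"
proof -
  obtain x y where z: "z = (x, y)" by (cases z)
  let ?F = "sequentially \<times>\<^sub>F nhds (x, y)"
  have N: "filterlim fst sequentially ?F" by (rule filterlim_fst)
  have s: "filterlim snd (nhds (x, y)) ?F" by (rule filterlim_snd)
  have X: "((\<lambda>t. fst (snd t)) \<longlongrightarrow> x) ?F" "((\<lambda>t. snd (snd t)) \<longlongrightarrow> y) ?F"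
    using tendsto_fst[OF s] tendsto_snd[OF s] by simp_all
  have F: "?F \<noteq> bot" by (simp add: prod_filter_eq_bot)
  show ?thesis
    using circ_kernel_tendsto[OF c F N X] by (simp add: z k_inf_def case_prod_unfold)
qed

lemma isCont_k_inf:
  assumes c: "c > 0" "c \<noteq> 1"
  shows "isCont (\<lambda>(x, y). k_inf c x y) z"
  using circ_kernel_tendsto'[OF c]
  by (intro locally_uniform_limit_isCont[where f = "\<lambda>N (x, y). of_real (2 * pi / real (2 * N + 1)) *
             circ_kernel c N (2 * pi * x / real (2 * N + 1)) (2 * pi * y / real (2 * N + 1))"])
    (simp add: case_prod_unfold)

text \<open>The kernels before the limit are Hermitian, hence so is the limit. It is also symmetric
  by its formula and therefore real. This matters because two-point forms with real \<open>s\<close>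
  and \<open>t\<close> see only real parts.\<close>

lemma k_inf_real:
  assumes c: "c > 0" "c \<noteq> 1"
  shows "Im (k_inf c x y) = 0"
proof -
  let ?f = "\<lambda>x y N. of_real (2 * pi / real (2 * N + 1)) *
      circ_kernel c N (2 * pi * x / real (2 * N + 1)) (2 * pi * y / real (2 * N + 1))"
  have lim: "?f x y \<longlonglongrightarrow> k_inf c x y" for x y
    unfolding k_inf_def by (rule circ_kernel_tendsto[OF c]) (auto intro: filterlim_ident)
  have "cnj (?f x y N) = ?f y x N" for N
    by (simp add: circ_kernel_def mult.commute)
  then have "(\<lambda>N. ?f y x N) \<longlonglongrightarrow> cnj (k_inf c x y)"
    using tendsto_cnj[OF lim[of x y]] by (simp only:)
  with lim[of y x] have "k_inf c y x = cnj (k_inf c x y)" by (rule LIMSEQ_unique)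
  then show ?thesis by (metis k_inf_sym cnj.simps(2) neg_equal_zero)
qed

text \<open>The circle problem has about \<open>2 r n\<close> dimensions. In units of
  \<open>2 pi / (2 N + 1)\<close> an angle close to \<open>pi x / n\<close> is about
  \<open>r x\<close>, and the changed normalization contributes the outer factor
  \<open>r\<close>.\<close>

lemma circ_two_point_tendsto:
  fixes N n :: "'a \<Rightarrow> nat" and a b s t :: "'a \<Rightarrow> real"
  assumes c: "c > 0" "c \<noteq> 1" and F: "F \<noteq> bot" and N: "filterlim N sequentially F" and n: "filterlim n sequentially F"
    and r: "((\<lambda>\<tau>. real (2 * N \<tau> + 1) / real (n \<tau>)) \<longlongrightarrow> 2 * r) F"
    and a: "((\<lambda>\<tau>. real (n \<tau>) * a \<tau>) \<longlongrightarrow> pi * x) F" and b: "((\<lambda>\<tau>. real (n \<tau>) * b \<tau>) \<longlongrightarrow> pi * y) F"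
    and s: "(s \<longlongrightarrow> 1) F" and t: "(t \<longlongrightarrow> t0) F"
  shows "((\<lambda>\<tau>. pi / real (n \<tau>) * two_point (circ_basis c (N \<tau>)) (2 * N \<tau> + 1) (s \<tau>) (t \<tau>) (a \<tau>) (b \<tau>))
           \<longlongrightarrow> r * q_inf c t0 (r * x) (r * y)) F"
proof -
  have ev: "\<forall>\<^sub>F \<tau> in F. n \<tau> > 0"
    by (rule eventually_compose_filterlim[OF eventually_gt_at_top n])
  have X: "((\<lambda>\<tau>. real (2 * N \<tau> + 1) * d \<tau> / (2 * pi)) \<longlongrightarrow> r * z) F"
    if d: "((\<lambda>\<tau>. real (n \<tau>) * d \<tau>) \<longlongrightarrow> pi * z) F" for d z
  proof (rule Lim_transform_eventually)
    have "((\<lambda>\<tau>. real (2 * N \<tau> + 1) / real (n \<tau>) * (real (n \<tau>) * d \<tau>) / (2 * pi)) \<longlongrightarrow> 2 * r * (pi * z) / (2 * pi)) F"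
      by (intro tendsto_intros r d) auto
    then show "((\<lambda>\<tau>. real (2 * N \<tau> + 1) / real (n \<tau>) * (real (n \<tau>) * d \<tau>) / (2 * pi)) \<longlongrightarrow> r * z) F" by simp
    show "\<forall>\<^sub>F \<tau> in F. real (2 * N \<tau> + 1) / real (n \<tau>) * (real (n \<tau>) * d \<tau>) / (2 * pi) = real (2 * N \<tau> + 1) * d \<tau> / (2 * pi)"
      using ev by eventually_elim simp
  qed
  define \<kappa> where "\<kappa> d d' \<tau> = of_real (2 * pi / real (2 * N \<tau> + 1)) * circ_kernel c (N \<tau>) (d \<tau>) (d' \<tau>)" for d d' \<tau>
  have K: "((\<lambda>\<tau>. Re (\<kappa> d d' \<tau>)) \<longlongrightarrow> Re (k_inf c (r * z) (r * z'))) F"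
    if d: "((\<lambda>\<tau>. real (n \<tau>) * d \<tau>) \<longlongrightarrow> pi * z) F" "((\<lambda>\<tau>. real (n \<tau>) * d' \<tau>) \<longlongrightarrow> pi * z') F" for d d' z z'
  proof (rule tendsto_Re)
    have "2 * pi * (real (2 * N \<tau> + 1) * d \<tau> / (2 * pi)) / real (2 * N \<tau> + 1) = d \<tau>" for d \<tau>
      by (simp del: of_nat_add of_nat_mult)
    then show "(\<kappa> d d' \<longlongrightarrow> k_inf c (r * z) (r * z')) F"
      using circ_kernel_tendsto[OF c F N X[OF d(1)] X[OF d(2)]]
      by (simp only: \<kappa>_def[abs_def] k_inf_def)
  qed
  have "((\<lambda>\<tau>. real (2 * N \<tau> + 1) / real (n \<tau>) / 2 *
       ((s \<tau>)\<^sup>2 * Re (\<kappa> a a \<tau>) + 2 * s \<tau> * t \<tau> * Re (\<kappa> a b \<tau>) + (t \<tau>)\<^sup>2 * Re (\<kappa> b b \<tau>)))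
     \<longlongrightarrow> 2 * r / 2 * (1\<^sup>2 * Re (k_inf c (r * x) (r * x)) + 2 * 1 * t0 * Re (k_inf c (r * x) (r * y)) + t0\<^sup>2 * Re (k_inf c (r * y) (r * y)))) F"
    by (intro tendsto_intros r s t K a b) auto
  moreover have "real (2 * N \<tau> + 1) / real (n \<tau>) / 2 *
       ((s \<tau>)\<^sup>2 * Re (\<kappa> a a \<tau>) + 2 * s \<tau> * t \<tau> * Re (\<kappa> a b \<tau>) + (t \<tau>)\<^sup>2 * Re (\<kappa> b b \<tau>))
     = pi / real (n \<tau>) * two_point (circ_basis c (N \<tau>)) (2 * N \<tau> + 1) (s \<tau>) (t \<tau>) (a \<tau>) (b \<tau>)" for \<tau>
  proof -
    define M where "M = real (2 * N \<tau> + 1)"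
    have M: "M > 0" by (simp add: M_def)
    have kap: "Re (\<kappa> d d' \<tau>) = 2 * pi / M * Re (circ_kernel c (N \<tau>) (d \<tau>) (d' \<tau>))" for d d'
      unfolding \<kappa>_def M_def by (simp only: times_complex.sel Re_complex_of_real Im_complex_of_real)
    have fac: "s2 * (q * A) + st * (q * B) + t2 * (q * C) = q * (s2 * A + st * B + t2 * C)" for s2 st t2 q A B C :: real
      by (simp add: algebra_simps)
    show ?thesis
      unfolding two_point_kernel circ_kernel_def[symmetric] M_def[symmetric] kap
      unfolding fac using M by simp
  qed
  ultimately show ?thesis by (simp add: q_inf_def)
qed

section \<open>The localizer at the evaluation points\<close>

lemma one_minus_cos_le: "1 - cos x \<le> x\<^sup>2 / 2" for x :: real
proof -
  have "\<bar>sin (x / 2)\<bar> \<le> \<bar>x / 2\<bar>" by (rule abs_sin_x_le_abs_x)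
  then have "(sin (x / 2))\<^sup>2 \<le> (x / 2)\<^sup>2" by (simp only: abs_le_square_iff)
  moreover have "cos x = 1 - 2 * (sin (x / 2))\<^sup>2" using cos_double_sin[of "x / 2"] by simp
  ultimately show ?thesis by (simp add: power_divide)
qed

text \<open>At angles of order \<open>1 / n\<close> the bump differs from 1 by order
  \<open>1 / n^2\<close>, so by Bernoulli's inequality its \<open>m\<close>-th power with
  \<open>m \<le> n\<close> still tends to 1. A localizer of degree proportional to \<open>n\<close>
  therefore leaves the values at the evaluation points unchanged in the limit.\<close>

lemma localizer_tendsto_1:
  fixes m n :: "'a \<Rightarrow> nat" and a b d :: "'a \<Rightarrow> real"
  assumes n: "filterlim n sequentially F" and m: "\<And>\<tau>. m \<tau> \<le> n \<tau>"
    and na: "((\<lambda>\<tau>. real (n \<tau>) * d \<tau>) \<longlongrightarrow> x) F"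
    and a: "(a \<longlongrightarrow> 0) F" and b: "(b \<longlongrightarrow> 0) F" and d: "(d \<longlongrightarrow> 0) F"
  shows "((\<lambda>\<tau>. localizer A (m \<tau>) (a \<tau>) (b \<tau>) (d \<tau>)) \<longlongrightarrow> 1) F"
proof -
  have "((\<lambda>\<tau>. ((1 + cos (d \<tau>)) / 2) ^ m \<tau>) \<longlongrightarrow> 1) F"
  proof (rule tendsto_sandwich[OF always_eventually always_eventually])
    show "((\<lambda>\<tau>. 1 - real (n \<tau>) * d \<tau> * d \<tau> / 4) \<longlongrightarrow> 1) F"
      using tendsto_diff[OF tendsto_const[of 1] tendsto_divide[OF tendsto_mult[OF na d] tendsto_const[of 4]]] by simp
    show "((\<lambda>_. 1) \<longlongrightarrow> (1::real)) F" by (rule tendsto_const)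
    show "\<forall>\<tau>. 1 - real (n \<tau>) * d \<tau> * d \<tau> / 4 \<le> ((1 + cos (d \<tau>)) / 2) ^ m \<tau>"
    proof
      fix \<tau>
      define e where "e = (1 - cos (d \<tau>)) / 2"
      have e: "e \<le> 1" "0 \<le> e" "e \<le> d \<tau> * d \<tau> / 4"
        using bump_bounds(1)[of "d \<tau>"] cos_le_one[of "d \<tau>"] one_minus_cos_le[of "d \<tau>"]
        by (auto simp: e_def power2_eq_square field_simps)
      have "real (m \<tau>) * e \<le> real (n \<tau>) * (d \<tau> * d \<tau> / 4)"
        using e m[of \<tau>] by (intro mult_mono) auto
      moreover have "1 + real (m \<tau>) * (- e) \<le> (1 + (- e)) ^ m \<tau>"
        by (rule Bernoulli_inequality) (use e in simp)
      moreover have q: "(1 + cos (d \<tau>)) / 2 = 1 + (- e)" by (simp add: e_def field_simps)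
      ultimately show "1 - real (n \<tau>) * d \<tau> * d \<tau> / 4 \<le> ((1 + cos (d \<tau>)) / 2) ^ m \<tau>"
        unfolding q by (simp add: mult.assoc)
    qed
    show "\<forall>\<tau>. ((1 + cos (d \<tau>)) / 2) ^ m \<tau> \<le> 1"
      using bump_bounds by (auto intro: power_le_one)
  qed
  moreover have "((\<lambda>\<tau>. cos (d \<tau>)) \<longlongrightarrow> 1) F" "((\<lambda>\<tau>. cos (d \<tau> + a \<tau>)) \<longlongrightarrow> 1) F" "((\<lambda>\<tau>. cos (d \<tau> + b \<tau>)) \<longlongrightarrow> 1) F"
    using isCont_tendsto_compose[OF isCont_cos d] isCont_tendsto_compose[OF isCont_cos tendsto_add[OF d a]]
      isCont_tendsto_compose[OF isCont_cos tendsto_add[OF d b]] by simp_all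
  ultimately have "((\<lambda>\<tau>. localizer A (m \<tau>) (a \<tau>) (b \<tau>) (d \<tau>)) \<longlongrightarrow> 1 ^ A * 1 * ((1 + 1) / 2) * ((1 + 1) / 2)) F"
    unfolding localizer_def
    by (intro tendsto_mult tendsto_power tendsto_divide tendsto_add tendsto_const) auto
  then show ?thesis by simp
qed

section \<open>Passage to the limit\<close>

lemma arcsin_scaled:
  assumes n: "filterlim n sequentially F" and X: "(X \<longlongrightarrow> x) F"
  shows "((\<lambda>\<tau>. arcsin (pi * X \<tau> / real (n \<tau>))) \<longlongrightarrow> 0) F"
    and "((\<lambda>\<tau>. real (n \<tau>) * arcsin (pi * X \<tau> / real (n \<tau>))) \<longlongrightarrow> pi * x) F"
    and "\<forall>\<^sub>F \<tau> in F. sin (arcsin (pi * X \<tau> / real (n \<tau>))) = pi * X \<tau> / real (n \<tau>)"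
proof -
  define y where "y \<tau> = pi * X \<tau> / real (n \<tau>)" for \<tau>
  have "((\<lambda>\<tau>. pi * X \<tau> * inverse (real (n \<tau>))) \<longlongrightarrow> pi * x * 0) F"
    by (intro tendsto_intros X filterlim_compose[OF lim_inverse_n n])
  then have y: "(y \<longlongrightarrow> 0) F" by (simp add: y_def[abs_def] divide_inverse)
  have "isCont arcsin 0" by (rule isCont_arcsin) auto
  from isCont_tendsto_compose[OF this y] show "((\<lambda>\<tau>. arcsin (pi * X \<tau> / real (n \<tau>))) \<longlongrightarrow> 0) F"
    by (simp add: y_def)
  have "DERIV arcsin 0 :> 1" using DERIV_arcsin[of 0] by simp
  then have "((\<lambda>h. arcsin h / h) \<longlongrightarrow> 1) (at 0)" by (simp add: DERIV_def)
  then have g: "isCont (\<lambda>h. if h = 0 then 1 else arcsin h / h) 0"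
    unfolding isCont_def by (simp, elim Lim_transform_eventually) (auto simp: eventually_at intro!: exI[of _ 1])
  have "((\<lambda>\<tau>. (if y \<tau> = 0 then 1 else arcsin (y \<tau>) / y \<tau>) * (pi * X \<tau>)) \<longlongrightarrow> 1 * (pi * x)) F"
    using isCont_tendsto_compose[OF g y] by (intro tendsto_intros X) simp
  then have "((\<lambda>\<tau>. (if y \<tau> = 0 then 1 else arcsin (y \<tau>) / y \<tau>) * (pi * X \<tau>)) \<longlongrightarrow> pi * x) F" by simp
  then show "((\<lambda>\<tau>. real (n \<tau>) * arcsin (pi * X \<tau> / real (n \<tau>))) \<longlongrightarrow> pi * x) F"
  proof (rule Lim_transform_eventually)
    have "\<forall>\<^sub>F \<tau> in F. n \<tau> > 0"
      by (rule eventually_compose_filterlim[OF eventually_gt_at_top n])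
    then show "\<forall>\<^sub>F \<tau> in F. (if y \<tau> = 0 then 1 else arcsin (y \<tau>) / y \<tau>) * (pi * X \<tau>) = real (n \<tau>) * arcsin (pi * X \<tau> / real (n \<tau>))"
      by eventually_elim (auto simp: y_def)
  qed
  have "\<forall>\<^sub>F \<tau> in F. y \<tau> < 1" "\<forall>\<^sub>F \<tau> in F. -1 < y \<tau>"
    using order_tendstoD[OF y] by auto
  then show "\<forall>\<^sub>F \<tau> in F. sin (arcsin (pi * X \<tau> / real (n \<tau>))) = pi * X \<tau> / real (n \<tau>)"
    by eventually_elim (simp add: y_def)
qed

lemma floor_scaled:
  fixes n :: "'a \<Rightarrow> nat"
  assumes "0 < \<epsilon>" "\<epsilon> < 1" and n: "filterlim n sequentially F"
  defines "m \<equiv> \<lambda>\<tau>. nat \<lfloor>\<epsilon> * real (n \<tau>)\<rfloor>"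
  shows "m \<tau> \<le> n \<tau>" and "\<forall>\<^sub>F \<tau> in F. m0 \<le> m \<tau>"
    and "((\<lambda>\<tau>. real (m \<tau>) / real (n \<tau>)) \<longlongrightarrow> \<epsilon>) F"
proof -
  have m: "real (m \<tau>) \<le> \<epsilon> * real (n \<tau>)" "\<epsilon> * real (n \<tau>) - 1 \<le> real (m \<tau>)" for \<tau>
    using assms(1) unfolding m_def by (simp_all add: of_nat_nat)
  show "m \<tau> \<le> n \<tau>"
  proof -
    have "\<epsilon> * real (n \<tau>) \<le> 1 * real (n \<tau>)" using assms by (intro mult_right_mono) auto
    then have "real (m \<tau>) \<le> real (n \<tau>)" using m(1)[of \<tau>] by linarith
    then show ?thesis by simp
  qed
  have ev: "\<forall>\<^sub>F \<tau> in F. n \<tau> > 0"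
    by (rule eventually_compose_filterlim[OF eventually_gt_at_top n])
  have "\<forall>\<^sub>F \<tau> in F. nat \<lceil>(real m0 + 1) / \<epsilon>\<rceil> \<le> n \<tau>"
    by (rule eventually_compose_filterlim[OF eventually_ge_at_top n])
  then show "\<forall>\<^sub>F \<tau> in F. m0 \<le> m \<tau>"
  proof eventually_elim
    case (elim \<tau>)
    then have "(real m0 + 1) / \<epsilon> \<le> real (n \<tau>)" by linarith
    then have "real m0 + 1 \<le> \<epsilon> * real (n \<tau>)" using assms(1) by (simp add: field_simps)
    then have "real m0 \<le> real (m \<tau>)" using m(2)[of \<tau>] by linarith
    then show ?case by simp
  qed
  show "((\<lambda>\<tau>. real (m \<tau>) / real (n \<tau>)) \<longlongrightarrow> \<epsilon>) F"
  proof (rule tendsto_sandwich)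
    have "((\<lambda>\<tau>. \<epsilon> - inverse (real (n \<tau>))) \<longlongrightarrow> \<epsilon> - 0) F"
      by (intro tendsto_intros filterlim_compose[OF lim_inverse_n n])
    then show "((\<lambda>\<tau>. \<epsilon> - inverse (real (n \<tau>))) \<longlongrightarrow> \<epsilon>) F" by simp
    show "((\<lambda>_. \<epsilon>) \<longlongrightarrow> \<epsilon>) F" by (rule tendsto_const)
    show "\<forall>\<^sub>F \<tau> in F. \<epsilon> - inverse (real (n \<tau>)) \<le> real (m \<tau>) / real (n \<tau>)"
      using ev
    proof eventually_elim
      case (elim \<tau>)
      have "(\<epsilon> * real (n \<tau>) - 1) / real (n \<tau>) \<le> real (m \<tau>) / real (n \<tau>)"
        by (rule divide_right_mono[OF m(2)]) simp
      then show ?case using elim by (simp add: diff_divide_distrib inverse_eq_divide)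
    qed
    show "\<forall>\<^sub>F \<tau> in F. real (m \<tau>) / real (n \<tau>) \<le> \<epsilon>"
      using ev by eventually_elim (use m(1) in \<open>simp add: field_simps\<close>)
  qed
qed

context jump_jacobi begin

text \<open>\<open>two_point_upper\<close> is applied with the coefficients \<open>1 / La\<close>
  and \<open>t / Lb\<close>, so that the localizer values cancel on the interval side; on the circle
  side they tend to 1.\<close>

lemma two_point_eventually_less:
  fixes n :: "'a \<Rightarrow> nat"
  assumes F: "F \<noteq> bot" and n: "filterlim n sequentially F" and X: "(X \<longlongrightarrow> x) F" and Y: "(Y \<longlongrightarrow> y) F"
    and eps: "0 < \<epsilon>" "\<epsilon> < 1" and v: "(1 + \<epsilon>) / h 0 * ((1 + \<epsilon>) * q_inf c t ((1 + \<epsilon>) * x) ((1 + \<epsilon>) * y)) < v"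
  shows "\<forall>\<^sub>F \<tau> in F. pi / real (n \<tau>) * two_point p_fun (n \<tau>) 1 t (pi * X \<tau> / real (n \<tau>)) (pi * Y \<tau> / real (n \<tau>)) < v"
proof -
  obtain A m0 where loc: "\<And>m a b \<theta>. m \<ge> m0 \<Longrightarrow> \<theta> \<in> {-pi/2..pi/2} \<Longrightarrow>
     (localizer A m a b \<theta>)\<^sup>2 * arc_weight c \<theta> + (localizer A m a b (pi - \<theta>))\<^sup>2 * refl_weight c \<theta> \<le> (1 + \<epsilon>) / h 0 * polar_weight \<theta>"
    by (rule localized_weights[OF eps(1)]) blast
  define m where "m \<tau> = nat \<lfloor>\<epsilon> * real (n \<tau>)\<rfloor>" for \<tau>
  note m = floor_scaled[OF eps n, folded m_def]
  define a where "a \<tau> = arcsin (pi * X \<tau> / real (n \<tau>))" for \<tau>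
  define b where "b \<tau> = arcsin (pi * Y \<tau> / real (n \<tau>))" for \<tau>
  note a = arcsin_scaled[OF n X, folded a_def] and b = arcsin_scaled[OF n Y, folded b_def]
  define N where "N \<tau> = n \<tau> + A + m \<tau> + 1" for \<tau>
  define La where "La \<tau> = localizer A (m \<tau>) (a \<tau>) (b \<tau>) (a \<tau>)" for \<tau>
  define Lb where "Lb \<tau> = localizer A (m \<tau>) (a \<tau>) (b \<tau>) (b \<tau>)" for \<tau>
  have La: "(La \<longlongrightarrow> 1) F" unfolding La_def by (rule localizer_tendsto_1[OF n m(1) a(2) a(1) b(1) a(1)])
  have Lb: "(Lb \<longlongrightarrow> 1) F" unfolding Lb_def by (rule localizer_tendsto_1[OF n m(1) b(2) a(1) b(1) b(1)])
  have N: "filterlim N sequentially F"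
    by (rule filterlim_at_top_mono[OF n]) (simp add: N_def)
  have ev: "\<forall>\<^sub>F \<tau> in F. n \<tau> > 0"
    by (rule eventually_compose_filterlim[OF eventually_gt_at_top n])
  have r: "((\<lambda>\<tau>. real (2 * N \<tau> + 1) / real (n \<tau>)) \<longlongrightarrow> 2 * (1 + \<epsilon>)) F"
  proof (rule Lim_transform_eventually)
    have "((\<lambda>\<tau>. 2 + 2 * (real (m \<tau>) / real (n \<tau>)) + (2 * real A + 3) * inverse (real (n \<tau>)))
        \<longlongrightarrow> 2 + 2 * \<epsilon> + (2 * real A + 3) * 0) F"
      by (intro tendsto_intros m filterlim_compose[OF lim_inverse_n n])
    then show "((\<lambda>\<tau>. 2 + 2 * (real (m \<tau>) / real (n \<tau>)) + (2 * real A + 3) * inverse (real (n \<tau>))) \<longlongrightarrow> 2 * (1 + \<epsilon>)) F"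
      by simp
    show "\<forall>\<^sub>F \<tau> in F. 2 + 2 * (real (m \<tau>) / real (n \<tau>)) + (2 * real A + 3) * inverse (real (n \<tau>)) = real (2 * N \<tau> + 1) / real (n \<tau>)"
      using ev by eventually_elim (simp add: N_def field_simps)
  qed
  have "((\<lambda>\<tau>. pi / real (n \<tau>) * two_point (circ_basis c (N \<tau>)) (2 * N \<tau> + 1) (1 / La \<tau>) (t / Lb \<tau>) (a \<tau>) (b \<tau>))
      \<longlongrightarrow> (1 + \<epsilon>) * q_inf c t ((1 + \<epsilon>) * x) ((1 + \<epsilon>) * y)) F"
  proof (rule circ_two_point_tendsto[OF c F N n r a(2) b(2)])
    show "((\<lambda>\<tau>. 1 / La \<tau>) \<longlongrightarrow> 1) F" using tendsto_divide[OF tendsto_const[of 1] La] by simp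
    show "((\<lambda>\<tau>. t / Lb \<tau>) \<longlongrightarrow> t) F" using tendsto_divide[OF tendsto_const[of t] Lb] by simp
  qed
  from tendsto_mult[OF tendsto_const[of "(1 + \<epsilon>) / h 0"] this]
  have "\<forall>\<^sub>F \<tau> in F. (1 + \<epsilon>) / h 0 * (pi / real (n \<tau>) * two_point (circ_basis c (N \<tau>)) (2 * N \<tau> + 1) (1 / La \<tau>) (t / Lb \<tau>) (a \<tau>) (b \<tau>)) < v"
    using v by (rule order_tendstoD)
  moreover have "\<forall>\<^sub>F \<tau> in F. La \<tau> > 0" "\<forall>\<^sub>F \<tau> in F. Lb \<tau> > 0"
    using order_tendstoD(1)[OF La, of 0] order_tendstoD(1)[OF Lb, of 0] by auto
  ultimately show ?thesis
    using ev m(2)[of m0] a(3) b(3)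
  proof eventually_elim
    case (elim \<tau>)
    have "two_point p_fun (n \<tau>) (1 / La \<tau> * localizer A (m \<tau>) (a \<tau>) (b \<tau>) (a \<tau>)) (t / Lb \<tau> * localizer A (m \<tau>) (a \<tau>) (b \<tau>) (b \<tau>)) (sin (a \<tau>)) (sin (b \<tau>))
      \<le> (1 + \<epsilon>) / h 0 * two_point (circ_basis c (N \<tau>)) (2 * N \<tau> + 1) (1 / La \<tau>) (t / Lb \<tau>) (a \<tau>) (b \<tau>)"
      by (rule two_point_upper[OF eps(1) elim(4) loc[OF elim(5)] N_def])
    then have "two_point p_fun (n \<tau>) 1 t (pi * X \<tau> / real (n \<tau>)) (pi * Y \<tau> / real (n \<tau>))
      \<le> (1 + \<epsilon>) / h 0 * two_point (circ_basis c (N \<tau>)) (2 * N \<tau> + 1) (1 / La \<tau>) (t / Lb \<tau>) (a \<tau>) (b \<tau>)"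
      using elim(2,3,6,7) by (simp add: La_def[symmetric] Lb_def[symmetric])
    then have "pi / real (n \<tau>) * two_point p_fun (n \<tau>) 1 t (pi * X \<tau> / real (n \<tau>)) (pi * Y \<tau> / real (n \<tau>))
      \<le> pi / real (n \<tau>) * ((1 + \<epsilon>) / h 0 * two_point (circ_basis c (N \<tau>)) (2 * N \<tau> + 1) (1 / La \<tau>) (t / Lb \<tau>) (a \<tau>) (b \<tau>))"
      by (intro mult_left_mono) auto
    also have "\<dots> < v" using elim(1) by (simp only: mult.left_commute)
    finally show ?case .
  qed
qed

text \<open>Here the degree is spent the other way round: the circle problem gets the smaller degree
  \<open>n - (A + m + 3)\<close>, hence the dilation \<open>1 - \<epsilon>\<close>, and the
  localizer values stay on the circle side.\<close>

lemma two_point_eventually_greater: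
  fixes n :: "'a \<Rightarrow> nat"
  assumes F: "F \<noteq> bot" and n: "filterlim n sequentially F" and X: "(X \<longlongrightarrow> x) F" and Y: "(Y \<longlongrightarrow> y) F"
    and eps: "0 < \<epsilon>" "\<epsilon> < 1" and v: "v < 1 / ((1 + \<epsilon>)\<^sup>2 * h 0) * ((1 - \<epsilon>) * q_inf c t ((1 - \<epsilon>) * x) ((1 - \<epsilon>) * y))"
  shows "\<forall>\<^sub>F \<tau> in F. v < pi / real (n \<tau>) * two_point p_fun (n \<tau>) 1 t (pi * X \<tau> / real (n \<tau>)) (pi * Y \<tau> / real (n \<tau>))"
proof -
  obtain A m0 where loc: "\<And>m a b \<theta>. m \<ge> m0 \<Longrightarrow> \<theta> \<in> {-pi/2..pi/2} \<Longrightarrow>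
       (localizer A m a b \<theta>)\<^sup>2 * polar_weight \<theta> \<le> (1 + \<epsilon>) * h 0 * arc_weight c \<theta>"
    "\<And>m a b \<theta>. m \<ge> m0 \<Longrightarrow> \<theta> \<in> {-pi/2..pi/2} \<Longrightarrow>
       (1 + 1 / \<epsilon>) * (localizer A m a b (pi - \<theta>))\<^sup>2 * polar_weight \<theta> \<le> (1 + \<epsilon>) * h 0 * refl_weight c \<theta>"
    by (rule localized_weights[OF eps(1)]) blast
  define m where "m \<tau> = nat \<lfloor>\<epsilon> * real (n \<tau>)\<rfloor>" for \<tau>
  note m = floor_scaled[OF eps n, folded m_def]
  define a where "a \<tau> = arcsin (pi * X \<tau> / real (n \<tau>))" for \<tau>
  define b where "b \<tau> = arcsin (pi * Y \<tau> / real (n \<tau>))" for \<tau>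
  note a = arcsin_scaled[OF n X, folded a_def] and b = arcsin_scaled[OF n Y, folded b_def]
  define N where "N \<tau> = n \<tau> - (A + m \<tau> + 3)" for \<tau>
  define La where "La \<tau> = localizer A (m \<tau>) (a \<tau>) (b \<tau>) (a \<tau>)" for \<tau>
  define Lb where "Lb \<tau> = localizer A (m \<tau>) (a \<tau>) (b \<tau>) (b \<tau>)" for \<tau>
  have La: "(La \<longlongrightarrow> 1) F" unfolding La_def by (rule localizer_tendsto_1[OF n m(1) a(2) a(1) b(1) a(1)])
  have Lb: "(Lb \<longlongrightarrow> 1) F" unfolding Lb_def by (rule localizer_tendsto_1[OF n m(1) b(2) a(1) b(1) b(1)])
  have ev: "\<forall>\<^sub>F \<tau> in F. n \<tau> > 0"
    by (rule eventually_compose_filterlim[OF eventually_gt_at_top n])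
  \<comment> \<open>Since \<open>\<epsilon> < 1\<close>, the subtraction of natural numbers in
    \<open>N\<close> is eventually not truncated, and \<open>N\<close> tends to infinity.\<close>
  have large: "\<forall>\<^sub>F \<tau> in F. A + m \<tau> + 3 + Z \<le> n \<tau>" for Z
  proof -
    have "\<forall>\<^sub>F \<tau> in F. nat \<lceil>(real A + 3 + real Z) / (1 - \<epsilon>)\<rceil> \<le> n \<tau>"
      by (rule eventually_compose_filterlim[OF eventually_ge_at_top n])
    then show ?thesis
    proof eventually_elim
      case (elim \<tau>)
      then have "(real A + 3 + real Z) / (1 - \<epsilon>) \<le> real (n \<tau>)" by linarith
      then have "real A + 3 + real Z \<le> real (n \<tau>) - \<epsilon> * real (n \<tau>)" using eps by (simp add: field_simps)
      moreover have "real (m \<tau>) \<le> \<epsilon> * real (n \<tau>)" unfolding m_def using eps by (simp add: of_nat_nat)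
      ultimately have "real (A + m \<tau> + 3 + Z) \<le> real (n \<tau>)" by simp
      then show ?case by (simp only: of_nat_le_iff)
    qed
  qed
  have N: "filterlim N sequentially F"
    unfolding filterlim_at_top
  proof
    fix Z
    show "\<forall>\<^sub>F \<tau> in F. Z \<le> N \<tau>" using large[of Z] by eventually_elim (simp add: N_def)
  qed
  have r: "((\<lambda>\<tau>. real (2 * N \<tau> + 1) / real (n \<tau>)) \<longlongrightarrow> 2 * (1 - \<epsilon>)) F"
  proof (rule Lim_transform_eventually)
    have "((\<lambda>\<tau>. 2 - 2 * (real (m \<tau>) / real (n \<tau>)) - (2 * real A + 5) * inverse (real (n \<tau>)))
        \<longlongrightarrow> 2 - 2 * \<epsilon> - (2 * real A + 5) * 0) F"
      by (intro tendsto_intros m filterlim_compose[OF lim_inverse_n n])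
    then show "((\<lambda>\<tau>. 2 - 2 * (real (m \<tau>) / real (n \<tau>)) - (2 * real A + 5) * inverse (real (n \<tau>))) \<longlongrightarrow> 2 * (1 - \<epsilon>)) F"
      by simp
    show "\<forall>\<^sub>F \<tau> in F. 2 - 2 * (real (m \<tau>) / real (n \<tau>)) - (2 * real A + 5) * inverse (real (n \<tau>)) = real (2 * N \<tau> + 1) / real (n \<tau>)"
      using ev large[of 0]
    proof eventually_elim
      case (elim \<tau>)
      have "real (N \<tau>) = real (n \<tau>) - real A - real (m \<tau>) - 3"
        using elim by (simp add: N_def of_nat_diff)
      then have N': "real (2 * N \<tau> + 1) = 2 * real (n \<tau>) - 2 * real (m \<tau>) - (2 * real A + 5)" by simp
      show ?case unfolding N' using elim(1) by (simp add: field_simps)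
    qed
  qed
  have "((\<lambda>\<tau>. pi / real (n \<tau>) * two_point (circ_basis c (N \<tau>)) (2 * N \<tau> + 1) (La \<tau>) (t * Lb \<tau>) (a \<tau>) (b \<tau>))
      \<longlongrightarrow> (1 - \<epsilon>) * q_inf c t ((1 - \<epsilon>) * x) ((1 - \<epsilon>) * y)) F"
  proof (rule circ_two_point_tendsto[OF c F N n r a(2) b(2) La])
    show "((\<lambda>\<tau>. t * Lb \<tau>) \<longlongrightarrow> t) F" using tendsto_mult[OF tendsto_const[of t] Lb] by simp
  qed
  from tendsto_mult[OF tendsto_const[of "1 / ((1 + \<epsilon>)\<^sup>2 * h 0)"] this]
  have "\<forall>\<^sub>F \<tau> in F. v < 1 / ((1 + \<epsilon>)\<^sup>2 * h 0) * (pi / real (n \<tau>) * two_point (circ_basis c (N \<tau>)) (2 * N \<tau> + 1) (La \<tau>) (t * Lb \<tau>) (a \<tau>) (b \<tau>))"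
    using v by (rule order_tendstoD)
  then show ?thesis
    using large[of 0] m(2)[of m0] a(3) b(3)
  proof eventually_elim
    case (elim \<tau>)
    have n': "n \<tau> = N \<tau> + A + m \<tau> + 3" using elim(2) by (simp add: N_def)
    define D where "D = (1 + \<epsilon>)\<^sup>2 * h 0"
    have D: "D > 0" using eps h0 by (simp add: D_def)
    have "two_point (circ_basis c (N \<tau>)) (2 * N \<tau> + 1) (1 * localizer A (m \<tau>) (a \<tau>) (b \<tau>) (a \<tau>)) (t * localizer A (m \<tau>) (a \<tau>) (b \<tau>) (b \<tau>)) (a \<tau>) (b \<tau>)
      \<le> (1 + \<epsilon>)\<^sup>2 * h 0 * two_point p_fun (n \<tau>) 1 t (sin (a \<tau>)) (sin (b \<tau>))"
      by (rule two_point_lower[OF eps(1) loc(1)[OF elim(3)] loc(2)[OF elim(3)] n'])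
    then have "two_point (circ_basis c (N \<tau>)) (2 * N \<tau> + 1) (La \<tau>) (t * Lb \<tau>) (a \<tau>) (b \<tau>)
      \<le> D * two_point p_fun (n \<tau>) 1 t (pi * X \<tau> / real (n \<tau>)) (pi * Y \<tau> / real (n \<tau>))"
      unfolding elim(4,5) La_def Lb_def D_def mult_1_left .
    then have "1 / D * (pi / real (n \<tau>)) * two_point (circ_basis c (N \<tau>)) (2 * N \<tau> + 1) (La \<tau>) (t * Lb \<tau>) (a \<tau>) (b \<tau>)
      \<le> 1 / D * (pi / real (n \<tau>)) * (D * two_point p_fun (n \<tau>) 1 t (pi * X \<tau> / real (n \<tau>)) (pi * Y \<tau> / real (n \<tau>)))"
      using D by (intro mult_left_mono) auto
    also have "\<dots> = pi / real (n \<tau>) * two_point p_fun (n \<tau>) 1 t (pi * X \<tau> / real (n \<tau>)) (pi * Y \<tau> / real (n \<tau>))"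
      using D by simp
    finally show ?case using elim(1) unfolding D_def[symmetric] by (simp only: mult.assoc)
  qed
qed

lemma q_inf_tendsto:
  assumes "(r \<longlongrightarrow> 1) F"
  shows "((\<lambda>\<epsilon>. q_inf c t (r \<epsilon> * x) (r \<epsilon> * y)) \<longlongrightarrow> q_inf c t x y) F"
proof -
  have k: "((\<lambda>\<epsilon>. k_inf c (r \<epsilon> * z) (r \<epsilon> * z')) \<longlongrightarrow> k_inf c z z') F" for z z'
  proof -
    have "((\<lambda>\<epsilon>. (r \<epsilon> * z, r \<epsilon> * z')) \<longlongrightarrow> (1 * z, 1 * z')) F"
      by (intro tendsto_intros assms)
    then have "((\<lambda>\<epsilon>. (r \<epsilon> * z, r \<epsilon> * z')) \<longlongrightarrow> (z, z')) F" by simp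
    from isCont_tendsto_compose[OF isCont_k_inf[OF c] this] show ?thesis by simp
  qed
  show ?thesis unfolding q_inf_def by (intro tendsto_intros k)
qed

text \<open>A bound \<open>v\<close> strictly beyond the limit leaves room to fix
  \<open>\<epsilon>\<close> first, by continuity of \<open>q_inf\<close> under dilation; only then
  is the limit along \<open>F\<close> taken.\<close>

lemma two_point_tendsto:
  fixes n :: "'a \<Rightarrow> nat"
  assumes F: "F \<noteq> bot" and n: "filterlim n sequentially F" and X: "(X \<longlongrightarrow> x) F" and Y: "(Y \<longlongrightarrow> y) F"
  shows "((\<lambda>\<tau>. pi / real (n \<tau>) * two_point p_fun (n \<tau>) 1 t (pi * X \<tau> / real (n \<tau>)) (pi * Y \<tau> / real (n \<tau>)))
     \<longlongrightarrow> q_inf c t x y / h 0) F"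
proof (rule order_tendstoI)
  have small: "\<forall>\<^sub>F \<epsilon> in at_right (0::real). 0 < \<epsilon> \<and> \<epsilon> < 1"
    unfolding eventually_at_right_field by (intro exI[of _ 1]) auto
  fix v assume v: "q_inf c t x y / h 0 < v"
  have "((\<lambda>\<epsilon>. 1 + \<epsilon>) \<longlongrightarrow> 1 + 0) (at_right (0::real))"
    by (intro tendsto_intros)
  then have r: "((\<lambda>\<epsilon>. 1 + \<epsilon>) \<longlongrightarrow> 1) (at_right (0::real))" by simp
  have "((\<lambda>\<epsilon>. (1 + \<epsilon>) / h 0 * ((1 + \<epsilon>) * q_inf c t ((1 + \<epsilon>) * x) ((1 + \<epsilon>) * y))) \<longlongrightarrow> 1 / h 0 * (1 * q_inf c t x y)) (at_right (0::real))"
    using h0 by (intro tendsto_mult tendsto_divide r q_inf_tendsto tendsto_const) auto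
  then have "\<forall>\<^sub>F \<epsilon> in at_right (0::real). (1 + \<epsilon>) / h 0 * ((1 + \<epsilon>) * q_inf c t ((1 + \<epsilon>) * x) ((1 + \<epsilon>) * y)) < v"
    by (rule order_tendstoD) (use v in simp)
  with small have "\<forall>\<^sub>F \<epsilon> in at_right (0::real). (0 < \<epsilon> \<and> \<epsilon> < 1) \<and> (1 + \<epsilon>) / h 0 * ((1 + \<epsilon>) * q_inf c t ((1 + \<epsilon>) * x) ((1 + \<epsilon>) * y)) < v"
    by (rule eventually_conj)
  from eventually_happens'[OF trivial_limit_at_right_real this] obtain \<epsilon> :: real
    where "0 < \<epsilon>" "\<epsilon> < 1" "(1 + \<epsilon>) / h 0 * ((1 + \<epsilon>) * q_inf c t ((1 + \<epsilon>) * x) ((1 + \<epsilon>) * y)) < v" by blast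
  then show "\<forall>\<^sub>F \<tau> in F. pi / real (n \<tau>) * two_point p_fun (n \<tau>) 1 t (pi * X \<tau> / real (n \<tau>)) (pi * Y \<tau> / real (n \<tau>)) < v"
    by (rule two_point_eventually_less[OF F n X Y])
next
  have small: "\<forall>\<^sub>F \<epsilon> in at_right (0::real). 0 < \<epsilon> \<and> \<epsilon> < 1"
    unfolding eventually_at_right_field by (intro exI[of _ 1]) auto
  fix v assume v: "v < q_inf c t x y / h 0"
  have "((\<lambda>\<epsilon>. 1 - \<epsilon>) \<longlongrightarrow> 1 - 0) (at_right (0::real))" "((\<lambda>\<epsilon>. 1 + \<epsilon>) \<longlongrightarrow> 1 + 0) (at_right (0::real))"
    by (intro tendsto_intros)+
  then have r: "((\<lambda>\<epsilon>. 1 - \<epsilon>) \<longlongrightarrow> 1) (at_right (0::real))" "((\<lambda>\<epsilon>. 1 + \<epsilon>) \<longlongrightarrow> 1) (at_right (0::real))" by simp_all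
  have "((\<lambda>\<epsilon>. 1 / ((1 + \<epsilon>)\<^sup>2 * h 0) * ((1 - \<epsilon>) * q_inf c t ((1 - \<epsilon>) * x) ((1 - \<epsilon>) * y))) \<longlongrightarrow> 1 / (1\<^sup>2 * h 0) * (1 * q_inf c t x y)) (at_right (0::real))"
    using h0 by (intro tendsto_mult tendsto_divide tendsto_power r q_inf_tendsto tendsto_const) auto
  then have "\<forall>\<^sub>F \<epsilon> in at_right (0::real). v < 1 / ((1 + \<epsilon>)\<^sup>2 * h 0) * ((1 - \<epsilon>) * q_inf c t ((1 - \<epsilon>) * x) ((1 - \<epsilon>) * y))"
    by (rule order_tendstoD) (use v in simp)
  with small have "\<forall>\<^sub>F \<epsilon> in at_right (0::real). (0 < \<epsilon> \<and> \<epsilon> < 1) \<and> v < 1 / ((1 + \<epsilon>)\<^sup>2 * h 0) * ((1 - \<epsilon>) * q_inf c t ((1 - \<epsilon>) * x) ((1 - \<epsilon>) * y))"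
    by (rule eventually_conj)
  from eventually_happens'[OF trivial_limit_at_right_real this] obtain \<epsilon> :: real
    where "0 < \<epsilon>" "\<epsilon> < 1" "v < 1 / ((1 + \<epsilon>)\<^sup>2 * h 0) * ((1 - \<epsilon>) * q_inf c t ((1 - \<epsilon>) * x) ((1 - \<epsilon>) * y))" by blast
  then show "\<forall>\<^sub>F \<tau> in F. v < pi / real (n \<tau>) * two_point p_fun (n \<tau>) 1 t (pi * X \<tau> / real (n \<tau>)) (pi * Y \<tau> / real (n \<tau>))"
    by (rule two_point_eventually_greater[OF F n X Y])
qed

lemma christoffel_darboux_polarization:
  "4 * christoffel_darboux p n a b = two_point p_fun n 1 1 a b - two_point p_fun n 1 (- 1) a b"
  unfolding two_point_kernel by (simp add: christoffel_darboux_def p_fun_def)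

text \<open>The forms with \<open>t = 1\<close> and \<open>t = -1\<close> recover the kernel by
  polarization; since the limit kernel is real, nothing is lost in passing to real parts.
  Convergence at every \<open>z\<close> along the product filter is the form from which uniformity
  on compact sets follows.\<close>

lemma christoffel_darboux_tendsto:
  "((\<lambda>(n, x, y). complex_of_real (pi / real n * christoffel_darboux p n (pi * x / real n) (pi * y / real n)))
      \<longlongrightarrow> (case z of (x, y) \<Rightarrow> K_inf h c x y)) (sequentially \<times>\<^sub>F nhds z)"
proof -
  obtain x y where z: "z = (x, y)" by (cases z)
  let ?F = "sequentially \<times>\<^sub>F nhds (x, y)"
  have n: "filterlim fst sequentially ?F" by (rule filterlim_fst)
  have s: "filterlim snd (nhds (x, y)) ?F" by (rule filterlim_snd)
  have X: "((\<lambda>\<tau>. fst (snd \<tau>)) \<longlongrightarrow> x) ?F" and Y: "((\<lambda>\<tau>. snd (snd \<tau>)) \<longlongrightarrow> y) ?F"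
    using tendsto_fst[OF s] tendsto_snd[OF s] by simp_all
  have F: "?F \<noteq> bot" by (simp add: prod_filter_eq_bot)
  note lim = two_point_tendsto[OF F n X Y]
  have "K_inf h c x y = complex_of_real ((q_inf c 1 x y / h 0 - q_inf c (- 1) x y / h 0) / 4)"
    using k_inf_real[OF c, of x y] h0
    by (simp add: K_inf_scale q_inf_def complex_eq_iff diff_divide_distrib[symmetric])
  moreover have "pi / real n * christoffel_darboux p n a b
      = (pi / real n * two_point p_fun n 1 1 a b - pi / real n * two_point p_fun n 1 (- 1) a b) / 4" for n a b
    unfolding right_diff_distrib[symmetric] christoffel_darboux_polarization[symmetric] by simp
  moreover have "((\<lambda>\<tau>. complex_of_real ((pi / real (fst \<tau>) * two_point p_fun (fst \<tau>) 1 1 (pi * fst (snd \<tau>) / real (fst \<tau>)) (pi * snd (snd \<tau>) / real (fst \<tau>))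
       - pi / real (fst \<tau>) * two_point p_fun (fst \<tau>) 1 (- 1) (pi * fst (snd \<tau>) / real (fst \<tau>)) (pi * snd (snd \<tau>) / real (fst \<tau>))) / 4))
     \<longlongrightarrow> complex_of_real ((q_inf c 1 x y / h 0 - q_inf c (- 1) x y / h 0) / 4)) ?F"
    by (intro tendsto_of_real tendsto_divide tendsto_diff lim tendsto_const) simp
  ultimately show ?thesis
    unfolding z case_prod_unfold by (simp only: fst_conv snd_conv)
qed

end

theorem theorem11:
  fixes \<alpha> \<beta> c \<delta> :: real and h :: "real \<Rightarrow> real" and p :: "nat \<Rightarrow> real poly"
  assumes "\<alpha> > -1" and "\<beta> > -1"
    and "h real_analytic_on {-1..1}" and "\<forall>x\<in>{-1..1}. h x > 0"
    and "c > 0" and "c \<noteq> 1"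
    and "0 < \<delta>" and "\<delta> < 1"
    and "orthonormal_polys (jump_jacobi_weight \<alpha> \<beta> h c) p"
  shows "\<forall>C. compact C \<and> C \<subseteq> {-\<delta><..<\<delta>} \<times> {-\<delta><..<\<delta>} \<longrightarrow>
           uniform_limit C
             (\<lambda>n (x, y). complex_of_real
                (pi / real n * christoffel_darboux p n (pi * x / real n) (pi * y / real n)))
             (\<lambda>(x, y). K_inf h c x y)
             sequentially"
proof (intro allI impI)
  fix C assume C: "compact C \<and> C \<subseteq> {-\<delta><..<\<delta>} \<times> {-\<delta><..<\<delta>}"
  interpret jump_jacobi \<alpha> \<beta> c h p
    by standard (use assms real_analytic_on_imp_continuous_on in auto)
  show "uniform_limit C
             (\<lambda>n (x, y). complex_of_real
                (pi / real n * christoffel_darboux p n (pi * x / real n) (pi * y / real n)))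
             (\<lambda>(x, y). K_inf h c x y)
             sequentially"
    by (rule locally_uniform_limit_compact[OF christoffel_darboux_tendsto]) (use C in blast)
qed

end
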